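(* Let $f:M^n\to\varepsilon I\times_a\mathbb{Q}_s^{n+m}(c)$ be a spacelike isometric immersion, let $\{e_1,\dots,e_n,e_{n+1},\dots,e_{n+m+1}\}$ be an adapted frame on $M$, and let $b=\dfrac{\varepsilon(a')^2-c}{a^2}$. Then \begin{align*} \frac12\Delta|\alpha|^2=&\sum_\beta\sum_{i,j,k}h^\beta_{ij}h^\beta_{kkji}+|\nabla^\perp\alpha|^2+\sum_\beta\Big\langle\nabla\Big(\frac{a''}{a}-\varepsilon b\Big),(nA_\beta-(\mathrm{tr}A_\beta)\mathrm{Id})(T)\Big\rangle\langle\xi,e_\beta\rangle\\ &-\sum_\beta b'\Big\langle(nA_\beta-(\mathrm{tr}A_\beta)\mathrm{Id})(T),T\Big\rangle\langle\xi,e_\beta\rangle+\sum_\beta\Big(\frac{a''}{a}-\varepsilon b\Big)\Big(n\,\mathrm{tr}(A_\xi A_\beta)-(\mathrm{tr}A_\xi)(\mathrm{tr}A_\beta)\Big)\langle\xi,e_\beta\rangle\\ &+\sum_\beta\Big(\frac{a''}{a}-\varepsilon b\Big)\Big(3\langle A_\beta T,T\rangle\,\mathrm{tr}A_\beta-2n\|A_\beta T\|^2-\|T\|^2\,\mathrm{tr}A_\beta^2\Big)\\ &+\sum_\beta b\big((\mathrm{tr}A_\beta)^2-n\,\mathrm{tr}A_\beta^2\big)+\sum_{\beta,\gamma}\varepsilon_\gamma\Big((\mathrm{tr}A_\gamma)\,\mathrm{tr}(A_\beta^2A_\gamma)+\mathrm{tr}([A_\gamma,A_\beta]^2)-(\mathrm{tr}(A_\beta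 A_\gamma))^2\Big), \end{align*} where $A_\beta$ is the shape operator of $M$ with respect to $e_\beta\in TM^\perp$.
   Context: Ambient space: $\mathbb{Q}_s^{n+m}(c)$ is the $(n+m)$-dimensional semi-Riemannian space form of index $s$ and constant curvature $c$, with metric $g$; $I\subset\mathbb{R}$ is an open interval, $a:I\to\mathbb{R}_+$ is smooth and $\varepsilon\in\{-1,1\}$. The semi-Riemannian warped product $\varepsilon I\times_a\mathbb{Q}_s^{n+m}(c)$ is $I\times\mathbb{Q}_s^{n+m}(c)$ with metric $\langle\cdot,\cdot\rangle=\varepsilon\,\pi_I^*(dt^2)+a(\pi_I)^2\,\pi_{\mathbb{Q}}^*g$, where $\pi_I,\pi_{\mathbb{Q}}$ are the projections. $\partial_t$ is the coordinate vector field tangent to the factor $I$, so $\langle\partial_t,\partial_t\rangle=\varepsilon$. Immersion: $f$ is spacelike if the induced metric on $M$ is positive definite. $\nabla$ is the Levi-Civita connection of $M$, $\nabla^\perp$ the normal connection (and the connection it induces, together with $\nabla$, on $TM^\perp$-valued tensors), $\alpha$ the second fundamental form, and for normal $\eta$ the shape operator $A_\eta$ is defined by $\langle A_\eta X,Y\rangle=\langle\alpha(X,Y),\eta\rangle$. Along $M$, $\partial_t=T+\xi$ with $T$ tangent and $\xi$ normal to $M$. The functions $a,a',a'',b,b'$ of $t$ are regarded as functions on $M$ by composition with $\pi_I\circ f$ (primes are derivatives in $t$), and $\nabla(\cdot)$ of a function is its gradient on $M$. Adapted frame: $\{e_1,\dots,e_n\}$ is a local orthonormal frame of $TM$ (chosen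 with $(\nabla e_i)(p)=0$ at the point $p$ under consideration, where the formula is evaluated; $p$ is arbitrary), and $\{e_{n+1},\dots,e_{n+m+1}\}$ is a local frame of $TM^\perp$ with $\langle e_\gamma,e_\beta\rangle=\varepsilon_\gamma\delta_{\gamma\beta}$, $\varepsilon_\gamma\in\{-1,1\}$. Index ranges: $1\le i,j,k,l\le n$ and $n+1\le\beta,\gamma\le n+m+1$. $A_\beta=A_{e_\beta}$, $[A,B]=AB-BA$. Components: $h^\beta_{ij}=\langle\alpha(e_i,e_j),e_\beta\rangle$, $h^\beta_{ijk}=\langle(\nabla^\perp_{e_k}\alpha)(e_i,e_j),e_\beta\rangle$, $h^\beta_{ijkl}=\langle(\nabla^\perp_{e_l}\nabla^\perp_{e_k}\alpha)(e_i,e_j),e_\beta\rangle$ (second covariant derivative). Norms: $|\alpha|^2=\sum_\beta\sum_{i,j}(h^\beta_{ij})^2$ and $|\nabla^\perp\alpha|^2=\sum_\beta\sum_{i,j,k}(h^\beta_{ijk})^2$. $\Delta$ is the Laplacian of $M$, and $\mathrm{Id}$ is the identity of $TM$.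
   Formalization: If the normal metric is indefinite, the unsigned |α|² depends on the normal frame and the formula can fail; it is assumed that at p the operator J e_β = ε_β e_β satisfies ∇^⊥J = 0 and ΔJ = 0 (vacuous for definite normal metric, true for frames parallel along geodesics from p). *)

theory Defs
  imports "HOL-Analysis.Analysis"
begin

text \<open>
  Manifolds are given by atlases, tensor fields by their components in each chart. Pointwise
  differential geometry is then done in charts, that is, on open subsets of Euclidean spaces;
  all tangent spaces there are identified with the Euclidean space itself, so a vector field is a
  map into it, and a metric \<open>G\<close> assigns to a point \<open>x\<close> the bilinear form \<open>G x\<close>.
\<close>

primrec k_smooth_on ::
    "nat \<Rightarrow> ('a::real_normed_vector \<Rightarrow> 'b::real_normed_vector) \<Rightarrow> 'a set \<Rightarrow> bool" where
  "k_smooth_on 0 f S \<longleftrightarrow> continuous_on S f"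
| "k_smooth_on (Suc k) f S \<longleftrightarrow>
     (\<forall>x\<in>S. f differentiable (at x)) \<and>
     (\<forall>v. k_smooth_on k (\<lambda>x. frechet_derivative f (at x) v) S)"

text \<open>Only used for open sets \<open>S\<close>.\<close>

definition smooth_on :: "('a::real_normed_vector \<Rightarrow> 'b::real_normed_vector) \<Rightarrow> 'a set \<Rightarrow> bool" where
  "smooth_on f S \<longleftrightarrow> (\<forall>k. k_smooth_on k f S)"

type_synonym ('m, 'a) chart = "'m set \<times> ('m \<Rightarrow> 'a)"

definition smooth_atlas ::
    "('m::{t2_space,second_countable_topology}, 'a::euclidean_space) chart set \<Rightarrow> bool" where
  "smooth_atlas \<A> \<longleftrightarrow>
     (\<Union>(U, \<phi>)\<in>\<A>. U) = UNIV \<and>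
     (\<forall>(U, \<phi>)\<in>\<A>. open U \<and> open (\<phi> ` U) \<and> homeomorphism U (\<phi> ` U) \<phi> (inv_into U \<phi>)) \<and>
     (\<forall>(U, \<phi>)\<in>\<A>. \<forall>(V, \<psi>)\<in>\<A>. smooth_on (\<psi> \<circ> inv_into U \<phi>) (\<phi> ` (U \<inter> V)))"


definition metric_on :: "('a::euclidean_space \<Rightarrow> 'a \<Rightarrow> 'a \<Rightarrow> real) \<Rightarrow> 'a set \<Rightarrow> bool" where
  "metric_on G S \<longleftrightarrow>
     (\<forall>x\<in>S. bilinear (G x) \<and> (\<forall>u v. G x u v = G x v u) \<and>
            (\<forall>u. (\<forall>v. G x u v = 0) \<longrightarrow> u = 0)) \<and>
     (\<forall>u v. smooth_on (\<lambda>x. G x u v) S)"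

definition form_index :: "('a::euclidean_space \<Rightarrow> 'a \<Rightarrow> real) \<Rightarrow> nat" where
  "form_index B =
     (GREATEST k. \<exists>S. subspace S \<and> dim S = k \<and> (\<forall>u\<in>S. u \<noteq> 0 \<longrightarrow> B u u < 0))"

definition riesz :: "('a \<Rightarrow> 'a \<Rightarrow> real) \<Rightarrow> ('a \<Rightarrow> real) \<Rightarrow> 'a" where
  "riesz B l = (THE u. \<forall>v. B u v = l v)"

definition christoffel ::
    "('a::euclidean_space \<Rightarrow> 'a \<Rightarrow> 'a \<Rightarrow> real) \<Rightarrow> 'a \<Rightarrow> 'a \<Rightarrow> 'a \<Rightarrow> 'a" where
  "christoffel G x u v =
     riesz (G x) (\<lambda>w. (frechet_derivative (\<lambda>y. G y v w) (at x) u
                     + frechet_derivative (\<lambda>y. G y u w) (at x) v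
                     - frechet_derivative (\<lambda>y. G y u v) (at x) w) / 2)"

definition cov_deriv ::
    "('a::euclidean_space \<Rightarrow> 'a \<Rightarrow> 'a \<Rightarrow> real) \<Rightarrow> ('a \<Rightarrow> 'a) \<Rightarrow> ('a \<Rightarrow> 'a) \<Rightarrow> 'a \<Rightarrow> 'a" where
  "cov_deriv G X Y x = frechet_derivative Y (at x) (X x) + christoffel G x (X x) (Y x)"

definition lie_bracket ::
    "('a::euclidean_space \<Rightarrow> 'a) \<Rightarrow> ('a \<Rightarrow> 'a) \<Rightarrow> 'a \<Rightarrow> 'a" where
  "lie_bracket X Y x = frechet_derivative Y (at x) (X x) - frechet_derivative X (at x) (Y x)"

definition curvature ::
    "('a::euclidean_space \<Rightarrow> 'a \<Rightarrow> 'a \<Rightarrow> real) \<Rightarrow> ('a \<Rightarrow> 'a) \<Rightarrow> ('a \<Rightarrow> 'a) \<Rightarrow> ('a \<Rightarrow> 'a) \<Rightarrow> 'a \<Rightarrow> 'a" where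
  "curvature G X Y Z x =
     cov_deriv G X (cov_deriv G Y Z) x - cov_deriv G Y (cov_deriv G X Z) x
       - cov_deriv G (lie_bracket X Y) Z x"

text \<open>The curvature is tensorial, so tangent vectors may be extended to constant fields.\<close>

definition sectional_curvature ::
    "('a::euclidean_space \<Rightarrow> 'a \<Rightarrow> 'a \<Rightarrow> real) \<Rightarrow> 'a \<Rightarrow> 'a \<Rightarrow> 'a \<Rightarrow> real" where
  "sectional_curvature G x u v =
     G x (curvature G (\<lambda>_. u) (\<lambda>_. v) (\<lambda>_. v) x) u / (G x u u * G x v v - (G x u v)\<^sup>2)"

definition constant_curvature_on ::
    "('a::euclidean_space \<Rightarrow> 'a \<Rightarrow> 'a \<Rightarrow> real) \<Rightarrow> real \<Rightarrow> 'a set \<Rightarrow> bool" where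
  "constant_curvature_on G c S \<longleftrightarrow>
     (\<forall>x\<in>S. \<forall>u v. G x u u * G x v v - (G x u v)\<^sup>2 \<noteq> 0 \<longrightarrow> sectional_curvature G x u v = c)"

definition gradient ::
    "('a::euclidean_space \<Rightarrow> 'a \<Rightarrow> 'a \<Rightarrow> real) \<Rightarrow> ('a \<Rightarrow> real) \<Rightarrow> 'a \<Rightarrow> 'a" where
  "gradient G u x = riesz (G x) (\<lambda>v. frechet_derivative u (at x) v)"

definition op_trace :: "(real^'n \<Rightarrow> real^'n) \<Rightarrow> real" where
  "op_trace L = trace (matrix L)"

definition laplacian ::
    "(real^'n \<Rightarrow> real^'n \<Rightarrow> real^'n \<Rightarrow> real) \<Rightarrow> (real^'n \<Rightarrow> real) \<Rightarrow> real^'n \<Rightarrow> real" where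
  "laplacian G u x = op_trace (\<lambda>v. cov_deriv G (\<lambda>_. v) (gradient G u) x)"


text \<open>\<open>g (U, \<phi>)\<close> are the components of the metric in the chart \<open>(U, \<phi>)\<close>.\<close>

definition semi_riemannian_metric ::
    "('q::{t2_space,second_countable_topology}, 'a::euclidean_space) chart set \<Rightarrow>
     (('q, 'a) chart \<Rightarrow> 'a \<Rightarrow> 'a \<Rightarrow> 'a \<Rightarrow> real) \<Rightarrow> bool" where
  "semi_riemannian_metric \<B> g \<longleftrightarrow>
     (\<forall>(U, \<phi>)\<in>\<B>. metric_on (g (U, \<phi>)) (\<phi> ` U)) \<and>
     (\<forall>(U, \<phi>)\<in>\<B>. \<forall>(V, \<psi>)\<in>\<B>. \<forall>x\<in>\<phi> ` (U \<inter> V). \<forall>u v.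
        g (V, \<psi>) ((\<psi> \<circ> inv_into U \<phi>) x)
          (frechet_derivative (\<psi> \<circ> inv_into U \<phi>) (at x) u)
          (frechet_derivative (\<psi> \<circ> inv_into U \<phi>) (at x) v) = g (U, \<phi>) x u v)"

text \<open>
  Space forms, except that neither completeness nor connectedness is required: they play no role for
  a local identity.
\<close>

definition constant_curvature_manifold ::
    "('q::{t2_space,second_countable_topology}, 'a::euclidean_space) chart set \<Rightarrow>
     (('q, 'a) chart \<Rightarrow> 'a \<Rightarrow> 'a \<Rightarrow> 'a \<Rightarrow> real) \<Rightarrow> nat \<Rightarrow> real \<Rightarrow> bool" where
  "constant_curvature_manifold \<B> g s c \<longleftrightarrow>
     smooth_atlas \<B> \<and> semi_riemannian_metric \<B> g \<and>
     (\<forall>(U, \<phi>)\<in>\<B>. (\<forall>x\<in>\<phi> ` U. form_index (g (U, \<phi>) x) = s) \<and>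
                 constant_curvature_on (g (U, \<phi>)) c (\<phi> ` U))"

text \<open>
  The metric of \<open>\<epsilon>I \<times>\<^sub>a Q\<close> in the chart \<open>map_prod id \<psi>\<close>, where \<open>G\<close> is the metric of \<open>Q\<close> in the
  chart \<open>\<psi>\<close>. The coordinate field \<open>\<partial>\<^sub>t\<close> is \<open>(1, 0)\<close>.
\<close>

definition warped_metric ::
    "real \<Rightarrow> (real \<Rightarrow> real) \<Rightarrow> ('a \<Rightarrow> 'a \<Rightarrow> 'a \<Rightarrow> real) \<Rightarrow> real \<times> 'a \<Rightarrow> real \<times> 'a \<Rightarrow> real \<times> 'a \<Rightarrow> real" where
  "warped_metric \<epsilon> a G z u v = \<epsilon> * fst u * fst v + (a (fst z))\<^sup>2 * G (snd z) (snd u) (snd v)"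


text \<open>
  Here \<open>F\<close> is an immersion of an open subset of \<open>'a\<close> into an open subset of \<open>'b\<close> with metric \<open>G\<close>.
  Tangent vectors of the submanifold are represented by their preimages under the differential
  of \<open>F\<close>, vector fields along \<open>F\<close> (in particular normal fields) by maps \<open>'a \<Rightarrow> 'b\<close>.
\<close>

definition induced_metric ::
    "('b::euclidean_space \<Rightarrow> 'b \<Rightarrow> 'b \<Rightarrow> real) \<Rightarrow> ('a::euclidean_space \<Rightarrow> 'b) \<Rightarrow> 'a \<Rightarrow> 'a \<Rightarrow> 'a \<Rightarrow> real" where
  "induced_metric G F x u v =
     G (F x) (frechet_derivative F (at x) u) (frechet_derivative F (at x) v)"

definition tangent_part ::
    "('b::euclidean_space \<Rightarrow> 'b \<Rightarrow> 'b \<Rightarrow> real) \<Rightarrow> ('a::euclidean_space \<Rightarrow> 'b) \<Rightarrow> 'a \<Rightarrow> 'b \<Rightarrow> 'a" where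
  "tangent_part G F x w =
     riesz (induced_metric G F x) (\<lambda>v. G (F x) w (frechet_derivative F (at x) v))"

definition normal_part ::
    "('b::euclidean_space \<Rightarrow> 'b \<Rightarrow> 'b \<Rightarrow> real) \<Rightarrow> ('a::euclidean_space \<Rightarrow> 'b) \<Rightarrow> 'a \<Rightarrow> 'b \<Rightarrow> 'b" where
  "normal_part G F x w = w - frechet_derivative F (at x) (tangent_part G F x w)"

text \<open>The Levi-Civita connection of \<open>G\<close>, pulled back to vector fields \<open>W\<close> along \<open>F\<close>.\<close>

definition ambient_deriv ::
    "('b::euclidean_space \<Rightarrow> 'b \<Rightarrow> 'b \<Rightarrow> real) \<Rightarrow> ('a::euclidean_space \<Rightarrow> 'b) \<Rightarrow>
     ('a \<Rightarrow> 'a) \<Rightarrow> ('a \<Rightarrow> 'b) \<Rightarrow> 'a \<Rightarrow> 'b" where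
  "ambient_deriv G F X W x =
     frechet_derivative W (at x) (X x)
       + christoffel G (F x) (frechet_derivative F (at x) (X x)) (W x)"

definition second_ff ::
    "('b::euclidean_space \<Rightarrow> 'b \<Rightarrow> 'b \<Rightarrow> real) \<Rightarrow> ('a::euclidean_space \<Rightarrow> 'b) \<Rightarrow>
     ('a \<Rightarrow> 'a) \<Rightarrow> ('a \<Rightarrow> 'a) \<Rightarrow> 'a \<Rightarrow> 'b" where
  "second_ff G F X Y x =
     normal_part G F x (ambient_deriv G F X (\<lambda>y. frechet_derivative F (at y) (Y y)) x)"

definition normal_deriv ::
    "('b::euclidean_space \<Rightarrow> 'b \<Rightarrow> 'b \<Rightarrow> real) \<Rightarrow> ('a::euclidean_space \<Rightarrow> 'b) \<Rightarrow>
     ('a \<Rightarrow> 'a) \<Rightarrow> ('a \<Rightarrow> 'b) \<Rightarrow> 'a \<Rightarrow> 'b" where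
  "normal_deriv G F X \<eta> x = normal_part G F x (ambient_deriv G F X \<eta> x)"

text \<open>The shape operator at \<open>x\<close> of a normal vector \<open>\<eta>\<close> at \<open>x\<close>; \<open>\<alpha>\<close> is tensorial.\<close>

definition shape_op ::
    "('b::euclidean_space \<Rightarrow> 'b \<Rightarrow> 'b \<Rightarrow> real) \<Rightarrow> ('a::euclidean_space \<Rightarrow> 'b) \<Rightarrow> 'a \<Rightarrow> 'b \<Rightarrow> 'a \<Rightarrow> 'a" where
  "shape_op G F x \<eta> u =
     riesz (induced_metric G F x) (\<lambda>v. G (F x) (second_ff G F (\<lambda>_. u) (\<lambda>_. v) x) \<eta>)"

text \<open>\<open>(\<nabla>\<^sup>\<bottom>\<^sub>Z \<alpha>)(X, Y)\<close> and the second covariant derivative \<open>(\<nabla>\<^sup>\<bottom>\<^sub>W \<nabla>\<^sup>\<bottom>\<^sub>Z \<alpha>)(X, Y)\<close>.\<close>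

definition nabla_second_ff ::
    "('b::euclidean_space \<Rightarrow> 'b \<Rightarrow> 'b \<Rightarrow> real) \<Rightarrow> ('a::euclidean_space \<Rightarrow> 'b) \<Rightarrow>
     ('a \<Rightarrow> 'a) \<Rightarrow> ('a \<Rightarrow> 'a) \<Rightarrow> ('a \<Rightarrow> 'a) \<Rightarrow> 'a \<Rightarrow> 'b" where
  "nabla_second_ff G F Z X Y x =
     normal_deriv G F Z (second_ff G F X Y) x
       - second_ff G F (cov_deriv (induced_metric G F) Z X) Y x
       - second_ff G F X (cov_deriv (induced_metric G F) Z Y) x"

definition nabla2_second_ff ::
    "('b::euclidean_space \<Rightarrow> 'b \<Rightarrow> 'b \<Rightarrow> real) \<Rightarrow> ('a::euclidean_space \<Rightarrow> 'b) \<Rightarrow>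
     ('a \<Rightarrow> 'a) \<Rightarrow> ('a \<Rightarrow> 'a) \<Rightarrow> ('a \<Rightarrow> 'a) \<Rightarrow> ('a \<Rightarrow> 'a) \<Rightarrow> 'a \<Rightarrow> 'b" where
  "nabla2_second_ff G F W Z X Y x =
     normal_deriv G F W (nabla_second_ff G F Z X Y) x
       - nabla_second_ff G F (cov_deriv (induced_metric G F) W Z) X Y x
       - nabla_second_ff G F Z (cov_deriv (induced_metric G F) W X) Y x
       - nabla_second_ff G F Z X (cov_deriv (induced_metric G F) W Y) x"


definition coord_domain :: "('m \<Rightarrow> real \<times> 'q) \<Rightarrow> ('m, 'a) chart \<Rightarrow> ('q, 'b) chart \<Rightarrow> 'm set" where
  "coord_domain f A B = fst A \<inter> {p. snd (f p) \<in> fst B}"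

definition coord_rep ::
    "('m \<Rightarrow> real \<times> 'q) \<Rightarrow> ('m, 'a) chart \<Rightarrow> ('q, 'b) chart \<Rightarrow> 'a \<Rightarrow> real \<times> 'b" where
  "coord_rep f A B = map_prod id (snd B) \<circ> f \<circ> inv_into (fst A) (snd A)"

text \<open>The manifold \<open>M\<close> (the whole type \<open>'m\<close>) carries the metric induced by \<open>f\<close>.\<close>

definition spacelike_immersion ::
    "('m::{t2_space,second_countable_topology}, 'a::euclidean_space) chart set \<Rightarrow>
     ('q::{t2_space,second_countable_topology}, 'b::euclidean_space) chart set \<Rightarrow>
     (('q, 'b) chart \<Rightarrow> 'b \<Rightarrow> 'b \<Rightarrow> 'b \<Rightarrow> real) \<Rightarrow> real set \<Rightarrow> real \<Rightarrow> (real \<Rightarrow> real) \<Rightarrow>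
     ('m \<Rightarrow> real \<times> 'q) \<Rightarrow> bool" where
  "spacelike_immersion \<A> \<B> g I \<epsilon> a f \<longleftrightarrow>
     f ` UNIV \<subseteq> I \<times> UNIV \<and> continuous_on UNIV f \<and>
     (\<forall>A\<in>\<A>. \<forall>B\<in>\<B>. smooth_on (coord_rep f A B) (snd A ` coord_domain f A B)) \<and>
     (\<forall>A\<in>\<A>. \<forall>B\<in>\<B>. \<forall>x\<in>snd A ` coord_domain f A B. \<forall>u. u \<noteq> 0 \<longrightarrow>
        0 < induced_metric (warped_metric \<epsilon> a (g B)) (coord_rep f A B) x u u)"

text \<open>
  An adapted frame on \<open>S\<close>: tangent fields \<open>e i\<close> for \<open>i \<in> {1..n}\<close> and normal fields \<open>\<nu> \<beta>\<close> for
  \<open>\<beta> \<in> {n+1..n+m+1}\<close>, with \<open>\<nabla>e\<^sub>i = 0\<close> at the point \<open>x\<close>.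
\<close>

definition adapted_frame ::
    "('b::euclidean_space \<Rightarrow> 'b \<Rightarrow> 'b \<Rightarrow> real) \<Rightarrow> (real^'n \<Rightarrow> 'b) \<Rightarrow> (real^'n) set \<Rightarrow> real^'n \<Rightarrow> nat \<Rightarrow>
     (nat \<Rightarrow> real^'n \<Rightarrow> real^'n) \<Rightarrow> (nat \<Rightarrow> real^'n \<Rightarrow> 'b) \<Rightarrow> (nat \<Rightarrow> real) \<Rightarrow> bool" where
  "adapted_frame G F S x m e \<nu> sg \<longleftrightarrow>
     (\<forall>i\<in>{1..CARD('n)}. smooth_on (e i) S) \<and>
     (\<forall>y\<in>S. \<forall>i\<in>{1..CARD('n)}. \<forall>j\<in>{1..CARD('n)}.
        induced_metric G F y (e i y) (e j y) = (if i = j then 1 else 0)) \<and>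
     (\<forall>i\<in>{1..CARD('n)}. \<forall>v. cov_deriv (induced_metric G F) (\<lambda>_. v) (e i) x = 0) \<and>
     (\<forall>\<beta>\<in>{CARD('n)+1..CARD('n)+m+1}. smooth_on (\<nu> \<beta>) S \<and> sg \<beta> \<in> {-1, 1}) \<and>
     (\<forall>y\<in>S. \<forall>\<beta>\<in>{CARD('n)+1..CARD('n)+m+1}. \<forall>v.
        G (F y) (\<nu> \<beta> y) (frechet_derivative F (at y) v) = 0) \<and>
     (\<forall>y\<in>S. \<forall>\<beta>\<in>{CARD('n)+1..CARD('n)+m+1}. \<forall>\<gamma>\<in>{CARD('n)+1..CARD('n)+m+1}.
        G (F y) (\<nu> \<beta> y) (\<nu> \<gamma> y) = (if \<beta> = \<gamma> then sg \<beta> else 0))"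

text \<open>
  The function \<open>|\<alpha>|\<^sup>2 = \<Sum>\<^sub>\<beta>\<Sum>\<^sub>i\<^sub>j (h\<^sup>\<beta>\<^sub>i\<^sub>j)\<^sup>2\<close>, summed without the signs of the \<open>\<nu> \<beta>\<close>, depends on the choice
  of the normal frame if the normal metric is indefinite: it is \<open>\<langle>J\<alpha>, \<alpha>\<rangle>\<close> for the operator
  \<open>J (\<nu> \<beta>) = sg \<beta> \<nu> \<beta>\<close>, and its Laplacian at \<open>x\<close> involves the first derivatives and the Laplacian
  of \<open>J\<close> at \<open>x\<close>. The following condition says that these vanish; it holds for any normal frame
  that is parallel along the geodesics starting at \<open>x\<close>, and it is vacuous (all \<open>sg \<beta>\<close> agree) if the
  normal metric is definite.
\<close>

definition sign_splitting_parallel_at ::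
    "('b::euclidean_space \<Rightarrow> 'b \<Rightarrow> 'b \<Rightarrow> real) \<Rightarrow> (real^'n \<Rightarrow> 'b) \<Rightarrow> real^'n \<Rightarrow> nat \<Rightarrow>
     (nat \<Rightarrow> real^'n \<Rightarrow> real^'n) \<Rightarrow> (nat \<Rightarrow> real^'n \<Rightarrow> 'b) \<Rightarrow> (nat \<Rightarrow> real) \<Rightarrow> bool" where
  "sign_splitting_parallel_at G F x m e \<nu> sg \<longleftrightarrow>
     (\<forall>\<beta>\<in>{CARD('n)+1..CARD('n)+m+1}. \<forall>\<gamma>\<in>{CARD('n)+1..CARD('n)+m+1}. sg \<beta> \<noteq> sg \<gamma> \<longrightarrow>
        (\<forall>v. G (F x) (normal_deriv G F (\<lambda>_. v) (\<nu> \<beta>) x) (\<nu> \<gamma> x) = 0) \<and>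
        (\<Sum>i=1..CARD('n).
           G (F x) (normal_deriv G F (e i) (normal_deriv G F (e i) (\<nu> \<beta>)) x) (\<nu> \<gamma> x)) = 0)"

definition op_commutator :: "('a \<Rightarrow> 'a::ab_group_add) \<Rightarrow> ('a \<Rightarrow> 'a) \<Rightarrow> 'a \<Rightarrow> 'a" where
  "op_commutator K L = (\<lambda>u. K (L u) - L (K u))"

end

theory Submission
  imports Defs
begin

text \<open>
  The identity is of Simons type. In a frame with \<open>\<nabla>e\<^sub>i = 0\<close> at the point,
  \<open>\<Delta>|\<alpha>|\<^sup>2 / 2\<close> is \<open>\<Sum> h\<^sub>i\<^sub>j h\<^sub>i\<^sub>j\<^sub>k\<^sub>k + |\<nabla>\<alpha>|\<^sup>2\<close>, and the index pair \<open>kk\<close> is moved from the end to the front: the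
  Codazzi equation, differentiated once, exchanges \<open>i\<close> and the first \<open>k\<close>, the Ricci identity exchanges the
  two derivatives, and a second use of the Codazzi equation finishes (\<open>H4_commute\<close>). The Codazzi steps
  leave the derivatives of \<open>r\<close>, \<open>T\<close> and \<open>\<xi>\<close>, where \<open>r = a''/a - \<epsilon>b\<close>; the Ricci identity leaves the curvatures of the tangent
  and of the normal bundle, which the Gauss and Ricci equations express through \<open>b\<close>, \<open>r\<close> and
  the shape operators. Contraction with \<open>h\<^sub>i\<^sub>j\<close> gives the asserted traces (\<open>codazzi_contraction\<close> and
  \<open>ricci_contraction\<close>). The term with \<open>b'\<close> arises because \<open>b' = 2 \<epsilon> (a'/a) r\<close>, and
  \<open>a'/a\<close> enters through \<open>\<nabla>\<^sub>X \<partial>\<^sub>t = (a'/a)(X - \<epsilon>\<langle>X, \<partial>\<^sub>t\<rangle>\<partial>\<^sub>t)\<close>.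

  The computation uses moving frames. Along the immersion the pulled-back ambient connection is described
  by its connection forms \<open>\<theta>\<close> with respect to all the vectors \<open>e\<^sub>i\<close> and \<open>\<nu>\<^sub>\<beta>\<close>.
  These are smooth real functions, skew in the two frame indices, with \<open>h\<^sup>\<beta>\<^sub>i\<^sub>j = \<theta> i j \<beta>\<close>; the single
  \<open>structure_equation\<close> contains the equations of Gauss, Codazzi and Ricci, and covariant
  derivatives become derivatives of functions corrected by products with \<open>\<theta>\<close>.

  Apart from its Levi-Civita connection, only two facts about the ambient space enter: the formula for \<open>\<nabla>\<^sub>X \<partial>\<^sub>t\<close> and the curvature tensor
  (\<open>warped_constant_curvature\<close>). The latter follows from the Christoffel symbols of the
  warped product and from the fact that the sectional curvatures of the fibre determine its curvature
  tensor (\<open>constant_curvature_tensor\<close>).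

  The normal metric may be indefinite, whereas \<open>|\<alpha>|\<^sup>2\<close> is a sum of squares without signs. The normal
  connection forms therefore drop out of the Laplacian only because they do not mix
  directions of different sign at the point, to second order in the sense of the Laplacian; within one sign they
  form a skew matrix, whose contributions cancel (\<open>laplacian_sq_norm\<close>).
\<close>

section \<open>Smooth maps\<close>

abbreviation fd :: "('a::real_normed_vector \<Rightarrow> 'b::real_normed_vector) \<Rightarrow> 'a \<Rightarrow> 'a \<Rightarrow> 'b" where
  "fd f x \<equiv> frechet_derivative f (at x)"

lemma fd_eqI: "(f has_derivative f') (at x) \<Longrightarrow> fd f x = f'"
  by (rule frechet_derivative_at[symmetric])

lemma fd_cong_open:
  assumes "open S" "x \<in> S" "\<And>y. y \<in> S \<Longrightarrow> f y = g y" "f differentiable (at x)"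
  shows "g differentiable (at x)" "fd g x = fd f x"
proof -
  have "(f has_derivative fd f x) (at x)" using assms(4) frechet_derivative_works by blast
  then have "(g has_derivative fd f x) (at x)"
    by (rule has_derivative_transform_within_open[OF _ assms(1,2)]) (use assms(3) in auto)
  then show "g differentiable (at x)" "fd g x = fd f x"
    by (auto simp: differentiable_def fd_eqI)
qed

lemma k_smooth_on_cong:
  assumes "open S" "k_smooth_on k f S" "\<And>x. x \<in> S \<Longrightarrow> f x = g x"
  shows "k_smooth_on k g S"
  using assms
proof (induction k arbitrary: f g)
  case 0
  then show ?case using continuous_on_cong by force
next
  case (Suc k)
  have d: "g differentiable (at x)" "fd g x = fd f x" if "x \<in> S" for x
    using fd_cong_open[of S x f g] Suc.prems that by auto
  have "k_smooth_on k (\<lambda>x. fd g x v) S" for v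
    by (rule Suc.IH[of "\<lambda>x. fd f x v"]) (use Suc.prems d in auto)
  then show ?case using d by auto
qed

lemma k_smooth_on_SucD: "k_smooth_on (Suc k) f S \<Longrightarrow> k_smooth_on k f S"
proof (induction k arbitrary: f)
  case 0
  then show ?case
    by (auto intro!: continuous_at_imp_continuous_on differentiable_imp_continuous_within)
next
  case (Suc k)
  then show ?case by simp
qed

lemma k_smooth_on_subset: "k_smooth_on k f S \<Longrightarrow> T \<subseteq> S \<Longrightarrow> k_smooth_on k f T"
  by (induction k arbitrary: f) (auto intro: continuous_on_subset)

lemma k_smooth_on_const: "k_smooth_on k (\<lambda>x. c) S"
  by (induction k arbitrary: c) auto

lemma k_smooth_on_add:
  assumes "open S" "k_smooth_on k f S" "k_smooth_on k g S"
  shows "k_smooth_on k (\<lambda>x. f x + g x) S"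
  using assms
proof (induction k arbitrary: f g)
  case 0
  then show ?case by (auto intro: continuous_on_add)
next
  case (Suc k)
  have eq: "fd (\<lambda>x. f x + g x) x v = fd f x v + fd g x v" if "x \<in> S" for x v
  proof -
    have "((\<lambda>x. f x + g x) has_derivative (\<lambda>v. fd f x v + fd g x v)) (at x)"
      using Suc.prems that by (intro has_derivative_add) (auto simp: frechet_derivative_works[symmetric])
    from fd_eqI[OF this] show ?thesis by simp
  qed
  have "k_smooth_on k (\<lambda>x. fd (\<lambda>x. f x + g x) x v) S" for v
    by (rule k_smooth_on_cong[where f = "\<lambda>x. fd f x v + fd g x v"])
       (use Suc eq in auto)
  then show ?case using Suc.prems by auto
qed

text \<open>
  By the product rule a derivative of a product is a sum of two products of the previous order. Scalar
  multiples, inner products and products of real functions are covered at once.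
\<close>

lemma k_smooth_on_bilinear:
  assumes "bounded_bilinear pr" "open S" "k_smooth_on k f S" "k_smooth_on k g S"
  shows "k_smooth_on k (\<lambda>x. pr (f x) (g x)) S"
  using assms(2-)
proof (induction k arbitrary: f g)
  case 0
  then show ?case by (auto intro: bounded_bilinear.continuous_on[OF assms(1)])
next
  case (Suc k)
  have der: "((\<lambda>x. pr (f x) (g x)) has_derivative (\<lambda>v. pr (f x) (fd g x v) + pr (fd f x v) (g x))) (at x)"
    if "x \<in> S" for x
    using bounded_bilinear.FDERIV[OF assms(1), of f "fd f x" x UNIV g "fd g x"] Suc.prems that
    by (auto simp: frechet_derivative_works[symmetric])
  have "k_smooth_on k (\<lambda>x. fd (\<lambda>x. pr (f x) (g x)) x v) S" for v
  proof (rule k_smooth_on_cong[where f = "\<lambda>x. pr (f x) (fd g x v) + pr (fd f x v) (g x)"])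
    show "k_smooth_on k (\<lambda>x. pr (f x) (fd g x v) + pr (fd f x v) (g x)) S"
      using Suc.prems k_smooth_on_SucD[OF Suc.prems(2)] k_smooth_on_SucD[OF Suc.prems(3)]
      by (intro k_smooth_on_add Suc.IH) auto
  qed (use Suc.prems fd_eqI[OF der] in auto)
  then show ?case using der differentiable_def by (simp, blast)
qed

lemma smooth_on_cong:
  "open S \<Longrightarrow> smooth_on f S \<Longrightarrow> (\<And>x. x \<in> S \<Longrightarrow> f x = g x) \<Longrightarrow> smooth_on g S"
  unfolding smooth_on_def using k_smooth_on_cong by blast

lemma smooth_on_subset: "smooth_on f S \<Longrightarrow> T \<subseteq> S \<Longrightarrow> smooth_on f T"
  unfolding smooth_on_def using k_smooth_on_subset by blast

lemma smooth_on_const: "smooth_on (\<lambda>x. c) S"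
  unfolding smooth_on_def using k_smooth_on_const by blast

lemma smooth_on_fd: "smooth_on f S \<Longrightarrow> smooth_on (\<lambda>x. fd f x v) S"
  unfolding smooth_on_def by (metis k_smooth_on.simps(2))

lemma smooth_on_differentiable: "smooth_on f S \<Longrightarrow> x \<in> S \<Longrightarrow> f differentiable (at x)"
  unfolding smooth_on_def by (metis k_smooth_on.simps(2))

lemma smooth_on_has_derivative: "smooth_on f S \<Longrightarrow> x \<in> S \<Longrightarrow> (f has_derivative fd f x) (at x)"
  using smooth_on_differentiable frechet_derivative_works by blast

lemma smooth_on_continuous: "smooth_on f S \<Longrightarrow> continuous_on S f"
  unfolding smooth_on_def by (metis k_smooth_on.simps(1))

lemma smooth_onI:
  assumes "\<And>x. x \<in> S \<Longrightarrow> f differentiable (at x)" "\<And>v. smooth_on (\<lambda>x. fd f x v) S"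
  shows "smooth_on f S"
  unfolding smooth_on_def
proof
  show "k_smooth_on k f S" for k
    by (rule k_smooth_on_SucD) (use assms in \<open>auto simp: smooth_on_def\<close>)
qed

lemma smooth_on_add:
  "open S \<Longrightarrow> smooth_on f S \<Longrightarrow> smooth_on g S \<Longrightarrow> smooth_on (\<lambda>x. f x + g x) S"
  unfolding smooth_on_def using k_smooth_on_add by blast

lemma smooth_on_bilinear:
  "bounded_bilinear pr \<Longrightarrow> open S \<Longrightarrow> smooth_on f S \<Longrightarrow> smooth_on g S \<Longrightarrow>
   smooth_on (\<lambda>x. pr (f x) (g x)) S"
  unfolding smooth_on_def using k_smooth_on_bilinear by blast

lemmas smooth_on_scaleR = smooth_on_bilinear[OF bounded_bilinear_scaleR]
lemmas smooth_on_inner = smooth_on_bilinear[OF bounded_bilinear_inner]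

lemma smooth_on_mult:
  fixes f :: "_ \<Rightarrow> real"
  shows "open S \<Longrightarrow> smooth_on f S \<Longrightarrow> smooth_on g S \<Longrightarrow> smooth_on (\<lambda>x. f x * g x) S"
  by (rule smooth_on_bilinear[OF bounded_bilinear_mult])

lemma smooth_on_minus:
  assumes "open S" "smooth_on f S"
  shows "smooth_on (\<lambda>x. - f x) S"
  using smooth_on_scaleR[OF assms(1) smooth_on_const[of "-1"] assms(2)] by simp

lemma smooth_on_diff:
  assumes "open S" "smooth_on f S" "smooth_on g S"
  shows "smooth_on (\<lambda>x. f x - g x) S"
  using smooth_on_add[OF assms(1,2) smooth_on_minus[OF assms(1,3)]] by simp

lemma smooth_on_sum:
  assumes "open S" "\<And>i. i \<in> J \<Longrightarrow> smooth_on (f i) S"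
  shows "smooth_on (\<lambda>x. \<Sum>i\<in>J. f i x) S"
  using assms(2)
proof (induction J rule: infinite_finite_induct)
  case (insert j J)
  then show ?case using smooth_on_add[OF assms(1), of "f j" "\<lambda>x. \<Sum>i\<in>J. f i x"] by simp
qed (auto simp: smooth_on_const)

lemma smooth_on_prod:
  fixes f :: "'i \<Rightarrow> 'a::real_normed_vector \<Rightarrow> real"
  assumes "open S" "\<And>i. i \<in> J \<Longrightarrow> smooth_on (f i) S"
  shows "smooth_on (\<lambda>x. \<Prod>i\<in>J. f i x) S"
  using assms(2)
proof (induction J rule: infinite_finite_induct)
  case (insert j J)
  then show ?case using smooth_on_mult[OF assms(1), of "f j" "\<lambda>x. \<Prod>i\<in>J. f i x"] by simp
qed (auto simp: smooth_on_const)

lemma smooth_on_id: "smooth_on (\<lambda>x. x) S"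
  by (rule smooth_onI) (auto simp: smooth_on_const)

lemma smooth_on_bounded_linear:
  assumes L: "bounded_linear L" and "open S" and f: "smooth_on f S"
  shows "smooth_on (\<lambda>x. L (f x)) S"
proof -
  interpret bounded_linear L by fact
  have "bounded_bilinear (\<lambda>(c::real) y. c *\<^sub>R L y)"
    using bounded_bilinear.comp[OF bounded_bilinear_scaleR bounded_linear_ident L] by simp
  from smooth_on_bilinear[OF this \<open>open S\<close> smooth_on_const[of 1] f] show ?thesis by simp
qed

text \<open>
  In an orthonormal basis the chain rule is a finite sum of products of a derivative of \<open>g\<close> with a partial
  derivative of \<open>f\<close> composed with \<open>g\<close>, so the induction runs over \<open>f\<close> for a fixed \<open>g\<close>.
\<close>

lemma k_smooth_on_compose:
  fixes f :: "'b::euclidean_space \<Rightarrow> 'c::real_normed_vector" and g :: "'a::real_normed_vector \<Rightarrow> 'b"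
  assumes "open S" "k_smooth_on k g S" "k_smooth_on k f T" "g ` S \<subseteq> T"
  shows "k_smooth_on k (\<lambda>x. f (g x)) S"
  using assms
proof (induction k arbitrary: f)
  case 0
  then show ?case by (auto intro: continuous_on_compose2)
next
  case (Suc k)
  have der: "((\<lambda>x. f (g x)) has_derivative (\<lambda>v. fd f (g x) (fd g x v))) (at x)" if "x \<in> S" for x
    by (rule has_derivative_compose)
       (use Suc.prems that in \<open>auto simp: frechet_derivative_works[symmetric]\<close>)
  have gk: "k_smooth_on k g S" using Suc.prems k_smooth_on_SucD by blast
  have exp: "fd f (g x) w = (\<Sum>b\<in>Basis. (w \<bullet> b) *\<^sub>R fd f (g x) b)" if "x \<in> S" for x w
  proof -
    have l: "linear (fd f (g x))"
      using Suc.prems that by (intro linear_frechet_derivative) auto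
    have "fd f (g x) w = fd f (g x) (\<Sum>b\<in>Basis. (w \<bullet> b) *\<^sub>R b)" by (simp add: euclidean_representation)
    also have "\<dots> = (\<Sum>b\<in>Basis. (w \<bullet> b) *\<^sub>R fd f (g x) b)"
      by (simp add: linear_sum[OF l] linear_scale[OF l])
    finally show ?thesis .
  qed
  have add: "k_smooth_on k (\<lambda>x. \<Sum>b\<in>J. h b x) S"
    if "\<And>b. b \<in> J \<Longrightarrow> k_smooth_on k (h b) S" for J and h :: "'b \<Rightarrow> 'a \<Rightarrow> 'c"
    using that
  proof (induction J rule: infinite_finite_induct)
    case (insert j J)
    then show ?case using k_smooth_on_add[OF assms(1), of k "h j" "\<lambda>x. \<Sum>i\<in>J. h i x"] by simp
  qed (auto simp: k_smooth_on_const)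
  have "k_smooth_on k (\<lambda>x. fd (\<lambda>x. f (g x)) x v) S" for v
  proof (rule k_smooth_on_cong[where f = "\<lambda>x. \<Sum>b\<in>Basis. (fd g x v \<bullet> b) *\<^sub>R fd f (g x) b"])
    show "k_smooth_on k (\<lambda>x. \<Sum>b\<in>Basis. (fd g x v \<bullet> b) *\<^sub>R fd f (g x) b) S"
      by (intro add k_smooth_on_bilinear[OF bounded_bilinear_scaleR]
          k_smooth_on_bilinear[OF bounded_bilinear_inner] k_smooth_on_const Suc.IH)
         (use Suc.prems gk in auto)
  qed (use Suc.prems fd_eqI[OF der] exp in auto)
  then show ?case using der differentiable_def by (simp, blast)
qed

lemma smooth_on_compose:
  fixes f :: "'b::euclidean_space \<Rightarrow> 'c::real_normed_vector" and g :: "'a::real_normed_vector \<Rightarrow> 'b"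
  assumes "open S" "smooth_on g S" "smooth_on f T" "g ` S \<subseteq> T"
  shows "smooth_on (\<lambda>x. f (g x)) S"
  using assms k_smooth_on_compose unfolding smooth_on_def by blast

lemma k_smooth_on_inverse:
  fixes f :: "'a::real_normed_vector \<Rightarrow> real"
  assumes "open S" "k_smooth_on k f S" "\<And>x. x \<in> S \<Longrightarrow> f x \<noteq> 0"
  shows "k_smooth_on k (\<lambda>x. inverse (f x)) S"
  using assms
proof (induction k)
  case 0
  then show ?case by (auto intro: continuous_on_inverse)
next
  case (Suc k)
  have der: "((\<lambda>x. inverse (f x)) has_derivative (\<lambda>v. - (inverse (f x) * fd f x v * inverse (f x)))) (at x)"
    if "x \<in> S" for x
    by (rule Deriv.has_derivative_inverse)
       (use Suc.prems that in \<open>auto simp: frechet_derivative_works[symmetric]\<close>)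
  have IH: "k_smooth_on k (\<lambda>x. inverse (f x)) S"
    using Suc k_smooth_on_SucD by blast
  have "k_smooth_on k (\<lambda>x. fd (\<lambda>x. inverse (f x)) x v) S" for v
  proof (rule k_smooth_on_cong[where f = "\<lambda>x. (-1) * (inverse (f x) * fd f x v * inverse (f x))"])
    show "k_smooth_on k (\<lambda>x. (-1) * (inverse (f x) * fd f x v * inverse (f x))) S"
      by (intro k_smooth_on_bilinear[OF bounded_bilinear_mult] k_smooth_on_const IH)
         (use Suc.prems in auto)
  qed (use Suc.prems fd_eqI[OF der] in auto)
  then show ?case using der differentiable_def by (simp, blast)
qed

lemma smooth_on_divide:
  fixes f :: "'a::real_normed_vector \<Rightarrow> real"
  assumes "open S" "smooth_on f S" "smooth_on g S" "\<And>x. x \<in> S \<Longrightarrow> g x \<noteq> 0"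
  shows "smooth_on (\<lambda>x. f x / g x) S"
proof -
  have "smooth_on (\<lambda>x. inverse (g x)) S"
    using assms k_smooth_on_inverse unfolding smooth_on_def by blast
  from smooth_on_mult[OF assms(1,2) this] show ?thesis by (simp add: divide_inverse)
qed

lemma smooth_on_Pair:
  assumes "open S" "smooth_on f S" "smooth_on g S"
  shows "smooth_on (\<lambda>x. (f x, g x)) S"
proof -
  have 1: "bounded_linear (\<lambda>u. (u, 0))" by (intro bounded_linear_Pair bounded_linear_ident bounded_linear_zero)
  have 2: "bounded_linear (\<lambda>u. (0, u))" by (intro bounded_linear_Pair bounded_linear_ident bounded_linear_zero)
  have "smooth_on (\<lambda>x. (f x, 0) + (0, g x)) S"
    by (intro smooth_on_add smooth_on_bounded_linear[OF 1] smooth_on_bounded_linear[OF 2] assms)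
  then show ?thesis by simp
qed

lemma smooth_on_components:
  fixes f :: "'a::real_normed_vector \<Rightarrow> 'b::euclidean_space"
  assumes "open S" "\<And>b. b \<in> Basis \<Longrightarrow> smooth_on (\<lambda>x. f x \<bullet> b) S"
  shows "smooth_on f S"
proof (rule smooth_on_cong[OF assms(1), where f = "\<lambda>x. \<Sum>b\<in>Basis. (f x \<bullet> b) *\<^sub>R b"])
  show "smooth_on (\<lambda>x. \<Sum>b\<in>Basis. (f x \<bullet> b) *\<^sub>R b) S"
    by (intro smooth_on_sum smooth_on_scaleR smooth_on_const assms)
qed (simp add: euclidean_representation)

section \<open>Symmetry of second derivatives\<close>

text \<open>
  The mean value theorem, applied along \<open>u\<close> to the increment of \<open>f\<close> in direction \<open>v\<close> and then along \<open>v\<close>. The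
  second difference on the left is symmetric in \<open>u\<close> and \<open>v\<close>; comparing the two expressions
  obtained for it on the right for small \<open>h\<close> gives the symmetry of second derivatives.
\<close>

lemma second_difference_mean_value:
  fixes f :: "'a::real_normed_vector \<Rightarrow> real"
  assumes f: "smooth_on f S" and h: "0 < h"
    and S: "\<And>s t. 0 \<le> s \<Longrightarrow> s \<le> h \<Longrightarrow> 0 \<le> t \<Longrightarrow> t \<le> h \<Longrightarrow> x + s *\<^sub>R u + t *\<^sub>R v \<in> S"
  obtains s t where "0 < s" "s < h" "0 < t" "t < h"
    "f (x + h *\<^sub>R u + h *\<^sub>R v) - f (x + h *\<^sub>R u) - (f (x + h *\<^sub>R v) - f x)
       = h * (h * fd (\<lambda>y. fd f y u) (x + s *\<^sub>R u + t *\<^sub>R v) v)"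
proof -
  have line: "((\<lambda>s. g (y + s *\<^sub>R w)) has_derivative (\<lambda>c. c * fd g (y + s *\<^sub>R w) w)) (at s within T)"
    if "smooth_on g S" "y + s *\<^sub>R w \<in> S" for g :: "'a \<Rightarrow> real" and y w s T
  proof -
    have "((\<lambda>s. g (y + s *\<^sub>R w)) has_derivative (\<lambda>c. fd g (y + s *\<^sub>R w) (c *\<^sub>R w))) (at s within T)"
      by (rule has_derivative_compose[of "\<lambda>s. y + s *\<^sub>R w"])
         (auto intro!: derivative_eq_intros smooth_on_has_derivative that)
    moreover have "fd g (y + s *\<^sub>R w) (c *\<^sub>R w) = c * fd g (y + s *\<^sub>R w) w" for c
      using linear_scale[OF linear_frechet_derivative[OF smooth_on_differentiable[OF that]]] by simp
    ultimately show ?thesis by simp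
  qed
  define k where "k s = f (x + h *\<^sub>R v + s *\<^sub>R u) - f (x + s *\<^sub>R u)" for s
  have "\<exists>s\<in>{0<..<h}. k h - k 0 = (\<lambda>c. c * fd f (x + h *\<^sub>R v + s *\<^sub>R u) u - c * fd f (x + s *\<^sub>R u) u) (h - 0)"
  proof (rule mvt_simple[OF h])
    fix s assume s: "0 \<le> s" "s \<le> h"
    show "(k has_derivative (\<lambda>c. c * fd f (x + h *\<^sub>R v + s *\<^sub>R u) u - c * fd f (x + s *\<^sub>R u) u)) (at s within {0..h})"
      unfolding k_def
      by (intro has_derivative_diff line f)
         (use S[of s h] S[of s 0] s h in \<open>auto simp: algebra_simps\<close>)
  qed
  then obtain s where s: "0 < s" "s < h"
    and ks: "k h - k 0 = h * (fd f (x + h *\<^sub>R v + s *\<^sub>R u) u - fd f (x + s *\<^sub>R u) u)"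
    by (auto simp: algebra_simps)
  define l where "l t = fd f (x + s *\<^sub>R u + t *\<^sub>R v) u" for t
  have "\<exists>t\<in>{0<..<h}. l h - l 0 = (\<lambda>c. c * fd (\<lambda>y. fd f y u) (x + s *\<^sub>R u + t *\<^sub>R v) v) (h - 0)"
  proof (rule mvt_simple[OF h])
    fix t assume t: "0 \<le> t" "t \<le> h"
    show "(l has_derivative (\<lambda>c. c * fd (\<lambda>y. fd f y u) (x + s *\<^sub>R u + t *\<^sub>R v) v)) (at t within {0..h})"
      unfolding l_def
      by (rule line[OF smooth_on_fd[OF f]]) (use S[of s t] s t in auto)
  qed
  then obtain t where t: "0 < t" "t < h"
    and lt: "l h - l 0 = h * fd (\<lambda>y. fd f y u) (x + s *\<^sub>R u + t *\<^sub>R v) v"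
    by auto
  show ?thesis
    by (rule that[OF s t]) (use ks lt in \<open>simp add: k_def l_def algebra_simps\<close>)
qed

lemma fd_commute_real:
  fixes f :: "'a::real_normed_vector \<Rightarrow> real"
  assumes f: "smooth_on f S" and S: "open S" "x \<in> S"
  shows "fd (\<lambda>y. fd f y u) x v = fd (\<lambda>y. fd f y v) x u"
proof (rule ccontr)
  let ?p = "\<lambda>z. fd (\<lambda>y. fd f y u) z v" and ?q = "\<lambda>z. fd (\<lambda>y. fd f y v) z u"
  assume ne: "?p x \<noteq> ?q x"
  define d where "d = \<bar>?p x - ?q x\<bar> / 2"
  have d: "0 < d" using ne by (simp add: d_def)
  have "continuous_on S ?p" "continuous_on S ?q"
    using f by (auto intro!: smooth_on_continuous smooth_on_fd)
  then have "isCont ?p x" "isCont ?q x"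
    using S continuous_on_eq_continuous_at by blast+
  then obtain r1 r2 where r: "0 < r1" "0 < r2"
    "\<And>z. dist z x < r1 \<Longrightarrow> dist (?p z) (?p x) < d" "\<And>z. dist z x < r2 \<Longrightarrow> dist (?q z) (?q x) < d"
    using d unfolding continuous_at_eps_delta by metis
  obtain r3 where r3: "0 < r3" "ball x r3 \<subseteq> S" using S openE by blast
  define r where "r = min r1 (min r2 r3)"
  \<comment> \<open>the parallelogram spanned by \<open>h u\<close> and \<open>h v\<close> at \<open>x\<close> then stays within distance \<open>r\<close> of \<open>x\<close>\<close>
  define h where "h = r / (2 * (norm u + norm v + 1))"
  have N: "norm u + norm v + 1 > 0" by (simp add: add_nonneg_pos)
  have rp: "0 < r" using r r3 by (simp add: r_def)
  have h: "0 < h" using N rp by (simp add: h_def)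
  have near: "dist (x + s *\<^sub>R w + t *\<^sub>R w') x < r"
    if "0 \<le> s" "s \<le> h" "0 \<le> t" "t \<le> h" "norm w + norm w' = norm u + norm v" for s t w w'
  proof -
    have "dist (x + s *\<^sub>R w + t *\<^sub>R w') x = norm (s *\<^sub>R w + t *\<^sub>R w')" by (simp add: dist_norm)
    also have "\<dots> \<le> s * norm w + t * norm w'"
      using norm_triangle_ineq[of "s *\<^sub>R w" "t *\<^sub>R w'"] that by simp
    also have "\<dots> \<le> h * norm w + h * norm w'"
      using that by (intro add_mono mult_right_mono) auto
    also have "\<dots> = h * (norm u + norm v)" using that(5) by (simp add: algebra_simps flip: that(5))
    also have "\<dots> < h * (2 * (norm u + norm v + 1))"
    proof (rule mult_strict_left_mono[OF _ h])
      show "norm u + norm v < 2 * (norm u + norm v + 1)"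
        using add_nonneg_nonneg[OF norm_ge_zero norm_ge_zero, of u v] by argo
    qed
    also have "\<dots> = r" using N by (simp add: h_def)
    finally show ?thesis .
  qed
  have inS: "x + s *\<^sub>R w + t *\<^sub>R w' \<in> S"
    if "0 \<le> s" "s \<le> h" "0 \<le> t" "t \<le> h" "norm w + norm w' = norm u + norm v" for s t w w'
    using near[OF that] r3 by (auto simp: r_def dist_commute)
  obtain s t where st: "0 < s" "s < h" "0 < t" "t < h"
    "f (x + h *\<^sub>R u + h *\<^sub>R v) - f (x + h *\<^sub>R u) - (f (x + h *\<^sub>R v) - f x)
       = h * (h * ?p (x + s *\<^sub>R u + t *\<^sub>R v))"
    by (rule second_difference_mean_value[OF f h, of x u v]) (use inS in auto)
  obtain s' t' where st': "0 < s'" "s' < h" "0 < t'" "t' < h"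
    "f (x + h *\<^sub>R v + h *\<^sub>R u) - f (x + h *\<^sub>R v) - (f (x + h *\<^sub>R u) - f x)
       = h * (h * ?q (x + s' *\<^sub>R v + t' *\<^sub>R u))"
    by (rule second_difference_mean_value[OF f h, of x v u]) (use inS in auto)
  have sw: "x + h *\<^sub>R v + h *\<^sub>R u = x + h *\<^sub>R u + h *\<^sub>R v" by simp
  have "h * (h * ?p (x + s *\<^sub>R u + t *\<^sub>R v)) = h * (h * ?q (x + s' *\<^sub>R v + t' *\<^sub>R u))"
    using st(5) st'(5) unfolding sw by linarith
  then have eq: "?p (x + s *\<^sub>R u + t *\<^sub>R v) = ?q (x + s' *\<^sub>R v + t' *\<^sub>R u)" using h by simp
  have "dist (?p (x + s *\<^sub>R u + t *\<^sub>R v)) (?p x) < d"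
    using near[of s t u v] st by (intro r(3)) (auto simp: r_def)
  moreover have "dist (?q (x + s' *\<^sub>R v + t' *\<^sub>R u)) (?q x) < d"
    using near[of s' t' v u] st' by (intro r(4)) (auto simp: r_def)
  ultimately have "dist (?p x) (?q x) < d + d"
    using dist_triangle3[of "?p x" "?q x" "?p (x + s *\<^sub>R u + t *\<^sub>R v)"] unfolding eq by linarith
  then show False by (simp add: d_def dist_real_def)
qed

lemma fd_commute:
  fixes f :: "'a::real_normed_vector \<Rightarrow> 'b::euclidean_space"
  assumes f: "smooth_on f S" and S: "open S" "x \<in> S"
  shows "fd (\<lambda>y. fd f y u) x v = fd (\<lambda>y. fd f y v) x u"
proof (rule euclidean_eqI)
  fix b :: 'b assume "b \<in> Basis"
  have comp: "fd (\<lambda>y. g y \<bullet> b) y w = fd g y w \<bullet> b" if "smooth_on g S" "y \<in> S" for g :: "'a \<Rightarrow> 'b" and y w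
    using fd_eqI[OF has_derivative_inner_left[OF smooth_on_has_derivative[OF that], of b]] by simp
  have sm: "smooth_on (\<lambda>y. f y \<bullet> b) S" by (intro smooth_on_inner smooth_on_const f S)
  have c2: "fd (\<lambda>y. fd (\<lambda>y. f y \<bullet> b) y w) x w' = fd (\<lambda>y. fd f y w) x w' \<bullet> b" for w w'
  proof -
    have "fd (\<lambda>y. fd (\<lambda>y. f y \<bullet> b) y w) x = fd (\<lambda>y. fd f y w \<bullet> b) x"
      by (rule fd_cong_open(2)[OF S])
         (use comp[OF f] in \<open>auto intro!: smooth_on_differentiable[OF _ S(2)] smooth_on_inner smooth_on_const smooth_on_fd f S\<close>)
    then show ?thesis using comp[OF smooth_on_fd[OF f] S(2)] by simp
  qed
  show "fd (\<lambda>y. fd f y u) x v \<bullet> b = fd (\<lambda>y. fd f y v) x u \<bullet> b"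
    using fd_commute_real[OF sm S, of u v] by (simp add: c2)
qed

section \<open>Metrics and their Christoffel symbols\<close>

lemma riesz_unique:
  assumes "bilinear B" "\<And>u. (\<And>v. B u v = 0) \<Longrightarrow> u = 0" "\<And>v. B u v = l v"
  shows "riesz B l = u"
  unfolding riesz_def
proof (rule the_equality)
  fix w assume w: "\<forall>v. B w v = l v"
  have "w - u = 0" by (rule assms(2)) (simp add: bilinear_lsub[OF assms(1)] w assms(3))
  then show "w = u" by simp
qed (simp add: assms(3))

text \<open>
  Nondegeneracy makes \<open>u \<mapsto> B u\<close> injective, hence surjective onto the dual space by dimension.
\<close>

lemma riesz_works:
  fixes B :: "'a::euclidean_space \<Rightarrow> 'a \<Rightarrow> real"
  assumes B: "bilinear B" and nd: "\<And>u. (\<And>v. B u v = 0) \<Longrightarrow> u = 0" and l: "linear l"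
  shows "B (riesz B l) v = l v"
proof -
  let ?S = "\<lambda>u. \<Sum>b\<in>Basis. B u b *\<^sub>R b"
  have lin: "linear ?S"
    by (rule linearI)
       (simp_all add: bilinear_ladd[OF B] bilinear_lmul[OF B] scaleR_add_left sum.distrib scaleR_sum_right)
  have rep: "k v = (\<Sum>b\<in>Basis. (v \<bullet> b) * k b)" if "linear k" for k :: "'a \<Rightarrow> real" and v
  proof -
    have "k v = k (\<Sum>b\<in>Basis. (v \<bullet> b) *\<^sub>R b)" by (simp add: euclidean_representation)
    then show ?thesis by (simp add: linear_sum[OF that] linear_scale[OF that])
  qed
  have lr: "linear (B u)" for u using B by (simp add: bilinear_def)
  have "inj ?S"
    unfolding linear_injective_0[OF lin]
  proof (intro allI impI)
    fix u assume "?S u = 0"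
    then have 0: "?S u \<bullet> b = 0" for b by (simp only: inner_zero_left)
    have "B u b = 0" if "b \<in> Basis" for b
    proof -
      have "?S u \<bullet> b = B u b" using that by simp
      with 0[of b] show ?thesis by linarith
    qed
    then have "B u v = 0" for v using rep[OF lr, of u v] by simp
    then show "u = 0" by (rule nd)
  qed
  then have "surj ?S" using linear_injective_imp_surjective[OF lin] by simp
  then obtain u where u: "(\<Sum>b\<in>Basis. l b *\<^sub>R b) = ?S u" by (rule surjE)
  have "B u b = l b" if "b \<in> Basis" for b
    using arg_cong[OF u, of "\<lambda>w. w \<bullet> b"] that by simp
  then have "B u v = l v" for v using rep[OF lr, of u v] rep[OF l, of v] by simp
  then show ?thesis using riesz_unique[OF B nd, of u l] by simp
qed

lemma bilinear_expansion:
  fixes B :: "'b::euclidean_space \<Rightarrow> 'c::euclidean_space \<Rightarrow> 'd::real_normed_vector"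
  assumes "bilinear B"
  shows "B u v = (\<Sum>i\<in>Basis. \<Sum>j\<in>Basis. ((u \<bullet> i) * (v \<bullet> j)) *\<^sub>R B i j)"
proof -
  have "B u v = B (\<Sum>i\<in>Basis. (u \<bullet> i) *\<^sub>R i) (\<Sum>j\<in>Basis. (v \<bullet> j) *\<^sub>R j)"
    by (simp add: euclidean_representation)
  also have "\<dots> = (\<Sum>(i,j)\<in>Basis\<times>Basis. B ((u \<bullet> i) *\<^sub>R i) ((v \<bullet> j) *\<^sub>R j))"
    by (rule bilinear_sum[OF assms])
  finally show ?thesis
    by (simp add: sum.cartesian_product bilinear_lmul[OF assms] bilinear_rmul[OF assms]
        case_prod_unfold mult.commute)
qed

lemma fd_bilinear_family:
  fixes B :: "'a::real_normed_vector \<Rightarrow> 'b::euclidean_space \<Rightarrow> 'c::euclidean_space \<Rightarrow> 'd::real_normed_vector"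
  assumes T: "open T" "x \<in> T" and bil: "\<And>z. z \<in> T \<Longrightarrow> bilinear (B z)"
    and diff: "\<And>u v. (\<lambda>z. B z u v) differentiable (at x)"
  shows "bilinear (\<lambda>u v. fd (\<lambda>z. B z u v) x h)"
proof -
  have D: "((\<lambda>z. B z u v) has_derivative fd (\<lambda>z. B z u v) x) (at x)" for u v
    using diff frechet_derivative_works by blast
  have E: "fd f x h = f'' h" if "(f' has_derivative f'') (at x)" "\<And>z. z \<in> T \<Longrightarrow> f' z = f z" 
    for f f' :: "'a \<Rightarrow> 'd" and f''
    using that fd_cong_open(2)[OF T, of f' f] by (auto simp: differentiable_def fd_eqI)
  show ?thesis
    unfolding bilinear_def
  proof (intro conjI allI linearI)
    fix u v w and c :: real
    show "fd (\<lambda>z. B z u (v + w)) x h = fd (\<lambda>z. B z u v) x h + fd (\<lambda>z. B z u w) x h"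
      by (rule E[OF has_derivative_add[OF D D]]) (simp add: bil bilinear_radd)
    show "fd (\<lambda>z. B z u (c *\<^sub>R v)) x h = c *\<^sub>R fd (\<lambda>z. B z u v) x h"
      by (rule E[OF has_derivative_scaleR_right[OF D]]) (simp add: bil bilinear_rmul)
  next
    fix u v w and c :: real
    show "fd (\<lambda>z. B z (v + w) u) x h = fd (\<lambda>z. B z v u) x h + fd (\<lambda>z. B z w u) x h"
      by (rule E[OF has_derivative_add[OF D D]]) (simp add: bil bilinear_ladd)
    show "fd (\<lambda>z. B z (c *\<^sub>R v) u) x h = c *\<^sub>R fd (\<lambda>z. B z v u) x h"
      by (rule E[OF has_derivative_scaleR_right[OF D]]) (simp add: bil bilinear_lmul)
  qed
qed

text \<open>
  The product rule for a bilinear map that depends on a point. Metrics, Christoffel symbols and differentials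
  applied to vector fields are all differentiated with this rule.
\<close>

lemma has_derivative_bilinear_family:
  fixes B :: "'z::real_normed_vector \<Rightarrow> 'b::euclidean_space \<Rightarrow> 'c::euclidean_space \<Rightarrow> 'd::real_normed_vector"
    and F :: "'a::real_normed_vector \<Rightarrow> 'z"
  assumes S: "open S" "x \<in> S" and T: "open T" "F ` S \<subseteq> T" and bil: "\<And>z. z \<in> T \<Longrightarrow> bilinear (B z)"
    and diff: "\<And>u v. (\<lambda>z. B z u v) differentiable (at (F x))"
    and F: "(F has_derivative F') (at x)"
    and p: "(p has_derivative p') (at x)" and q: "(q has_derivative q') (at x)"
  shows "((\<lambda>y. B (F y) (p y) (q y)) has_derivative
          (\<lambda>h. fd (\<lambda>z. B z (p x) (q x)) (F x) (F' h) + B (F x) (p' h) (q x) + B (F x) (p x) (q' h))) (at x)"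
proof (rule has_derivative_transform_within_open[OF _ S])
  have Fx: "F x \<in> T" using S T by auto
  show "((\<lambda>y. \<Sum>i\<in>Basis. \<Sum>j\<in>Basis. ((p y \<bullet> i) * (q y \<bullet> j)) *\<^sub>R B (F y) i j) has_derivative
    (\<lambda>h. fd (\<lambda>z. B z (p x) (q x)) (F x) (F' h) + B (F x) (p' h) (q x) + B (F x) (p x) (q' h))) (at x)"
  proof (rule has_derivative_eq_rhs)
    show "((\<lambda>y. \<Sum>i\<in>Basis. \<Sum>j\<in>Basis. ((p y \<bullet> i) * (q y \<bullet> j)) *\<^sub>R B (F y) i j) has_derivative
      (\<lambda>h. \<Sum>i\<in>Basis. \<Sum>j\<in>Basis. ((p x \<bullet> i) * (q x \<bullet> j)) *\<^sub>R fd (\<lambda>z. B z i j) (F x) (F' h)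
         + ((p x \<bullet> i) * (q' h \<bullet> j) + (p' h \<bullet> i) * (q x \<bullet> j)) *\<^sub>R B (F x) i j)) (at x)"
      by (intro has_derivative_sum has_derivative_scaleR has_derivative_mult
          has_derivative_inner_left p q has_derivative_compose[OF F])
         (use diff frechet_derivative_works in blast)
    have 1: "fd (\<lambda>z. B z u v) (F x) k = (\<Sum>i\<in>Basis. \<Sum>j\<in>Basis. ((u \<bullet> i) * (v \<bullet> j)) *\<^sub>R fd (\<lambda>z. B z i j) (F x) k)"
      for u v k
      by (rule bilinear_expansion[OF fd_bilinear_family[OF T(1) Fx bil diff]])
    show "(\<lambda>h. \<Sum>i\<in>Basis. \<Sum>j\<in>Basis. ((p x \<bullet> i) * (q x \<bullet> j)) *\<^sub>R fd (\<lambda>z. B z i j) (F x) (F' h)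
         + ((p x \<bullet> i) * (q' h \<bullet> j) + (p' h \<bullet> i) * (q x \<bullet> j)) *\<^sub>R B (F x) i j)
       = (\<lambda>h. fd (\<lambda>z. B z (p x) (q x)) (F x) (F' h) + B (F x) (p' h) (q x) + B (F x) (p x) (q' h))"
      by (rule ext, subst 1, subst (2) bilinear_expansion[OF bil[OF Fx]], subst (3) bilinear_expansion[OF bil[OF Fx]])
         (simp add: sum.distrib scaleR_add_left)
  qed
  show "(\<Sum>i\<in>Basis. \<Sum>j\<in>Basis. ((p y \<bullet> i) * (q y \<bullet> j)) *\<^sub>R B (F y) i j) = B (F y) (p y) (q y)" if "y \<in> S" for y
    using bilinear_expansion[OF bil, of "F y" "p y" "q y"] that T by auto
qed

lemma smooth_on_bilinear_family:
  fixes B :: "'z::euclidean_space \<Rightarrow> 'b::euclidean_space \<Rightarrow> 'c::euclidean_space \<Rightarrow> 'd::real_normed_vector"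
    and F :: "'a::real_normed_vector \<Rightarrow> 'z"
  assumes S: "open S" and T: "F ` S \<subseteq> T" and bil: "\<And>z. z \<in> T \<Longrightarrow> bilinear (B z)"
    and B: "\<And>u v. smooth_on (\<lambda>z. B z u v) T"
    and F: "smooth_on F S" and p: "smooth_on p S" and q: "smooth_on q S"
  shows "smooth_on (\<lambda>y. B (F y) (p y) (q y)) S"
proof (rule smooth_on_cong[OF S])
  show "smooth_on (\<lambda>y. \<Sum>i\<in>Basis. \<Sum>j\<in>Basis. ((p y \<bullet> i) * (q y \<bullet> j)) *\<^sub>R B (F y) i j) S"
    by (intro smooth_on_sum smooth_on_scaleR smooth_on_mult smooth_on_inner smooth_on_const S p q
        smooth_on_compose[OF S F B T])
qed (use bilinear_expansion[OF bil] T in \<open>auto simp: image_subset_iff\<close>)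

lemma
  assumes "metric_on G S" "x \<in> S"
  shows metric_on_bilinear: "bilinear (G x)" and metric_on_sym: "G x u v = G x v u"
    and metric_on_nondegenerate: "(\<And>v. G x u v = 0) \<Longrightarrow> u = 0"
  using assms unfolding metric_on_def by blast+

lemma metric_on_smooth: "metric_on G S \<Longrightarrow> smooth_on (\<lambda>x. G x u v) S"
  unfolding metric_on_def by blast

lemma metric_on_riesz:
  assumes "metric_on G S" "x \<in> S" "linear l"
  shows "G x (riesz (G x) l) v = l v"
  using riesz_works[OF metric_on_bilinear[OF assms(1,2)] _ assms(3)] metric_on_nondegenerate[OF assms(1,2)] by blast

lemma metric_on_eqI:
  assumes "metric_on G S" "x \<in> S" "\<And>w. G x u w = G x v w"
  shows "u = v"
proof -
  have "u - v = 0"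
    by (rule metric_on_nondegenerate[OF assms(1,2)])
       (simp add: assms(3) bilinear_lsub[OF metric_on_bilinear[OF assms(1,2)]])
  then show ?thesis by simp
qed

context
  fixes G :: "'a::euclidean_space \<Rightarrow> 'a \<Rightarrow> 'a \<Rightarrow> real" and S x
  assumes G: "metric_on G S" and S: "open S" and x: "x \<in> S"
begin

lemma metric_fd_bilinear: "bilinear (\<lambda>v w. fd (\<lambda>y. G y v w) x u)"
  by (rule fd_bilinear_family[OF S x metric_on_bilinear[OF G]])
     (use smooth_on_differentiable[OF metric_on_smooth[OF G] x] in auto)

lemma metric_fd_linear: "linear (fd (\<lambda>y. G y v w) x)"
  by (rule linear_frechet_derivative[OF smooth_on_differentiable[OF metric_on_smooth[OF G] x]])

lemma metric_fd_sym: "fd (\<lambda>y. G y v w) x = fd (\<lambda>y. G y w v) x"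
  by (rule fd_cong_open(2)[OF S x])
     (use smooth_on_differentiable[OF metric_on_smooth[OF G] x] metric_on_sym[OF G] in auto)

lemma koszul:
  "G x (christoffel G x u v) w = (fd (\<lambda>y. G y v w) x u + fd (\<lambda>y. G y u w) x v - fd (\<lambda>y. G y u v) x w) / 2"
proof -
  note b = metric_fd_bilinear and l = metric_fd_linear
  have "linear (\<lambda>w. (fd (\<lambda>y. G y v w) x u + fd (\<lambda>y. G y u w) x v - fd (\<lambda>y. G y u v) x w) / 2)"
    by (rule linearI)
       (simp_all add: bilinear_radd[OF b] bilinear_rmul[OF b] linear_add[OF l] linear_scale[OF l] field_simps)
  from metric_on_riesz[OF G x this] show ?thesis by (simp add: christoffel_def)
qed

lemma christoffel_sym: "christoffel G x u v = christoffel G x v u"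
  by (rule metric_on_eqI[OF G x]) (simp add: koszul metric_fd_sym[of u v])

lemma christoffel_compat:
  "fd (\<lambda>y. G y v w) x u = G x (christoffel G x u v) w + G x v (christoffel G x u w)"
  by (simp add: koszul metric_on_sym[OF G x, of v] metric_fd_sym[of w v] metric_fd_sym[of v u]
      metric_fd_sym[of w u] field_simps)

text \<open>
  The Levi-Civita connection is determined by being torsion free and metric. Christoffel symbols
  of warped products and of induced metrics are found by checking these two conditions for a candidate.
\<close>

lemma christoffel_unique:
  assumes sym: "\<And>u v. \<Gamma> u v = \<Gamma> v u"
    and compat: "\<And>u v w. fd (\<lambda>y. G y v w) x u = G x (\<Gamma> u v) w + G x v (\<Gamma> u w)"
  shows "christoffel G x u v = \<Gamma> u v"
proof (rule metric_on_eqI[OF G x])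
  show "G x (christoffel G x u v) w = G x (\<Gamma> u v) w" for w
    by (simp add: koszul compat sym[of v u] sym[of w u] sym[of w v] metric_on_sym[OF G x, of v "\<Gamma> u w"])
qed

lemma christoffel_bilinear: "bilinear (christoffel G x)"
proof -
  note b = metric_fd_bilinear and l = metric_fd_linear and g = metric_on_bilinear[OF G x]
  have add: "christoffel G x u (v + w) = christoffel G x u v + christoffel G x u w" for u v w
    by (rule metric_on_eqI[OF G x])
       (simp add: koszul bilinear_ladd[OF g] bilinear_radd[OF b] bilinear_ladd[OF b] linear_add[OF l] field_simps)
  have mul: "christoffel G x u (c *\<^sub>R v) = c *\<^sub>R christoffel G x u v" for u v c
    by (rule metric_on_eqI[OF G x])
       (simp add: koszul bilinear_lmul[OF g] bilinear_rmul[OF b] bilinear_lmul[OF b] linear_scale[OF l] field_simps)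
  show ?thesis unfolding bilinear_def
    by (intro conjI allI linearI; metis add mul christoffel_sym)
qed

end

lemma smooth_on_det:
  fixes M :: "'a::real_normed_vector \<Rightarrow> real^'n^'n"
  assumes "open S" "\<And>i j. smooth_on (\<lambda>x. M x $ i $ j) S"
  shows "smooth_on (\<lambda>x. det (M x)) S"
  unfolding det_def
  by (intro smooth_on_sum smooth_on_mult smooth_on_const smooth_on_prod assms)

text \<open>The solution of a smooth linear system is smooth by Cramer's rule.\<close>

lemma smooth_on_christoffel:
  fixes G :: "real^'k \<Rightarrow> real^'k \<Rightarrow> real^'k \<Rightarrow> real"
  assumes G: "metric_on G S" and S: "open S"
  shows "smooth_on (\<lambda>x. christoffel G x u v) S"
proof -
  define A where "A x = (\<chi> i j. G x (axis j 1) (axis i 1))" for x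
  define b where "b x = (\<chi> i. G x (christoffel G x u v) (axis i 1))" for x
  have A: "A x *v w = (\<chi> i. G x w (axis i 1))" if "x \<in> S" for x w
  proof -
    note g = metric_on_bilinear[OF G that]
    have l: "linear (\<lambda>w. G x w (axis i 1))" for i using g by (simp add: bilinear_def)
    have "(\<Sum>j\<in>UNIV. w $ j *\<^sub>R axis j 1) = w"
      using basis_expansion[of w] by (simp add: scalar_mult_eq_scaleR)
    then have "G x w (axis i 1) = G x (\<Sum>j\<in>UNIV. w $ j *\<^sub>R axis j 1) (axis i 1)" for i
      by simp
    then have "G x w (axis i 1) = (\<Sum>j\<in>UNIV. w $ j * G x (axis j 1) (axis i 1))" for i
      by (simp add: linear_sum[OF l] linear_scale[OF l])
    then show ?thesis
      by (simp add: matrix_vector_mult_def A_def vec_eq_iff mult.commute)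
  qed
  have det: "det (A x) \<noteq> 0" if "x \<in> S" for x
  proof -
    have "w = 0" if w: "A x *v w = 0" for w
    proof (rule metric_on_nondegenerate[OF G \<open>x \<in> S\<close>])
      fix z :: "real^'k"
      note g = metric_on_bilinear[OF G \<open>x \<in> S\<close>]
      have l: "linear (G x w)" using g by (simp add: bilinear_def)
      have "(\<Sum>j\<in>UNIV. z $ j *\<^sub>R axis j 1) = z"
        using basis_expansion[of z] by (simp add: scalar_mult_eq_scaleR)
      then have "G x w z = G x w (\<Sum>j\<in>UNIV. z $ j *\<^sub>R axis j 1)"
        by simp
      moreover have "G x w (axis i 1) = 0" for i using w by (simp add: A[OF \<open>x \<in> S\<close>] vec_eq_iff)
      ultimately show "G x w z = 0" by (simp add: linear_sum[OF l] linear_scale[OF l])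
    qed
    then show ?thesis
      using matrix_left_invertible_ker invertible_left_inverse invertible_det_nz by metis
  qed
  have sol: "christoffel G x u v = (\<chi> k. det(\<chi> i j. if j=k then b x$i else A x$i$j) / det (A x))" if "x \<in> S" for x
    using cramer[OF det[OF that], of "christoffel G x u v" "b x"] A[OF that] by (simp add: b_def)
  have bs: "smooth_on (\<lambda>x. b x $ i) S" for i
  proof (rule smooth_on_cong[OF S, where f = "\<lambda>x. (fd (\<lambda>y. G y v (axis i 1)) x u + fd (\<lambda>y. G y u (axis i 1)) x v
       - fd (\<lambda>y. G y u v) x (axis i 1)) / 2"])
    show "smooth_on (\<lambda>x. (fd (\<lambda>y. G y v (axis i 1)) x u + fd (\<lambda>y. G y u (axis i 1)) x v
       - fd (\<lambda>y. G y u v) x (axis i 1)) / 2) S"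
      by (intro smooth_on_divide smooth_on_diff smooth_on_add smooth_on_fd smooth_on_const
          metric_on_smooth[OF G] S) auto
  qed (simp add: b_def koszul[OF G S])
  have As: "smooth_on (\<lambda>x. A x $ i $ j) S" for i j
    by (simp add: A_def metric_on_smooth[OF G])
  show ?thesis
  proof (rule smooth_on_cong[OF S, where f = "\<lambda>x. \<chi> k. det(\<chi> i j. if j=k then b x$i else A x$i$j) / det (A x)"])
    show "smooth_on (\<lambda>x. \<chi> k. det(\<chi> i j. if j=k then b x$i else A x$i$j) / det (A x)) S"
    proof (rule smooth_on_components[OF S])
      fix e :: "real^'k" assume "e \<in> Basis"
      then obtain k where e: "e = axis k 1" by (auto simp: Basis_vec_def)
      have "smooth_on (\<lambda>x. det(\<chi> i j. if j=k then b x$i else A x$i$j) / det (A x)) S"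
      proof (intro smooth_on_divide smooth_on_det S)
        show "smooth_on (\<lambda>x. (\<chi> i j. if j = k then b x $ i else A x $ i $ j) $ i $ j) S" for i j
          using bs As by (cases "j = k") auto
      qed (use As det in auto)
      then show "smooth_on (\<lambda>x. (\<chi> k. det(\<chi> i j. if j=k then b x$i else A x$i$j) / det (A x)) \<bullet> e) S"
        by (simp add: e inner_axis)
    qed
  qed (simp add: sol)
qed

section \<open>Curvature of a metric\<close>

text \<open>
  The curvature \<open>R(u, v)w\<close> of the connection with Christoffel symbols \<open>\<Gamma>\<close>, expressed through \<open>\<Gamma>\<close> alone:
  in this form it depends on vectors rather than on fields.
\<close>

definition coord_curvature ::
    "('b::euclidean_space \<Rightarrow> 'b \<Rightarrow> 'b \<Rightarrow> 'b) \<Rightarrow> 'b \<Rightarrow> 'b \<Rightarrow> 'b \<Rightarrow> 'b \<Rightarrow> 'b" where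
  "coord_curvature \<Gamma> x u v w =
     fd (\<lambda>y. \<Gamma> y v w) x u - fd (\<lambda>y. \<Gamma> y u w) x v + \<Gamma> x u (\<Gamma> x v w) - \<Gamma> x v (\<Gamma> x u w)"

context
  fixes G :: "'a::euclidean_space \<Rightarrow> 'a \<Rightarrow> 'a \<Rightarrow> real" and S x
  assumes G: "metric_on G S" and S: "open S" and x: "x \<in> S"
    and \<Gamma>: "\<And>u v. smooth_on (\<lambda>x. christoffel G x u v) S"
begin

lemma curvature_constant_fields:
  "curvature G (\<lambda>_. u) (\<lambda>_. v) (\<lambda>_. w) x = coord_curvature (christoffel G) x u v w"
proof -
  have 1: "cov_deriv G (\<lambda>_. v) (\<lambda>_. w) = (\<lambda>y. christoffel G y v w)" for v w
    by (rule ext) (simp add: cov_deriv_def)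
  have 2: "lie_bracket (\<lambda>_. u) (\<lambda>_. v) = (\<lambda>_. 0)"
    by (rule ext) (simp add: lie_bracket_def)
  show ?thesis
    unfolding curvature_def 1 2
    by (simp add: cov_deriv_def coord_curvature_def bilinear_lzero[OF christoffel_bilinear[OF G S x]])
qed

lemma coord_curvature_add:
  "coord_curvature (christoffel G) x (u + u') v w =
     coord_curvature (christoffel G) x u v w + coord_curvature (christoffel G) x u' v w"
  "coord_curvature (christoffel G) x u v (w + w') =
     coord_curvature (christoffel G) x u v w + coord_curvature (christoffel G) x u v w'"
  and coord_curvature_scale:
  "coord_curvature (christoffel G) x (c *\<^sub>R u) v w = c *\<^sub>R coord_curvature (christoffel G) x u v w"
  "coord_curvature (christoffel G) x u v (c *\<^sub>R w) = c *\<^sub>R coord_curvature (christoffel G) x u v w"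
proof -
  note b = christoffel_bilinear[OF G S x]
  have d: "bilinear (\<lambda>u v. fd (\<lambda>y. christoffel G y u v) x h)" for h
    by (rule fd_bilinear_family[OF S x christoffel_bilinear[OF G S]])
       (use smooth_on_differentiable[OF \<Gamma> x] in auto)
  have l: "linear (fd (\<lambda>y. christoffel G y v w) x)" for v w
    by (rule linear_frechet_derivative[OF smooth_on_differentiable[OF \<Gamma> x]])
  note simps = coord_curvature_def bilinear_ladd[OF b] bilinear_radd[OF b] bilinear_lmul[OF b] bilinear_rmul[OF b]
      bilinear_ladd[OF d] bilinear_radd[OF d] bilinear_lmul[OF d] bilinear_rmul[OF d]
      linear_add[OF l] linear_scale[OF l]
  show "coord_curvature (christoffel G) x (u + u') v w =
     coord_curvature (christoffel G) x u v w + coord_curvature (christoffel G) x u' v w"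
    "coord_curvature (christoffel G) x u v (w + w') =
     coord_curvature (christoffel G) x u v w + coord_curvature (christoffel G) x u v w'"
    "coord_curvature (christoffel G) x (c *\<^sub>R u) v w = c *\<^sub>R coord_curvature (christoffel G) x u v w"
    "coord_curvature (christoffel G) x u v (c *\<^sub>R w) = c *\<^sub>R coord_curvature (christoffel G) x u v w"
    by (simp_all add: simps algebra_simps)
qed

lemma coord_curvature_bianchi:
  "coord_curvature (christoffel G) x u v w + coord_curvature (christoffel G) x v w u
     + coord_curvature (christoffel G) x w u v = 0"
proof -
  have s: "christoffel G x u v = christoffel G x v u" for u v
    by (rule christoffel_sym[OF G S x])
  have d: "fd (\<lambda>y. christoffel G y u v) x = fd (\<lambda>y. christoffel G y v u) x" for u v
    by (rule fd_cong_open(2)[OF S x])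
       (use smooth_on_differentiable[OF \<Gamma> x] christoffel_sym[OF G S] in auto)
  show ?thesis
    unfolding coord_curvature_def
    by (simp add: s[of w u] s[of w v] s[of v u] d[of w u] d[of w v] d[of v u])
qed

text \<open>
  Metric compatibility, differentiated once more. The left-hand side is symmetric in \<open>u\<close> and \<open>v\<close>, and the
  antisymmetric part of the right-hand side is \<open>\<langle>R(u,v)w, z\<rangle> + \<langle>R(u,v)z, w\<rangle>\<close>.
\<close>

lemma fd_christoffel_compat:
  "fd (\<lambda>y. fd (\<lambda>y. G y w z) y v) x u =
     G x (christoffel G x u (christoffel G x v w)) z + G x (christoffel G x v w) (christoffel G x u z)
   + G x (fd (\<lambda>y. christoffel G y v w) x u) z
   + (G x (christoffel G x u (christoffel G x v z)) w + G x (christoffel G x v z) (christoffel G x u w)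
   + G x (fd (\<lambda>y. christoffel G y v z) x u) w)"
proof -
  have "((\<lambda>y. G y (christoffel G y v w) z) has_derivative
     (\<lambda>h. fd (\<lambda>y. G y (christoffel G x v w) z) x h + G x (fd (\<lambda>y. christoffel G y v w) x h) z
        + G x (christoffel G x v w) 0)) (at x)" for w z
    by (rule has_derivative_bilinear_family[OF S x S _ metric_on_bilinear[OF G], where F = "\<lambda>y. y" and F' = "\<lambda>h. h"])
       (auto intro!: smooth_on_differentiable[OF metric_on_smooth[OF G] x] smooth_on_has_derivative[OF \<Gamma> x])
  then have D: "((\<lambda>y. G y (christoffel G y v w) z) has_derivative
     (\<lambda>h. fd (\<lambda>y. G y (christoffel G x v w) z) x h + G x (fd (\<lambda>y. christoffel G y v w) x h) z)) (at x)" for w z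
    by (simp add: bilinear_rzero[OF metric_on_bilinear[OF G x]])
  have "((\<lambda>y. fd (\<lambda>y. G y w z) y v) has_derivative
      (\<lambda>h. (fd (\<lambda>y. G y (christoffel G x v w) z) x h + G x (fd (\<lambda>y. christoffel G y v w) x h) z)
         + (fd (\<lambda>y. G y (christoffel G x v z) w) x h + G x (fd (\<lambda>y. christoffel G y v z) x h) w))) (at x)"
    by (rule has_derivative_transform_within_open[OF has_derivative_add[OF D D] S x])
       (use christoffel_compat[OF G S] metric_on_sym[OF G] in auto)
  from fd_eqI[OF this] show ?thesis by (simp add: christoffel_compat[OF G S x])
qed

lemma coord_curvature_skew:
  "G x (coord_curvature (christoffel G) x u v w) z = - G x (coord_curvature (christoffel G) x u v z) w"
proof -
  note g = metric_on_bilinear[OF G x]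
  have "fd (\<lambda>y. fd (\<lambda>y. G y w z) y v) x u = fd (\<lambda>y. fd (\<lambda>y. G y w z) y u) x v"
    by (rule fd_commute[OF metric_on_smooth[OF G] S x])
  then show ?thesis
    unfolding fd_christoffel_compat coord_curvature_def
    by (simp add: bilinear_ladd[OF g] bilinear_lsub[OF g] metric_on_sym[OF G x, of "christoffel G x v w" "christoffel G x u z"]
        metric_on_sym[OF G x, of "christoffel G x u w" "christoffel G x v z"])
qed

end

text \<open>
  Polarisation: from \<open>K(u,v,v,u) = 0\<close>, polarising in \<open>v\<close> and using the pair symmetry gives \<open>K(u,v,w,u) = 0\<close>;
  polarising in \<open>u\<close> then makes \<open>K\<close> skew in its second and third arguments as well, so that the
  three terms of the Bianchi identity are equal.
\<close>

lemma curvature_like_tensor_zero: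
  fixes K :: "'a::real_vector \<Rightarrow> 'a \<Rightarrow> 'a \<Rightarrow> 'a \<Rightarrow> real"
  assumes add1: "\<And>u u' v w z. K (u + u') v w z = K u v w z + K u' v w z"
    and add3: "\<And>u v w w' z. K u v (w + w') z = K u v w z + K u v w' z"
    and skew12: "\<And>u v w z. K u v w z = - K v u w z"
    and skew34: "\<And>u v w z. K u v w z = - K u v z w"
    and bianchi: "\<And>u v w z. K u v w z + K v w u z + K w u v z = 0"
    and sec: "\<And>u v. K u v v u = 0"
  shows "K u v w z = 0"
proof -
  have add2: "K u (v + v') w z = K u v w z + K u v' w z" for u v v' w z
    using skew12[of u "v + v'" w z] skew12[of u v w z] skew12[of u v' w z] add1[of v v' u w z] by linarith
  have add4: "K u v w (z + z') = K u v w z + K u v w z'" for u v w z z'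
    using skew34[of u v w "z + z'"] skew34[of u v w z] skew34[of u v w z'] add3[of u v z z' w] by linarith
  have pair: "K u v w z = K w z u v" for u v w z
    using bianchi[of u v w z] bianchi[of v w z u] bianchi[of w z u v] bianchi[of z u v w]
      skew12[of u v] skew34[of u v] skew12[of v w] skew34[of v w] skew12[of w z] skew34[of w z]
      skew12[of z u] skew34[of z u] skew12[of u w] skew34[of u w] skew12[of v z] skew34[of v z]
    by (smt (verit, ccfv_threshold) skew12 skew34)
  have s: "K u v w u = 0" for u v w
  proof -
    have "K u (v + w) (v + w) u = 0" by (rule sec)
    then have "K u v w u + K u w v u = 0" unfolding add2 add3 by (simp add: sec)
    moreover have "K u w v u = K u v w u"
      using pair[of u w v u] skew12[of v u u w] skew34[of u v u w] by linarith
    ultimately show ?thesis by simp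
  qed
  have flip: "K u v w z = - K z v w u" for u v w z
  proof -
    have "K (u + z) v w (u + z) = 0" by (rule s)
    then show ?thesis unfolding add1 add4 by (simp add: s)
  qed
  have 1: "K u v w z = - K u w v z" for u v w z
    using flip[of u v w z] pair[of z v w u] skew12[of w u z v] skew34[of u w z v] by linarith
  have "K v w u z = K u v w z" using 1[of v w u z] skew12[of v u w z] by linarith
  moreover have "K w u v z = K u v w z" using 1[of u v w z] skew12[of w u v z] by linarith
  ultimately show ?thesis using bianchi[of u v w z] by linarith
qed

text \<open>
  If some \<open>u\<close> with \<open>B u u \<noteq> 0\<close> spans no nondegenerate plane, then polarising \<open>B u u * B v v = (B u v)\<^sup>2\<close>
  shows that the part of any \<open>v\<close> orthogonal to \<open>u\<close> is orthogonal to everything, so \<open>u\<close> spans the space.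
\<close>

lemma nondegenerate_plane_or_line:
  fixes B :: "'a::euclidean_space \<Rightarrow> 'a \<Rightarrow> real"
  assumes B: "bilinear B" and sym: "\<And>u v. B u v = B v u" and nd: "\<And>u. (\<And>v. B u v = 0) \<Longrightarrow> u = 0"
  obtains (plane) u v where "B u u * B v v - (B u v)\<^sup>2 \<noteq> 0" | (line) u :: 'a where "\<And>v. \<exists>s. v = s *\<^sub>R u"
proof (cases "\<forall>u. B u u = 0")
  case True
  note b = bilinear_ladd[OF B] bilinear_radd[OF B]
  have "B u v = 0" for u v
  proof -
    have "B (u + v) (u + v) = 0" using True by blast
    then have "B u v + B v u = 0" unfolding b by (simp add: True[rule_format])
    then show ?thesis using sym[of u v] by linarith
  qed
  then have L: "\<exists>s. v = s *\<^sub>R (0::'a)" for v using nd[of v] by simp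
  show ?thesis by (rule line[OF L])
next
  case False
  then obtain u where u: "B u u \<noteq> 0" by blast
  show ?thesis
  proof (cases "\<exists>v. B u u * B v v - (B u v)\<^sup>2 \<noteq> 0")
    case False
    then have q: "B u u * B v v = (B u v)\<^sup>2" for v by simp
    have pol: "B u u * B v w = B u v * B u w" for v w
      using q[of "v + w"] q[of v] q[of w]
      by (simp add: bilinear_ladd[OF B] bilinear_radd[OF B] sym[of w v] algebra_simps power2_eq_square)
    have "v = (B u v / B u u) *\<^sub>R u" for v
    proof -
      have "v - (B u v / B u u) *\<^sub>R u = 0"
        by (rule nd) (use u pol[of v] in \<open>simp add: bilinear_lsub[OF B] bilinear_lmul[OF B] field_simps\<close>)
      then show ?thesis by simp
    qed
    then show ?thesis using line by blast
  qed (use plane in blast)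
qed

text \<open>
  A sectional condition on nondegenerate planes extends to all planes: along a line of pairs that
  starts at the given pair and moves towards a nondegenerate one, only finitely many pairs are
  degenerate.
\<close>

lemma sectional_zero_on_all_planes:
  fixes K :: "'a::euclidean_space \<Rightarrow> 'a \<Rightarrow> 'a \<Rightarrow> 'a \<Rightarrow> real" and B :: "'a \<Rightarrow> 'a \<Rightarrow> real"
  assumes B: "bilinear B" and sym: "\<And>u v. B u v = B v u" and nd: "\<And>u. (\<And>v. B u v = 0) \<Longrightarrow> u = 0"
    and l1: "\<And>v w z. linear (\<lambda>u. K u v w z)" and l2: "\<And>u w z. linear (\<lambda>v. K u v w z)"
    and l3: "\<And>u v z. linear (\<lambda>w. K u v w z)" and l4: "\<And>u v w. linear (\<lambda>z. K u v w z)"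
    and skew12: "\<And>u v w z. K u v w z = - K v u w z"
    and sec: "\<And>u v. B u u * B v v - (B u v)\<^sup>2 \<noteq> 0 \<Longrightarrow> K u v v u = 0"
  shows "K u v v u = 0"
proof (rule nondegenerate_plane_or_line[OF B sym])
  show "u = 0" if "\<And>v. B u v = 0" for u using that by (rule nd)
next
  fix e :: 'a assume e: "\<And>v. \<exists>s. v = s *\<^sub>R e"
  obtain s t where "u = s *\<^sub>R e" "v = t *\<^sub>R e" using e by blast
  moreover have "K e e w z = 0" for w z using skew12[of e e w z] by simp
  ultimately show ?thesis by (simp add: linear_scale[OF l1] linear_scale[OF l2])
next
  fix u1 v1 :: 'a assume 1: "B u1 u1 * B v1 v1 - (B u1 v1)\<^sup>2 \<noteq> 0"
  let ?u = "\<lambda>t. u + t *\<^sub>R u1" and ?v = "\<lambda>t. v + t *\<^sub>R v1"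
  let ?Q = "\<lambda>u v. B u u * B v v - (B u v)\<^sup>2"
  note b = bilinear_ladd[OF B] bilinear_radd[OF B] bilinear_lmul[OF B] bilinear_rmul[OF B]
  note l = linear_add[OF l1] linear_add[OF l2] linear_add[OF l3] linear_add[OF l4]
    linear_scale[OF l1] linear_scale[OF l2] linear_scale[OF l3] linear_scale[OF l4]
  \<comment> \<open>the coefficients of \<open>?Q (?u t) (?v t)\<close> as a polynomial in \<open>t\<close>; the leading one is \<open>?Q u1 v1\<close>\<close>
  define c :: "nat \<Rightarrow> real" where "c i =
    (if i = 0 then B u u * B v v - B u v * B u v
     else if i = 1 then B u u * (2 * B v v1) + 2 * B u u1 * B v v - 2 * B u v * (B u v1 + B u1 v)
     else if i = 2 then B u u * B v1 v1 + 2 * B u u1 * (2 * B v v1) + B u1 u1 * B v v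
        - 2 * B u v * B u1 v1 - (B u v1 + B u1 v) * (B u v1 + B u1 v)
     else if i = 3 then 2 * B u u1 * B v1 v1 + B u1 u1 * (2 * B v v1) - 2 * (B u v1 + B u1 v) * B u1 v1
     else B u1 u1 * B v1 v1 - B u1 v1 * B u1 v1)" for i
  have atMost_4: "{..4::nat} = {0, 1, 2, 3, 4}" by auto
  have "?Q (?u t) (?v t) = (\<Sum>i\<le>4. c i * t ^ i)" for t
    unfolding atMost_4
    by (simp add: c_def power3_eq_cube power4_eq_xxxx b power2_eq_square sym[of u1 u] sym[of v1 v] algebra_simps)
  moreover have "finite {t. (\<Sum>i\<le>4. c i * t ^ i) = 0}"
    unfolding polyfun_finite_roots using 1 by (intro exI[of _ 4]) (simp add: c_def power2_eq_square)
  ultimately have "finite {t. ?Q (?u t) (?v t) = 0}" by simp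
  then have "eventually (\<lambda>t. t \<notin> {t. ?Q (?u t) (?v t) = 0}) (at 0)"
    using islimpt_finite islimpt_iff_eventually by blast
  then have ev: "eventually (\<lambda>t. K (?u t) (?v t) (?v t) (?u t) = 0) (at 0)"
    by (rule eventually_mono) (use sec in blast)
  have "isCont (\<lambda>t. K (?u t) (?v t) (?v t) (?u t)) 0"
    unfolding l by (intro continuous_intros)
  then have "((\<lambda>t. K (?u t) (?v t) (?v t) (?u t)) \<longlongrightarrow> K (?u 0) (?v 0) (?v 0) (?u 0)) (at 0)"
    by (simp add: isCont_def)
  moreover have "((\<lambda>t. K (?u t) (?v t) (?v t) (?u t)) \<longlongrightarrow> 0) (at 0)"
    by (rule tendsto_eventually[OF ev])
  ultimately have "K (?u 0) (?v 0) (?v 0) (?u 0) = 0"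
    using tendsto_unique[OF at_neq_bot] by blast
  then show ?thesis by simp
qed

text \<open>
  The difference of both sides, as a form in four arguments, has all the symmetries of a curvature tensor
  and vanishes on nondegenerate planes.
\<close>

lemma constant_curvature_tensor:
  fixes G :: "'a::euclidean_space \<Rightarrow> 'a \<Rightarrow> 'a \<Rightarrow> real"
  assumes G: "metric_on G S" and S: "open S" and x: "x \<in> S"
    and \<Gamma>: "\<And>u v. smooth_on (\<lambda>x. christoffel G x u v) S"
    and c: "constant_curvature_on G c S"
  shows "coord_curvature (christoffel G) x u v w = c *\<^sub>R (G x v w *\<^sub>R u - G x u w *\<^sub>R v)"
proof (rule metric_on_eqI[OF G x])
  fix z
  let ?R = "coord_curvature (christoffel G) x"
  note g = metric_on_bilinear[OF G x] and sym = metric_on_sym[OF G x]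
  note gs = bilinear_ladd[OF g] bilinear_radd[OF g] bilinear_lmul[OF g] bilinear_rmul[OF g] bilinear_lsub[OF g]
  define K where "K u v w z = G x (?R u v w) z - c * (G x v w * G x u z - G x u w * G x v z)" for u v w z
  have R12: "?R u v w = - ?R v u w" for u v w by (simp add: coord_curvature_def)
  have l1: "linear (\<lambda>u. K u v w z)" for v w z
    by (rule linearI)
       (simp_all add: K_def gs coord_curvature_add[OF G S x \<Gamma>] coord_curvature_scale[OF G S x \<Gamma>] algebra_simps)
  have l3: "linear (\<lambda>w. K u v w z)" for u v z
    by (rule linearI)
       (simp_all add: K_def gs coord_curvature_add[OF G S x \<Gamma>] coord_curvature_scale[OF G S x \<Gamma>] algebra_simps)
  have l4: "linear (\<lambda>z. K u v w z)" for u v w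
    by (rule linearI) (simp_all add: K_def gs algebra_simps)
  have skew12: "K u v w z = - K v u w z" for u v w z
    unfolding K_def by (subst R12) (simp add: bilinear_lneg[OF g] algebra_simps)
  have skew34: "K u v w z = - K u v z w" for u v w z
    unfolding K_def by (subst coord_curvature_skew[OF G S x \<Gamma>]) (simp add: algebra_simps)
  have bianchi: "K u v w z + K v w u z + K w u v z = 0" for u v w z
  proof -
    have "G x (?R u v w + ?R v w u + ?R w u v) z = 0"
      by (simp only: coord_curvature_bianchi[OF G S x \<Gamma>] bilinear_lzero[OF g])
    then show ?thesis by (simp add: K_def gs sym[of w] sym[of v u] algebra_simps)
  qed
  have l2: "linear (\<lambda>v. K u v w z)" for u w z
  proof -
    have "(\<lambda>v. K u v w z) = (\<lambda>v. - K v u w z)" by (rule ext) (rule skew12)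
    then show ?thesis using linear_compose_neg[OF l1] by simp
  qed
  have sec: "K u v v u = 0" if "G x u u * G x v v - (G x u v)\<^sup>2 \<noteq> 0" for u v
  proof -
    have "G x (?R u v v) u / (G x u u * G x v v - (G x u v)\<^sup>2) = c"
      using c x that unfolding constant_curvature_on_def sectional_curvature_def
        curvature_constant_fields[OF G S x \<Gamma>, symmetric] by blast
    then show ?thesis using that by (simp add: K_def field_simps sym[of v u] power2_eq_square)
  qed
  have sec': "K u v v u = 0" for u v
    by (rule sectional_zero_on_all_planes[OF g sym metric_on_nondegenerate[OF G x] l1 l2 l3 l4 skew12 sec])
  have "K u v w z = 0"
    by (rule curvature_like_tensor_zero[OF linear_add[OF l1] linear_add[OF l3] skew12 skew34 bianchi sec'])
  then show "G x (?R u v w) z = G x (c *\<^sub>R (G x v w *\<^sub>R u - G x u w *\<^sub>R v)) z"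
    by (simp add: K_def gs)
qed

section \<open>Warped products over an interval\<close>

lemma smooth_on_real_deriv:
  fixes a :: "real \<Rightarrow> real"
  assumes "smooth_on a I" "open I"
  shows "smooth_on (deriv a) I"
    and "t \<in> I \<Longrightarrow> (a has_real_derivative deriv a t) (at t)"
proof -
  have d: "(a has_real_derivative deriv a t) (at t)" if "t \<in> I" for t
    using smooth_on_differentiable[OF assms(1) that] DERIV_deriv_iff_real_differentiable by blast
  then show "t \<in> I \<Longrightarrow> (a has_real_derivative deriv a t) (at t)" .
  have "fd a t 1 = deriv a t" if "t \<in> I" for t
    using fd_eqI[OF d[OF that, unfolded has_field_derivative_def]] by simp
  then show "smooth_on (deriv a) I"
    by (intro smooth_on_cong[OF assms(2) smooth_on_fd[OF assms(1), of 1]])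
qed

lemma smooth_on_fst: "open S \<Longrightarrow> smooth_on fst S" and smooth_on_snd: "open S \<Longrightarrow> smooth_on snd S"
  using smooth_on_bounded_linear[OF bounded_linear_fst _ smooth_on_id]
    smooth_on_bounded_linear[OF bounded_linear_snd _ smooth_on_id] by auto

locale warped_product =
  fixes G :: "'a::euclidean_space \<Rightarrow> 'a \<Rightarrow> 'a \<Rightarrow> real" and S :: "'a set"
    and a :: "real \<Rightarrow> real" and I :: "real set" and \<epsilon> :: real
  assumes G: "metric_on G S" and S: "open S"
    and christoffel_smooth: "\<And>u v. smooth_on (\<lambda>x. christoffel G x u v) S"
    and a: "smooth_on a I" and I: "open I" and a_pos: "\<And>t. t \<in> I \<Longrightarrow> 0 < a t"
    and eps: "\<epsilon> \<in> {-1, 1}"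
begin

abbreviation "W \<equiv> warped_metric \<epsilon> a G"

lemma open_domain: "open (I \<times> S)"
  using I S by (rule open_Times)

lemma eps_sq: "\<epsilon> * \<epsilon> = 1"
  using eps by auto

lemma smooth_on_warp: "smooth_on f I \<Longrightarrow> smooth_on (\<lambda>z. f (fst z)) (I \<times> S)"
  by (rule smooth_on_compose[OF open_domain smooth_on_fst[OF open_domain]]) auto

lemma smooth_on_base:
  fixes f :: "'a \<Rightarrow> 'b::real_normed_vector"
  shows "smooth_on f S \<Longrightarrow> smooth_on (\<lambda>z. f (snd z)) (I \<times> S)"
  by (rule smooth_on_compose[OF open_domain smooth_on_snd[OF open_domain]]) auto

lemma warped_metric_on: "metric_on W (I \<times> S)"
  unfolding metric_on_def
proof (intro conjI ballI allI impI)
  fix z assume z: "z \<in> I \<times> S"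
  then have s: "snd z \<in> S" by auto
  note g = metric_on_bilinear[OF G s]
  show "bilinear (W z)"
    unfolding bilinear_def warped_metric_def
    by (intro conjI allI linearI)
       (simp_all add: bilinear_ladd[OF g] bilinear_radd[OF g] bilinear_lmul[OF g] bilinear_rmul[OF g] algebra_simps)
  show "W z u v = W z v u" for u v
    unfolding warped_metric_def by (simp add: metric_on_sym[OF G s, of "snd u"])
  show "u = 0" if u: "\<forall>v. W z u v = 0" for u
  proof (rule prod_eqI)
    show "fst u = fst 0"
      using u[rule_format, of "(1, 0)"] eps by (auto simp: warped_metric_def bilinear_rzero[OF g])
    have "a (fst z) \<noteq> 0" using z a_pos by force
    then have "G (snd z) (snd u) w = 0" for w
      using u[rule_format, of "(0, w)"] by (simp add: warped_metric_def)
    then show "snd u = snd 0"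
      using metric_on_nondegenerate[OF G s] by simp
  qed
next
  show "smooth_on (\<lambda>z. W z u v) (I \<times> S)" for u v
    unfolding warped_metric_def power2_eq_square
    by (intro smooth_on_add smooth_on_mult smooth_on_const open_domain smooth_on_warp a
        smooth_on_base metric_on_smooth[OF G])
qed

lemma has_derivative_warp:
  assumes "smooth_on f I" "z \<in> I \<times> S"
  shows "((\<lambda>z. f (fst z)) has_derivative (\<lambda>u. deriv f (fst z) * fst u)) (at z)"
proof -
  have "(f has_derivative (*) (deriv f (fst z))) (at (fst z))"
    using smooth_on_real_deriv(2)[OF assms(1) I, of "fst z"] assms(2)
    unfolding has_field_derivative_def by auto
  from has_derivative_compose[OF has_derivative_fst[OF has_derivative_ident] this] show ?thesis .
qed

lemma has_derivative_base:
  fixes f :: "'a \<Rightarrow> 'b::real_normed_vector"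
  assumes "smooth_on f S" "z \<in> I \<times> S"
  shows "((\<lambda>z. f (snd z)) has_derivative (\<lambda>u. fd f (snd z) (snd u))) (at z)"
proof -
  have "(f has_derivative fd f (snd z)) (at (snd z))"
    using smooth_on_has_derivative[OF assms(1), of "snd z"] assms(2) by auto
  from has_derivative_compose[OF has_derivative_snd[OF has_derivative_ident] this] show ?thesis .
qed

lemma warped_christoffel:
  assumes z: "z \<in> I \<times> S"
  shows "christoffel W z u v =
    (- \<epsilon> * (a (fst z) * deriv a (fst z)) * G (snd z) (snd u) (snd v),
     (deriv a (fst z) / a (fst z)) *\<^sub>R (fst u *\<^sub>R snd v + fst v *\<^sub>R snd u) + christoffel G (snd z) (snd u) (snd v))"
proof (rule christoffel_unique[OF warped_metric_on open_domain z])
  have s: "snd z \<in> S" and az: "a (fst z) \<noteq> 0" using z a_pos by force+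
  note g = metric_on_bilinear[OF G s] and sym = metric_on_sym[OF G s]
  fix u v w
  show "(- \<epsilon> * (a (fst z) * deriv a (fst z)) * G (snd z) (snd u) (snd v),
     (deriv a (fst z) / a (fst z)) *\<^sub>R (fst u *\<^sub>R snd v + fst v *\<^sub>R snd u) + christoffel G (snd z) (snd u) (snd v))
    = (- \<epsilon> * (a (fst z) * deriv a (fst z)) * G (snd z) (snd v) (snd u),
     (deriv a (fst z) / a (fst z)) *\<^sub>R (fst v *\<^sub>R snd u + fst u *\<^sub>R snd v) + christoffel G (snd z) (snd v) (snd u))"
    by (simp add: sym[of "snd u"] christoffel_sym[OF G S s, of "snd u"] add.commute)
  have "fd (\<lambda>y. W y v w) z u =
     2 * a (fst z) * deriv a (fst z) * fst u * G (snd z) (snd v) (snd w)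
      + (a (fst z))\<^sup>2 * fd (\<lambda>y. G y (snd v) (snd w)) (snd z) (snd u)"
  proof -
    have "((\<lambda>y. W y v w) has_derivative (\<lambda>u. 0 + (a (fst z) * a (fst z) * fd (\<lambda>y. G y (snd v) (snd w)) (snd z) (snd u)
       + (a (fst z) * (deriv a (fst z) * fst u) + deriv a (fst z) * fst u * a (fst z)) * G (snd z) (snd v) (snd w)))) (at z)"
      unfolding warped_metric_def power2_eq_square
      by (intro has_derivative_add has_derivative_mult has_derivative_const has_derivative_warp[OF a z]
          has_derivative_base[OF metric_on_smooth[OF G] z])
    from fd_eqI[OF this] show ?thesis by (simp add: algebra_simps power2_eq_square)
  qed
  also have "\<dots> = W z (- \<epsilon> * (a (fst z) * deriv a (fst z)) * G (snd z) (snd u) (snd v),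
     (deriv a (fst z) / a (fst z)) *\<^sub>R (fst u *\<^sub>R snd v + fst v *\<^sub>R snd u) + christoffel G (snd z) (snd u) (snd v)) w
   + W z v (- \<epsilon> * (a (fst z) * deriv a (fst z)) * G (snd z) (snd u) (snd w),
     (deriv a (fst z) / a (fst z)) *\<^sub>R (fst u *\<^sub>R snd w + fst w *\<^sub>R snd u) + christoffel G (snd z) (snd u) (snd w))"
  proof -
    define l where "l = deriv a (fst z) / a (fst z)"
    have l: "deriv a (fst z) = a (fst z) * l" using az by (simp add: l_def)
    consider "\<epsilon> = 1" | "\<epsilon> = -1" using eps by auto
    then show ?thesis
      unfolding christoffel_compat[OF G S s] l
      by cases (use az in \<open>simp_all add: warped_metric_def bilinear_ladd[OF g] bilinear_radd[OF g] bilinear_lmul[OF g]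
        bilinear_rmul[OF g] sym[of "snd v" "snd u"] power2_eq_square algebra_simps\<close>)
  qed
  finally show "fd (\<lambda>y. W y v w) z u = \<dots>" .
qed

lemma smooth_on_warped_christoffel: "smooth_on (\<lambda>z. christoffel W z u v) (I \<times> S)"
proof (rule smooth_on_cong[OF open_domain])
  show "smooth_on (\<lambda>z. (- \<epsilon> * (a (fst z) * deriv a (fst z)) * G (snd z) (snd u) (snd v),
     (deriv a (fst z) / a (fst z)) *\<^sub>R (fst u *\<^sub>R snd v + fst v *\<^sub>R snd u) + christoffel G (snd z) (snd u) (snd v))) (I \<times> S)"
    by (intro smooth_on_Pair smooth_on_add smooth_on_mult smooth_on_scaleR smooth_on_divide smooth_on_const open_domain
        smooth_on_warp a smooth_on_real_deriv[OF a I] smooth_on_base metric_on_smooth[OF G] christoffel_smooth)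
       (use a_pos in force)
qed (simp add: warped_christoffel)

text \<open>
  The field \<open>\<partial>\<^sub>t\<close> becomes conformal after multiplication by \<open>a\<close>: \<open>\<nabla>\<^sub>u (a \<partial>\<^sub>t) = a' u\<close>.
\<close>

lemma warped_christoffel_dt:
  assumes z: "z \<in> I \<times> S"
  shows "christoffel W z u (1, 0) = (deriv a (fst z) / a (fst z)) *\<^sub>R (u - (\<epsilon> * W z u (1, 0)) *\<^sub>R (1, 0))"
proof -
  have s: "snd z \<in> S" using z by auto
  note g = metric_on_bilinear[OF G s]
  show ?thesis
    unfolding warped_christoffel[OF z]
    by (simp add: warped_metric_def bilinear_rzero[OF g] bilinear_rzero[OF christoffel_bilinear[OF G S s]]
        mult.assoc[symmetric] eps_sq prod_eq_iff)
qed

text \<open>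
  Antisymmetrising in \<open>u\<close> and \<open>v\<close> removes the derivatives of \<open>G\<close>, which is compatible with its own
  Christoffel symbols. What remains of the warping function is \<open>(a a')' - a'\<^sup>2 = a a''\<close> in the direction of \<open>I\<close>, and
  \<open>(a'/a)' + (a'/a)\<^sup>2 = a''/a\<close> in the fibre directions.
\<close>

lemma warped_coord_curvature:
  assumes z: "z \<in> I \<times> S"
  shows "coord_curvature (christoffel W) z u v w =
     (- \<epsilon> * a (fst z) * deriv (deriv a) (fst z)
        * (fst u * G (snd z) (snd v) (snd w) - fst v * G (snd z) (snd u) (snd w)),
      (deriv (deriv a) (fst z) / a (fst z) * fst w) *\<^sub>R (fst u *\<^sub>R snd v - fst v *\<^sub>R snd u)
       + coord_curvature (christoffel G) (snd z) (snd u) (snd v) (snd w)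
       - (\<epsilon> * (deriv a (fst z))\<^sup>2) *\<^sub>R (G (snd z) (snd v) (snd w) *\<^sub>R snd u - G (snd z) (snd u) (snd w) *\<^sub>R snd v))"
proof -
  have s: "snd z \<in> S" and az: "a (fst z) \<noteq> 0" using z a_pos by force+
  note g = metric_on_bilinear[OF G s] and sym = metric_on_sym[OF G s]
  note gam = christoffel_bilinear[OF G S s] and gsym = christoffel_sym[OF G S s]
  let ?a = "a (fst z)" and ?a1 = "deriv a (fst z)" and ?a2 = "deriv (deriv a) (fst z)"
  note a1 = smooth_on_real_deriv(1)[OF a I]
  have D: "fd (\<lambda>z. christoffel W z v w) z u =
     (- \<epsilon> * ((?a1 * ?a1 + ?a * ?a2) * fst u * G (snd z) (snd v) (snd w)
          + ?a * ?a1 * fd (\<lambda>y. G y (snd v) (snd w)) (snd z) (snd u)),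
      ((?a2 / ?a - ?a1 * ?a1 / (?a * ?a)) * fst u) *\<^sub>R (fst v *\<^sub>R snd w + fst w *\<^sub>R snd v)
       + fd (\<lambda>y. christoffel G y (snd v) (snd w)) (snd z) (snd u))" for u v w
  proof -
    have "((\<lambda>z. christoffel W z v w) has_derivative
      (\<lambda>u. ((- \<epsilon> * (?a * ?a1)) * fd (\<lambda>y. G y (snd v) (snd w)) (snd z) (snd u)
              + - \<epsilon> * (?a * (?a2 * fst u) + ?a1 * fst u * ?a1) * G (snd z) (snd v) (snd w),
            (?a1 * (- (inverse ?a * (?a1 * fst u) * inverse ?a)) + (?a2 * fst u) * inverse ?a) *\<^sub>R (fst v *\<^sub>R snd w + fst w *\<^sub>R snd v)
              + fd (\<lambda>y. christoffel G y (snd v) (snd w)) (snd z) (snd u)))) (at z)"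
    proof (rule has_derivative_transform_within_open[OF _ open_domain z])
      show "((\<lambda>z. (- \<epsilon> * (a (fst z) * deriv a (fst z)) * G (snd z) (snd v) (snd w),
         (deriv a (fst z) * inverse (a (fst z))) *\<^sub>R (fst v *\<^sub>R snd w + fst w *\<^sub>R snd v) + christoffel G (snd z) (snd v) (snd w)))
         has_derivative (\<lambda>u. ((- \<epsilon> * (?a * ?a1)) * fd (\<lambda>y. G y (snd v) (snd w)) (snd z) (snd u)
              + - \<epsilon> * (?a * (?a2 * fst u) + ?a1 * fst u * ?a1) * G (snd z) (snd v) (snd w),
            (?a1 * (- (inverse ?a * (?a1 * fst u) * inverse ?a)) + (?a2 * fst u) * inverse ?a) *\<^sub>R (fst v *\<^sub>R snd w + fst w *\<^sub>R snd v)
              + fd (\<lambda>y. christoffel G y (snd v) (snd w)) (snd z) (snd u)))) (at z)"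
        by (intro has_derivative_Pair has_derivative_add has_derivative_mult has_derivative_mult_right has_derivative_scaleR_left
            Deriv.has_derivative_inverse az has_derivative_warp[OF a z] has_derivative_warp[OF a1 z]
            has_derivative_base[OF metric_on_smooth[OF G] z] has_derivative_base[OF christoffel_smooth z])
    qed (simp add: warped_christoffel divide_inverse)
    from fd_eqI[OF this] show ?thesis using az by (simp add: field_simps)
  qed
  define l where "l = ?a1 / ?a"
  define p where "p = ?a2 / ?a"
  have a1_eq: "?a1 = ?a * l" using az by (simp add: l_def)
  have quot: "?a2 / ?a - ?a1 * ?a1 / (?a * ?a) = p - l * l" "?a1 / ?a = l" "?a2 / ?a = p"
    by (simp_all add: l_def p_def)
  show ?thesis
  proof (rule prod_eqI)
    have "fd (\<lambda>y. G y (snd v) (snd w)) (snd z) (snd u) - fd (\<lambda>y. G y (snd u) (snd w)) (snd z) (snd v)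
      = G (snd z) (snd v) (christoffel G (snd z) (snd u) (snd w)) - G (snd z) (snd u) (christoffel G (snd z) (snd v) (snd w))"
      unfolding christoffel_compat[OF G S s] by (simp add: gsym[of "snd v" "snd u"])
    then have dg: "fd (\<lambda>y. G y (snd v) (snd w)) (snd z) (snd u) = fd (\<lambda>y. G y (snd u) (snd w)) (snd z) (snd v)
      + G (snd z) (snd v) (christoffel G (snd z) (snd u) (snd w)) - G (snd z) (snd u) (christoffel G (snd z) (snd v) (snd w))"
      by simp
    show "fst (coord_curvature (christoffel W) z u v w) = fst (- \<epsilon> * ?a * ?a2
        * (fst u * G (snd z) (snd v) (snd w) - fst v * G (snd z) (snd u) (snd w)),
      (?a2 / ?a * fst w) *\<^sub>R (fst u *\<^sub>R snd v - fst v *\<^sub>R snd u)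
       + coord_curvature (christoffel G) (snd z) (snd u) (snd v) (snd w)
       - (\<epsilon> * ?a1\<^sup>2) *\<^sub>R (G (snd z) (snd v) (snd w) *\<^sub>R snd u - G (snd z) (snd u) (snd w) *\<^sub>R snd v))"
      unfolding coord_curvature_def D warped_christoffel[OF z] using az
      by (simp add: dg bilinear_radd[OF g] bilinear_rmul[OF g] sym[of "snd v" "snd u"] field_simps)
    show "snd (coord_curvature (christoffel W) z u v w) = snd (- \<epsilon> * ?a * ?a2
        * (fst u * G (snd z) (snd v) (snd w) - fst v * G (snd z) (snd u) (snd w)),
      (?a2 / ?a * fst w) *\<^sub>R (fst u *\<^sub>R snd v - fst v *\<^sub>R snd u)
       + coord_curvature (christoffel G) (snd z) (snd u) (snd v) (snd w)
       - (\<epsilon> * ?a1\<^sup>2) *\<^sub>R (G (snd z) (snd v) (snd w) *\<^sub>R snd u - G (snd z) (snd u) (snd w) *\<^sub>R snd v))"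
      unfolding coord_curvature_def D warped_christoffel[OF z] quot unfolding a1_eq using az
      by (simp add: bilinear_radd[OF gam] bilinear_rmul[OF gam] gsym[of "snd v" "snd u"] power2_eq_square
          algebra_simps)
  qed
qed

text \<open>
  The constants are chosen such that \<open>c = \<epsilon> a'\<^sup>2 - b a\<^sup>2\<close> and \<open>a'' = a (r + \<epsilon> b)\<close>: planes tangent to the
  fibre have curvature \<open>-b\<close>, planes containing \<open>\<partial>\<^sub>t\<close> have curvature \<open>-b - \<epsilon> r\<close>.
\<close>

lemma warped_constant_curvature:
  assumes z: "z \<in> I \<times> S"
    and c: "\<And>u v w. coord_curvature (christoffel G) (snd z) u v w = c *\<^sub>R (G (snd z) v w *\<^sub>R u - G (snd z) u w *\<^sub>R v)"
    and b: "b = (\<epsilon> * (deriv a (fst z))\<^sup>2 - c) / (a (fst z))\<^sup>2"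
    and r: "r = deriv (deriv a) (fst z) / a (fst z) - \<epsilon> * b"
  shows "W z (coord_curvature (christoffel W) z u v w) y =
     - b * (W z v w * W z u y - W z u w * W z v y)
     - r * (W z v w * W z u (1, 0) * W z y (1, 0) - W z u w * W z v (1, 0) * W z y (1, 0)
          + W z v (1, 0) * W z w (1, 0) * W z u y - W z u (1, 0) * W z w (1, 0) * W z v y)"
proof -
  have s: "snd z \<in> S" and az: "a (fst z) \<noteq> 0" using z a_pos by force+
  note g = metric_on_bilinear[OF G s]
  have c': "c = \<epsilon> * (deriv a (fst z))\<^sup>2 - b * (a (fst z))\<^sup>2"
    using az by (simp add: b field_simps)
  have a2: "deriv (deriv a) (fst z) = a (fst z) * (r + \<epsilon> * b)"
    using az by (simp add: r field_simps)
  have q: "deriv (deriv a) (fst z) / a (fst z) = r + \<epsilon> * b"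
    by (simp add: r)
  consider "\<epsilon> = 1" | "\<epsilon> = -1" using eps by auto
  then show ?thesis
    unfolding warped_coord_curvature[OF z] c q unfolding a2 c' warped_metric_def
    by cases (use az in \<open>simp_all add: bilinear_rzero[OF g] bilinear_ladd[OF g] bilinear_lsub[OF g] bilinear_lmul[OF g]
        power2_eq_square algebra_simps\<close>)
qed

end

section \<open>The pulled-back connection along an immersion\<close>

lemma fd_scaleR_bilinear:
  assumes "f differentiable (at x)"
  shows "bilinear (\<lambda>u (c::real). c *\<^sub>R fd f x u)"
  using linear_frechet_derivative[OF assms]
  unfolding bilinear_def
  by (auto intro!: linearI simp: linear_add linear_scale algebra_simps)

lemma has_derivative_fd_field:
  fixes f :: "'a::euclidean_space \<Rightarrow> 'b::real_normed_vector"
  assumes f: "smooth_on f S" and S: "open S" "x \<in> S" and p: "(p has_derivative p') (at x)"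
  shows "((\<lambda>y. fd f y (p y)) has_derivative (\<lambda>h. fd (\<lambda>y. fd f y (p x)) x h + fd f x (p' h))) (at x)"
proof -
  have "((\<lambda>y. 1 *\<^sub>R fd f y (p y)) has_derivative
     (\<lambda>h. fd (\<lambda>y. 1 *\<^sub>R fd f y (p x)) x h + 1 *\<^sub>R fd f x (p' h) + 0 *\<^sub>R fd f x (p x))) (at x)"
    by (rule has_derivative_bilinear_family[OF S S(1), where B = "\<lambda>y u (c::real). c *\<^sub>R fd f y u"
          and F = "\<lambda>y. y" and F' = "\<lambda>h. h" and q = "\<lambda>_. 1" and q' = "\<lambda>_. 0"])
       (auto intro!: fd_scaleR_bilinear smooth_on_differentiable[OF f]
          smooth_on_differentiable[OF _ S(2)] smooth_on_scaleR smooth_on_const smooth_on_fd f S p)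
  then show ?thesis by simp
qed

lemma smooth_on_fd_field:
  fixes f :: "'a::euclidean_space \<Rightarrow> 'b::real_normed_vector"
  assumes S: "open S" and f: "smooth_on f S" and p: "smooth_on p S"
  shows "smooth_on (\<lambda>y. fd f y (p y)) S"
proof -
  have "smooth_on (\<lambda>y. 1 *\<^sub>R fd f y (p y)) S"
    by (rule smooth_on_bilinear_family[OF S, where B = "\<lambda>y u (c::real). c *\<^sub>R fd f y u"
          and F = "\<lambda>y. y" and q = "\<lambda>_. 1" and T = S])
       (auto intro!: fd_scaleR_bilinear smooth_on_differentiable[OF f]
          smooth_on_id smooth_on_scaleR smooth_on_const smooth_on_fd f S p)
  then show ?thesis by simp
qed

text \<open>
  An immersion \<open>F\<close> of an open set \<open>S\<close> into the domain \<open>V\<close> of the metric \<open>G\<close>. Vector fields along \<open>F\<close> are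
  differentiated with the pulled-back Levi-Civita connection \<open>DD\<close>.
\<close>

locale spacelike_chart =
  fixes G :: "'b::euclidean_space \<Rightarrow> 'b \<Rightarrow> 'b \<Rightarrow> real" and V :: "'b set"
    and F :: "'a::euclidean_space \<Rightarrow> 'b" and S :: "'a set"
  assumes G: "metric_on G V" and V: "open V"
    and christoffel_smooth: "\<And>u v. smooth_on (\<lambda>z. christoffel G z u v) V"
    and F: "smooth_on F S" and S: "open S" and FS: "F ` S \<subseteq> V"
    and spacelike: "\<And>y u. y \<in> S \<Longrightarrow> u \<noteq> 0 \<Longrightarrow> 0 < induced_metric G F y u u"
begin

abbreviation "gM \<equiv> induced_metric G F"
abbreviation "DD \<equiv> ambient_deriv G F"

lemma FV: "y \<in> S \<Longrightarrow> F y \<in> V"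
  using FS by auto

lemma fd_F_linear: "y \<in> S \<Longrightarrow> linear (fd F y)"
  by (rule linear_frechet_derivative[OF smooth_on_differentiable[OF F]])

lemma G_bilinear: "y \<in> S \<Longrightarrow> bilinear (G (F y))"
  by (rule metric_on_bilinear[OF G FV])

lemma G_sym: "y \<in> S \<Longrightarrow> G (F y) u v = G (F y) v u"
  by (rule metric_on_sym[OF G FV])

lemma smooth_on_G:
  assumes "smooth_on p S" "smooth_on q S"
  shows "smooth_on (\<lambda>y. G (F y) (p y) (q y)) S"
  by (rule smooth_on_bilinear_family[OF S FS metric_on_bilinear[OF G] metric_on_smooth[OF G] F assms])

lemma smooth_on_tangent_field: "smooth_on Y S \<Longrightarrow> smooth_on (\<lambda>y. fd F y (Y y)) S"
  by (rule smooth_on_fd_field[OF S F])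

lemma smooth_on_DD:
  assumes "smooth_on X S" "smooth_on W S"
  shows "smooth_on (DD X W) S"
proof -
  have "smooth_on (\<lambda>y. fd W y (X y) + christoffel G (F y) (fd F y (X y)) (W y)) S"
    by (intro smooth_on_add S smooth_on_fd_field assms smooth_on_bilinear_family[OF S FS, where B = "christoffel G"]
        christoffel_bilinear[OF G V] christoffel_smooth F)
  then show ?thesis by (rule smooth_on_cong[OF S]) (simp add: ambient_deriv_def)
qed

lemma DD_at_cong: "X y = X' y \<Longrightarrow> DD X W y = DD X' W y"
  by (simp add: ambient_deriv_def)

lemma DD_direction_linear:
  assumes "y \<in> S" "W differentiable (at y)"
  shows "linear (\<lambda>u. DD (\<lambda>_. u) W y)"
proof -
  note g = christoffel_bilinear[OF G V FV[OF assms(1)]]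
  show ?thesis
    by (rule linearI)
       (simp_all add: ambient_deriv_def linear_add[OF linear_frechet_derivative[OF assms(2)]]
          linear_scale[OF linear_frechet_derivative[OF assms(2)]] linear_add[OF fd_F_linear[OF assms(1)]]
          linear_scale[OF fd_F_linear[OF assms(1)]] bilinear_ladd[OF g] bilinear_lmul[OF g] algebra_simps)
qed

lemma DD_compat:
  assumes y: "y \<in> S" and W: "W differentiable (at y)" and Z: "Z differentiable (at y)"
  shows "fd (\<lambda>y. G (F y) (W y) (Z y)) y (X y) = G (F y) (DD X W y) (Z y) + G (F y) (W y) (DD X Z y)"
proof -
  note g = G_bilinear[OF y]
  have "((\<lambda>y. G (F y) (W y) (Z y)) has_derivative
    (\<lambda>h. fd (\<lambda>z. G z (W y) (Z y)) (F y) (fd F y h) + G (F y) (fd W y h) (Z y) + G (F y) (W y) (fd Z y h))) (at y)"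
    by (rule has_derivative_bilinear_family[OF S y V FS metric_on_bilinear[OF G]])
       (use smooth_on_differentiable[OF metric_on_smooth[OF G] FV[OF y]] smooth_on_has_derivative[OF F y]
          W Z frechet_derivative_works in auto)
  from fd_eqI[OF this] show ?thesis
    by (simp add: christoffel_compat[OF G V FV[OF y]] ambient_deriv_def bilinear_ladd[OF g] bilinear_radd[OF g])
qed

lemma DD_tangent_field:
  assumes y: "y \<in> S" and Y: "Y differentiable (at y)"
  shows "DD X (\<lambda>y. fd F y (Y y)) y =
    fd F y (fd Y y (X y)) + (fd (\<lambda>z. fd F z (Y y)) y (X y) + christoffel G (F y) (fd F y (X y)) (fd F y (Y y)))"
  using fd_eqI[OF has_derivative_fd_field[OF F S y, of Y "fd Y y"]] Y
  by (simp add: ambient_deriv_def frechet_derivative_works[symmetric])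

lemma DD_torsion_free:
  assumes y: "y \<in> S" and X: "X differentiable (at y)" and Y: "Y differentiable (at y)"
  shows "DD X (\<lambda>y. fd F y (Y y)) y - DD Y (\<lambda>y. fd F y (X y)) y = fd F y (lie_bracket X Y y)"
  unfolding DD_tangent_field[OF y X] DD_tangent_field[OF y Y]
  using fd_commute[OF F S y, of "X y" "Y y"] christoffel_sym[OF G V FV[OF y], of "fd F y (X y)" "fd F y (Y y)"]
  by (simp add: lie_bracket_def linear_diff[OF fd_F_linear[OF y]])

text \<open>
  All terms with second derivatives of \<open>W\<close> and \<open>F\<close> cancel, because these are symmetric; the derivatives of \<open>X\<close> and
  \<open>Y\<close> are absorbed by the bracket.
\<close>

lemma DD_curvature:
  assumes y: "y \<in> S" and X: "smooth_on X S" and Y: "smooth_on Y S" and W: "smooth_on W S"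
  shows "DD X (DD Y W) y - DD Y (DD X W) y - DD (lie_bracket X Y) W y =
     coord_curvature (christoffel G) (F y) (fd F y (X y)) (fd F y (Y y)) (W y)"
proof -
  note g = christoffel_bilinear[OF G V FV[OF y]]
  have D: "fd (DD Y W) y h = fd (\<lambda>z. fd W z (Y y)) y h + fd W y (fd Y y h)
     + (fd (\<lambda>z. christoffel G z (fd F y (Y y)) (W y)) (F y) (fd F y h)
        + christoffel G (F y) (fd (\<lambda>z. fd F z (Y y)) y h + fd F y (fd Y y h)) (W y)
        + christoffel G (F y) (fd F y (Y y)) (fd W y h))" if Y: "smooth_on Y S" for Y h
  proof -
    have "((\<lambda>y. fd W y (Y y) + christoffel G (F y) (fd F y (Y y)) (W y)) has_derivative
      (\<lambda>h. fd (\<lambda>z. fd W z (Y y)) y h + fd W y (fd Y y h)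
     + (fd (\<lambda>z. christoffel G z (fd F y (Y y)) (W y)) (F y) (fd F y h)
        + christoffel G (F y) (fd (\<lambda>z. fd F z (Y y)) y h + fd F y (fd Y y h)) (W y)
        + christoffel G (F y) (fd F y (Y y)) (fd W y h)))) (at y)"
      by (intro has_derivative_add has_derivative_fd_field[OF _ S y]
          has_derivative_bilinear_family[OF S y V FS christoffel_bilinear[OF G V]]
          smooth_on_differentiable[OF christoffel_smooth FV[OF y]] smooth_on_has_derivative[OF _ y] F W Y) auto
    from fd_eqI[OF this] show ?thesis
      unfolding ambient_deriv_def by simp
  qed
  have l: "linear (fd W y)" by (rule linear_frechet_derivative[OF smooth_on_differentiable[OF W y]])
  note lF = fd_F_linear[OF y]
  have 1: "DD X (DD Y W) y = fd (DD Y W) y (X y) + christoffel G (F y) (fd F y (X y)) (DD Y W y)" for X Y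
    by (simp add: ambient_deriv_def)
  show ?thesis
    unfolding 1 D[OF X] D[OF Y] coord_curvature_def
    using fd_commute[OF F S y, of "X y" "Y y"] fd_commute[OF W S y, of "X y" "Y y"]
    by (simp add: ambient_deriv_def lie_bracket_def linear_diff[OF l] linear_diff[OF lF]
        bilinear_ladd[OF g] bilinear_radd[OF g] bilinear_lsub[OF g])
qed

lemma gM_metric_on: "metric_on gM S"
  unfolding metric_on_def
proof (intro conjI ballI allI impI)
  fix y assume y: "y \<in> S"
  note g = G_bilinear[OF y] and l = fd_F_linear[OF y]
  show "bilinear (gM y)"
    unfolding bilinear_def induced_metric_def
    by (intro conjI allI linearI)
       (simp_all add: linear_add[OF l] linear_scale[OF l] bilinear_ladd[OF g] bilinear_radd[OF g] bilinear_lmul[OF g] bilinear_rmul[OF g])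
  show "gM y u v = gM y v u" for u v
    unfolding induced_metric_def by (rule G_sym[OF y])
  show "u = 0" if "\<forall>v. gM y u v = 0" for u
    using spacelike[OF y, of u] that by force
next
  show "smooth_on (\<lambda>y. gM y u v) S" for u v
    unfolding induced_metric_def by (intro smooth_on_G smooth_on_fd F)
qed

lemma gM_tangent_part:
  assumes y: "y \<in> S"
  shows "gM y (tangent_part G F y w) v = G (F y) w (fd F y v)"
  unfolding tangent_part_def
  by (rule metric_on_riesz[OF gM_metric_on y])
     (auto intro!: linearI simp: linear_add[OF fd_F_linear[OF y]] linear_scale[OF fd_F_linear[OF y]]
        bilinear_radd[OF G_bilinear[OF y]] bilinear_rmul[OF G_bilinear[OF y]])

lemma normal_part_orthogonal:
  assumes y: "y \<in> S"
  shows "G (F y) (normal_part G F y w) (fd F y v) = 0"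
  using gM_tangent_part[OF y, of w v]
  by (simp add: normal_part_def bilinear_lsub[OF G_bilinear[OF y]] induced_metric_def)

lemma G_normal_part:
  assumes y: "y \<in> S" and \<eta>: "\<And>v. G (F y) \<eta> (fd F y v) = 0"
  shows "G (F y) (normal_part G F y w) \<eta> = G (F y) w \<eta>"
  using \<eta> G_sym[OF y, of \<eta>] by (simp add: normal_part_def bilinear_lsub[OF G_bilinear[OF y]])

text \<open>
  The tangential part of the pulled-back connection is torsion free and metric, hence it is the
  Levi-Civita connection of the induced metric.
\<close>

lemma induced_christoffel:
  assumes y: "y \<in> S"
  shows "christoffel gM y u v = tangent_part G F y (DD (\<lambda>_. u) (\<lambda>y. fd F y v) y)"
proof (rule christoffel_unique[OF gM_metric_on S y])
  have d: "(\<lambda>y. fd F y v) differentiable (at y)" for v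
    by (rule smooth_on_differentiable[OF smooth_on_fd[OF F] y])
  fix u v w
  show "tangent_part G F y (DD (\<lambda>_. u) (\<lambda>y. fd F y v) y) = tangent_part G F y (DD (\<lambda>_. v) (\<lambda>y. fd F y u) y)"
    using DD_torsion_free[OF y, of "\<lambda>_. u" "\<lambda>_. v"]
    by (simp add: lie_bracket_def linear_0[OF fd_F_linear[OF y]])
  show "fd (\<lambda>y. gM y v w) y u = gM y (tangent_part G F y (DD (\<lambda>_. u) (\<lambda>y. fd F y v) y)) w
     + gM y v (tangent_part G F y (DD (\<lambda>_. u) (\<lambda>y. fd F y w) y))"
    unfolding metric_on_sym[OF gM_metric_on y, of v] gM_tangent_part[OF y]
    using DD_compat[OF y d d, of v w "\<lambda>_. u"] G_sym[OF y] by (simp add: induced_metric_def)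
qed

lemma gM_cov_deriv:
  assumes y: "y \<in> S" and Y: "Y differentiable (at y)"
  shows "gM y (cov_deriv gM X Y y) w = G (F y) (DD X (\<lambda>y. fd F y (Y y)) y) (fd F y w)"
proof -
  note g = G_bilinear[OF y]
  have "gM y (cov_deriv gM X Y y) w = gM y (fd Y y (X y)) w + G (F y) (DD (\<lambda>_. X y) (\<lambda>z. fd F z (Y y)) y) (fd F y w)"
    by (simp add: cov_deriv_def bilinear_ladd[OF metric_on_bilinear[OF gM_metric_on y]] induced_christoffel[OF y] gM_tangent_part[OF y])
  also have "\<dots> = G (F y) (DD X (\<lambda>y. fd F y (Y y)) y) (fd F y w)"
    unfolding DD_tangent_field[OF y Y] DD_tangent_field[OF y differentiable_const]
    by (simp add: induced_metric_def bilinear_ladd[OF g] linear_0[OF fd_F_linear[OF y]])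
  finally show ?thesis .
qed

end

section \<open>Structure equations of an adapted frame\<close>

lemma orthogonal_expansion:
  fixes B :: "'b::euclidean_space \<Rightarrow> 'b \<Rightarrow> real"
  assumes B: "bilinear B" and J: "finite J" "card J = DIM('b)"
    and orth: "\<And>i j. i \<in> J \<Longrightarrow> j \<in> J \<Longrightarrow> B (f i) (f j) = (if i = j then \<eta> i else 0)"
    and \<eta>: "\<And>i. i \<in> J \<Longrightarrow> \<eta> i \<noteq> 0"
  shows "w = (\<Sum>i\<in>J. (B w (f i) / \<eta> i) *\<^sub>R f i)"
proof -
  have l: "linear (\<lambda>u. B u v)" for v using B by (simp add: bilinear_def)
  have coeff: "B (\<Sum>i\<in>J. c i *\<^sub>R f i) (f j) = c j * \<eta> j" if "j \<in> J" for c j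
  proof -
    have "B (\<Sum>i\<in>J. c i *\<^sub>R f i) (f j) = (\<Sum>i\<in>J. c i * (if i = j then \<eta> i else 0))"
      by (simp add: linear_sum[OF l] linear_scale[OF l] orth that)
    also have "\<dots> = (\<Sum>i\<in>J. if i = j then c i * \<eta> i else 0)"
      by (intro sum.cong refl) simp
    finally show ?thesis using that J by simp
  qed
  have inj: "inj_on f J"
  proof (rule inj_onI, rule ccontr)
    fix i j assume ij: "i \<in> J" "j \<in> J" "f i = f j" "i \<noteq> j"
    then show False using orth[of i i] orth[of i j] \<eta>[of i] by simp
  qed
  have "independent (f ` J)"
  proof (rule independent_if_scalars_zero)
    fix c v assume z: "(\<Sum>v\<in>f ` J. c v *\<^sub>R v) = 0" and "v \<in> f ` J"
    then obtain j where j: "j \<in> J" "v = f j" by blast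
    have "(\<Sum>i\<in>J. c (f i) *\<^sub>R f i) = 0" using z by (simp add: sum.reindex[OF inj])
    then have "c (f j) * \<eta> j = 0" using coeff[OF j(1), of "\<lambda>i. c (f i)"] bilinear_lzero[OF B] by simp
    then show "c v = 0" using j \<eta> by simp
  qed (use J in simp)
  moreover have "card (f ` J) = DIM('b)" using J inj by (simp add: card_image)
  ultimately have "span (f ` J) = UNIV"
    by (metis card_ge_dim_independent dim_UNIV top_greatest order_refl top.extremum_uniqueI)
  then have "w \<in> span (f ` J)" by simp
  then obtain c where "w = (\<Sum>v\<in>f ` J. c v *\<^sub>R v)" using J by (auto simp: span_finite)
  then have w: "w = (\<Sum>i\<in>J. c (f i) *\<^sub>R f i)" by (simp add: sum.reindex[OF inj])
  have "c (f i) = B w (f i) / \<eta> i" if "i \<in> J" for i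
    using coeff[OF that, of "\<lambda>i. c (f i)", folded w] \<eta>[OF that] by simp
  then have "(\<Sum>i\<in>J. c (f i) *\<^sub>R f i) = (\<Sum>i\<in>J. (B w (f i) / \<eta> i) *\<^sub>R f i)"
    by (intro sum.cong refl) simp
  with w show ?thesis by (rule trans)
qed

text \<open>
  The vector \<open>P\<close> stands for \<open>\<partial>\<^sub>t\<close> and \<open>bb\<close>, \<open>rr\<close>, \<open>lam\<close> for \<open>b\<close>, \<open>r\<close> and \<open>a'/a\<close>. The last three
  assumptions collect what the computation uses of the warped product structure.
\<close>

locale adapted_chart = spacelike_chart G V F S
  for G :: "'b::euclidean_space \<Rightarrow> 'b \<Rightarrow> 'b \<Rightarrow> real" and V and F :: "real^'n \<Rightarrow> 'b" and S +
  fixes n m :: nat and e :: "nat \<Rightarrow> (real^'n) \<Rightarrow> (real^'n)" and \<nu> :: "nat \<Rightarrow> (real^'n) \<Rightarrow> 'b" and sg :: "nat \<Rightarrow> real" and x :: "real^'n"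
    and P :: 'b and bb rr lam :: "'b \<Rightarrow> real" and \<epsilon> :: real
  assumes dims: "CARD('n) = n" "DIM('b) = n + m + 1"
    and x: "x \<in> S"
    and e_smooth: "\<And>i. i \<in> {1..n} \<Longrightarrow> smooth_on (e i) S"
    and e_orth: "\<And>y i j. y \<in> S \<Longrightarrow> i \<in> {1..n} \<Longrightarrow> j \<in> {1..n} \<Longrightarrow> gM y (e i y) (e j y) = (if i = j then 1 else 0)"
    and e_parallel: "\<And>i v. i \<in> {1..n} \<Longrightarrow> cov_deriv gM (\<lambda>_. v) (e i) x = 0"
    and nu_smooth: "\<And>\<beta>. \<beta> \<in> {n+1..n+m+1} \<Longrightarrow> smooth_on (\<nu> \<beta>) S"
    and sg: "\<And>\<beta>. \<beta> \<in> {n+1..n+m+1} \<Longrightarrow> sg \<beta> \<in> {-1, 1}"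
    and nu_normal: "\<And>y \<beta> v. y \<in> S \<Longrightarrow> \<beta> \<in> {n+1..n+m+1} \<Longrightarrow> G (F y) (\<nu> \<beta> y) (fd F y v) = 0"
    and nu_orth: "\<And>y \<beta> \<gamma>. y \<in> S \<Longrightarrow> \<beta> \<in> {n+1..n+m+1} \<Longrightarrow> \<gamma> \<in> {n+1..n+m+1} \<Longrightarrow>
        G (F y) (\<nu> \<beta> y) (\<nu> \<gamma> y) = (if \<beta> = \<gamma> then sg \<beta> else 0)"
    and ambient_curvature: "\<And>z u v w y. z \<in> V \<Longrightarrow> G z (coord_curvature (christoffel G) z u v w) y =
     - bb z * (G z v w * G z u y - G z u w * G z v y)
     - rr z * (G z v w * G z u P * G z y P - G z u w * G z v P * G z y P
          + G z v P * G z w P * G z u y - G z u P * G z w P * G z v y)"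
    and ambient_dt: "\<And>z u. z \<in> V \<Longrightarrow> christoffel G z u P = lam z *\<^sub>R (u - (\<epsilon> * G z u P) *\<^sub>R P)"
    and rr_smooth: "smooth_on rr V"
begin

definition "tng = {1..n}"
definition "nor = {n+1..n+m+1}"
definition "ind = {1..n+m+1}"

text \<open>
  The frame \<open>\<Phi>\<close> consists of the images of the tangent fields and of the normal fields, \<open>\<eta>\<close> are its signs, \<open>\<theta>\<close> its
  connection forms. The functions \<open>\<tau>\<close> are the components of \<open>P\<close>: those of \<open>T\<close> for tangential and those of
  \<open>\<xi>\<close> for normal indices. For tangential \<open>i\<close>, \<open>j\<close> and normal \<open>\<beta>\<close>, \<open>\<theta> i j \<beta>\<close> is \<open>h\<^sup>\<beta>\<^sub>i\<^sub>j\<close>.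
\<close>

definition "\<Phi> A = (if A \<le> n then (\<lambda>y. fd F y (e A y)) else \<nu> A)"
definition "\<eta> A = (if A \<le> n then 1 else sg A)"
definition "\<theta> k A C y = G (F y) (DD (e k) (\<Phi> A) y) (\<Phi> C y)"
definition "\<tau> A y = G (F y) P (\<Phi> A y)"

abbreviation "d k \<phi> y \<equiv> fd \<phi> y (e k y)" for \<phi> :: "(real^'n) \<Rightarrow> real"

lemma finite_index_sets: "finite tng" "finite nor" "finite ind"
  by (auto simp: tng_def nor_def ind_def)

lemma tan_ind: "i \<in> tng \<Longrightarrow> i \<in> ind" and nor_ind: "\<beta> \<in> nor \<Longrightarrow> \<beta> \<in> ind"
  and tan_nor: "i \<in> tng \<Longrightarrow> i \<notin> nor"
  by (auto simp: tng_def nor_def ind_def)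

lemmas e_smooth' = e_smooth[folded tng_def] and e_orth' = e_orth[folded tng_def]
  and e_parallel' = e_parallel[folded tng_def] and nu_smooth' = nu_smooth[folded nor_def]
  and nu_normal' = nu_normal[folded nor_def] and nu_orth' = nu_orth[folded nor_def]
  and sg' = sg[folded nor_def]

lemma Phi_tan: "i \<in> tng \<Longrightarrow> \<Phi> i = (\<lambda>y. fd F y (e i y))"
  and Phi_nor: "\<beta> \<in> nor \<Longrightarrow> \<Phi> \<beta> = \<nu> \<beta>"
  and eta_tan: "i \<in> tng \<Longrightarrow> \<eta> i = 1" and eta_nor: "\<beta> \<in> nor \<Longrightarrow> \<eta> \<beta> = sg \<beta>"
  by (auto simp: \<Phi>_def \<eta>_def tng_def nor_def)

lemma ind_cases: "A \<in> ind \<Longrightarrow> (A \<in> tng \<Longrightarrow> thesis) \<Longrightarrow> (A \<in> nor \<Longrightarrow> thesis) \<Longrightarrow> thesis"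
  by (force simp: tng_def nor_def ind_def)

lemma eta_cases: "A \<in> ind \<Longrightarrow> \<eta> A = 1 \<or> \<eta> A = -1"
  using sg'[of A] by (erule_tac ind_cases) (auto simp: eta_tan eta_nor)

lemma eta_nz: "A \<in> ind \<Longrightarrow> \<eta> A \<noteq> 0"
  using eta_cases by force

lemma card_index_sets: "card tng = DIM(real^'n)" "card ind = DIM('b)"
  using dims by (simp_all add: tng_def ind_def)

lemma eta_sq: "A \<in> ind \<Longrightarrow> \<eta> A * \<eta> A = 1"
  using eta_cases by force

lemma sum_ind: "(\<Sum>A\<in>ind. f A) = (\<Sum>i\<in>tng. f i) + (\<Sum>\<beta>\<in>nor. f \<beta>)" for f :: "nat \<Rightarrow> 'c::comm_monoid_add"
proof -
  have "ind = tng \<union> nor" "tng \<inter> nor = {}" by (auto simp: tng_def nor_def ind_def)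
  then show ?thesis by (simp add: sum.union_disjoint finite_index_sets)
qed

lemma Phi_smooth: "A \<in> ind \<Longrightarrow> smooth_on (\<Phi> A) S"
  by (erule ind_cases) (simp_all add: Phi_tan Phi_nor nu_smooth' smooth_on_tangent_field e_smooth')

lemma Phi_differentiable: "A \<in> ind \<Longrightarrow> y \<in> S \<Longrightarrow> \<Phi> A differentiable (at y)"
  using Phi_smooth smooth_on_differentiable by blast

lemma Phi_orth:
  assumes y: "y \<in> S" and "A \<in> ind" "C \<in> ind"
  shows "G (F y) (\<Phi> A y) (\<Phi> C y) = (if A = C then \<eta> A else 0)"
  using assms(2)
proof (rule ind_cases)
  assume A: "A \<in> tng"
  show ?thesis using assms(3)
    by (rule ind_cases)
       (use A e_orth'[OF y, of A C] nu_normal'[OF y, of C] G_sym[OF y] in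
         \<open>auto simp: Phi_tan Phi_nor induced_metric_def eta_tan dest: tan_nor\<close>)
next
  assume A: "A \<in> nor"
  show ?thesis using assms(3)
    by (rule ind_cases) (use A nu_normal'[OF y] nu_orth'[OF y] in \<open>auto simp: Phi_tan Phi_nor eta_nor dest: tan_nor\<close>)
qed

lemma frame_expansion:
  assumes y: "y \<in> S"
  shows "w = (\<Sum>A\<in>ind. (\<eta> A * G (F y) w (\<Phi> A y)) *\<^sub>R \<Phi> A y)"
proof -
  have "w = (\<Sum>A\<in>ind. (G (F y) w (\<Phi> A y) / \<eta> A) *\<^sub>R \<Phi> A y)"
    by (rule orthogonal_expansion[OF G_bilinear[OF y]])
       (simp_all add: Phi_orth[OF y] finite_index_sets card_index_sets eta_nz)
  also have "\<dots> = (\<Sum>A\<in>ind. (\<eta> A * G (F y) w (\<Phi> A y)) *\<^sub>R \<Phi> A y)"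
    by (intro sum.cong refl) (use eta_cases in force)
  finally show ?thesis .
qed

lemma G_frame_expansion:
  assumes y: "y \<in> S"
  shows "G (F y) u w = (\<Sum>A\<in>ind. \<eta> A * G (F y) u (\<Phi> A y) * G (F y) w (\<Phi> A y))"
proof -
  have l: "linear (G (F y) u)" using G_bilinear[OF y] by (simp add: bilinear_def)
  show ?thesis
    by (subst frame_expansion[OF y, of w]) (simp add: linear_sum[OF l] linear_scale[OF l] mult_ac)
qed

lemma tangent_expansion:
  assumes y: "y \<in> S"
  shows "v = (\<Sum>i\<in>tng. gM y v (e i y) *\<^sub>R e i y)"
proof -
  have "v = (\<Sum>i\<in>tng. (gM y v (e i y) / 1) *\<^sub>R e i y)"
    by (rule orthogonal_expansion[OF metric_on_bilinear[OF gM_metric_on y]]) (simp_all add: e_orth'[OF y] finite_index_sets card_index_sets)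
  then show ?thesis by simp
qed

lemma theta_smooth: "k \<in> tng \<Longrightarrow> A \<in> ind \<Longrightarrow> C \<in> ind \<Longrightarrow> smooth_on (\<theta> k A C) S"
  unfolding \<theta>_def by (intro smooth_on_G smooth_on_DD Phi_smooth e_smooth')

lemma tau_smooth: "A \<in> ind \<Longrightarrow> smooth_on (\<tau> A) S"
  unfolding \<tau>_def by (intro smooth_on_G smooth_on_const Phi_smooth)

lemma d_smooth: "k \<in> tng \<Longrightarrow> smooth_on \<phi> S \<Longrightarrow> smooth_on (\<lambda>y. d k \<phi> y) S"
  by (rule smooth_on_fd_field[OF S _ e_smooth'])

lemma theta_skew:
  assumes y: "y \<in> S" and k: "k \<in> tng" and A: "A \<in> ind" and C: "C \<in> ind"
  shows "\<theta> k A C y = - \<theta> k C A y"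
proof -
  have "fd (\<lambda>y. G (F y) (\<Phi> A y) (\<Phi> C y)) y = fd (\<lambda>y. if A = C then \<eta> A else 0) y"
    by (rule fd_cong_open(2)[OF S y]) (use Phi_orth A C in auto)
  then have "d k (\<lambda>y. G (F y) (\<Phi> A y) (\<Phi> C y)) y = 0" by simp
  then show ?thesis
    unfolding DD_compat[OF y Phi_differentiable[OF A y] Phi_differentiable[OF C y], of "e k"]
    by (simp add: \<theta>_def G_sym[OF y, of "\<Phi> A y"])
qed

lemma gM_lie_bracket:
  assumes y: "y \<in> S" and k: "k \<in> tng" and l: "l \<in> tng" and A: "A \<in> ind"
  shows "G (F y) (fd F y (lie_bracket (e k) (e l) y)) (\<Phi> A y) = \<theta> k l A y - \<theta> l k A y"
proof -
  have "fd F y (lie_bracket (e k) (e l) y) = DD (e k) (\<Phi> l) y - DD (e l) (\<Phi> k) y"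
    using DD_torsion_free[OF y smooth_on_differentiable[OF e_smooth'[OF k] y] smooth_on_differentiable[OF e_smooth'[OF l] y]]
    by (simp add: Phi_tan k l)
  then show ?thesis by (simp add: \<theta>_def bilinear_lsub[OF G_bilinear[OF y]])
qed

text \<open>
  The bracket of two tangent fields is tangential, so the normal part of \<open>D\<^sub>kE\<^sub>l - D\<^sub>lE\<^sub>k\<close> vanishes.
\<close>

lemma theta_sym:
  assumes y: "y \<in> S" and k: "k \<in> tng" and l: "l \<in> tng" and b: "\<beta> \<in> nor"
  shows "\<theta> k l \<beta> y = \<theta> l k \<beta> y"
  using gM_lie_bracket[OF y k l nor_ind[OF b]] nu_normal'[OF y b] G_sym[OF y, of _ "\<nu> \<beta> y"] Phi_nor[OF b] by simp

lemma lie_bracket_frame: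
  assumes y: "y \<in> S" and k: "k \<in> tng" and l: "l \<in> tng"
  shows "lie_bracket (e k) (e l) y = (\<Sum>j\<in>tng. (\<theta> k l j y - \<theta> l k j y) *\<^sub>R e j y)"
proof -
  have "gM y (lie_bracket (e k) (e l) y) (e j y) = \<theta> k l j y - \<theta> l k j y" if j: "j \<in> tng" for j
    using gM_lie_bracket[OF y k l tan_ind[OF j]] by (simp add: induced_metric_def Phi_tan j)
  then show ?thesis
    using tangent_expansion[OF y, of "lie_bracket (e k) (e l) y"] by simp
qed

lemma fd_sum_direction:
  assumes "\<phi> differentiable (at y)"
  shows "fd \<phi> y (\<Sum>j\<in>J. c j *\<^sub>R v j) = (\<Sum>j\<in>J. c j *\<^sub>R fd \<phi> y (v j))"
  using linear_frechet_derivative[OF assms] by (simp add: linear_sum linear_scale)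

lemma d_commutator:
  assumes y: "y \<in> S" and k: "k \<in> tng" and l: "l \<in> tng" and p: "smooth_on \<phi> S"
  shows "d k (\<lambda>y. d l \<phi> y) y - d l (\<lambda>y. d k \<phi> y) y = (\<Sum>j\<in>tng. (\<theta> k l j y - \<theta> l k j y) * d j \<phi> y)"
proof -
  have D: "d k (\<lambda>y. d l \<phi> y) y = fd (\<lambda>z. fd \<phi> z (e l y)) y (e k y) + fd \<phi> y (fd (e l) y (e k y))"
    if l: "l \<in> tng" for k l
    using fd_eqI[OF has_derivative_fd_field[OF p S y smooth_on_has_derivative[OF e_smooth'[OF l] y]]] by simp
  have "d k (\<lambda>y. d l \<phi> y) y - d l (\<lambda>y. d k \<phi> y) y = fd \<phi> y (lie_bracket (e k) (e l) y)"
    unfolding D[OF k] D[OF l] lie_bracket_def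
    using fd_commute[OF p S y, of "e l y" "e k y"] linear_frechet_derivative[OF smooth_on_differentiable[OF p y]]
    by (simp add: linear_diff)
  also have "\<dots> = (\<Sum>j\<in>tng. (\<theta> k l j y - \<theta> l k j y) * d j \<phi> y)"
    unfolding lie_bracket_frame[OF y k l] fd_sum_direction[OF smooth_on_differentiable[OF p y]] by simp
  finally show ?thesis .
qed

text \<open>
  The components \<open>\<langle>R(E\<^sub>k, E\<^sub>l)\<Phi>\<^sub>A, \<Phi>\<^sub>C\<rangle>\<close> of the ambient curvature; since \<open>k\<close> and \<open>l\<close> are tangential, no
  sign \<open>\<eta>\<close> occurs.
\<close>

definition "Rb k l A C y =
   - bb (F y) * ((if l = A then 1 else 0) * (if k = C then 1 else 0) - (if k = A then 1 else 0) * (if l = C then 1 else 0))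
   - rr (F y) * ((if l = A then 1 else 0) * \<tau> k y * \<tau> C y - (if k = A then 1 else 0) * \<tau> l y * \<tau> C y
       + \<tau> l y * \<tau> A y * (if k = C then 1 else 0) - \<tau> k y * \<tau> A y * (if l = C then 1 else 0))"

text \<open>Cartan's second structure equation; it contains the Gauss, Codazzi and Ricci equations.\<close>

lemma structure_equation:
  assumes y: "y \<in> S" and k: "k \<in> tng" and l: "l \<in> tng" and A: "A \<in> ind" and C: "C \<in> ind"
  shows "d k (\<theta> l A C) y - d l (\<theta> k A C) y
     + (\<Sum>B\<in>ind. \<eta> B * (\<theta> l A B y * \<theta> k B C y - \<theta> k A B y * \<theta> l B C y))
     - (\<Sum>j\<in>tng. (\<theta> k l j y - \<theta> l k j y) * \<theta> j A C y) = Rb k l A C y"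
proof -
  note g = G_bilinear[OF y]
  have dt: "d k (\<theta> l A C) y = G (F y) (DD (e k) (DD (e l) (\<Phi> A)) y) (\<Phi> C y)
      - (\<Sum>B\<in>ind. \<eta> B * \<theta> l A B y * \<theta> k B C y)" if k: "k \<in> tng" and l: "l \<in> tng" for k l
  proof -
    have "d k (\<theta> l A C) y = G (F y) (DD (e k) (DD (e l) (\<Phi> A)) y) (\<Phi> C y) + G (F y) (DD (e l) (\<Phi> A) y) (DD (e k) (\<Phi> C) y)"
      unfolding \<theta>_def[abs_def]
      by (rule DD_compat[OF y _ Phi_differentiable[OF C y]])
         (rule smooth_on_differentiable[OF smooth_on_DD[OF e_smooth'[OF l] Phi_smooth[OF A]] y])
    also have "G (F y) (DD (e l) (\<Phi> A) y) (DD (e k) (\<Phi> C) y) = (\<Sum>B\<in>ind. \<eta> B * \<theta> l A B y * \<theta> k C B y)"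
      unfolding \<theta>_def by (rule G_frame_expansion[OF y])
    also have "\<dots> = - (\<Sum>B\<in>ind. \<eta> B * \<theta> l A B y * \<theta> k B C y)"
      unfolding sum_negf[symmetric] by (intro sum.cong refl) (use theta_skew[OF y k C] in simp)
    finally show ?thesis by simp
  qed
  have br: "G (F y) (DD (lie_bracket (e k) (e l)) (\<Phi> A) y) (\<Phi> C y) = (\<Sum>j\<in>tng. (\<theta> k l j y - \<theta> l k j y) * \<theta> j A C y)"
  proof -
    note lin = DD_direction_linear[OF y Phi_differentiable[OF A y]]
    have l2: "linear (\<lambda>u. G (F y) u (\<Phi> C y))" using g by (simp add: bilinear_def)
    have "DD (lie_bracket (e k) (e l)) (\<Phi> A) y = DD (\<lambda>_. \<Sum>j\<in>tng. (\<theta> k l j y - \<theta> l k j y) *\<^sub>R e j y) (\<Phi> A) y"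
      by (rule DD_at_cong) (rule lie_bracket_frame[OF y k l])
    also have "\<dots> = (\<Sum>j\<in>tng. (\<theta> k l j y - \<theta> l k j y) *\<^sub>R DD (\<lambda>_. e j y) (\<Phi> A) y)"
      by (simp only: linear_sum[OF lin] linear_scale[OF lin])
    also have "\<dots> = (\<Sum>j\<in>tng. (\<theta> k l j y - \<theta> l k j y) *\<^sub>R DD (e j) (\<Phi> A) y)"
      by (intro sum.cong refl arg_cong2[of _ _ _ _ "(*\<^sub>R)"] DD_at_cong)
    finally show ?thesis by (simp add: linear_sum[OF l2] linear_scale[OF l2] \<theta>_def)
  qed
  have orth: "G (F y) (fd F y (e k y)) (\<Phi> A y) = (if k = A then 1 else 0)" if "k \<in> tng" "A \<in> ind" for k A
    using Phi_orth[OF y tan_ind[OF that(1)] that(2)] eta_tan[OF that(1)] by (auto simp: Phi_tan[OF that(1)])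
  have tau: "G (F y) (fd F y (e k y)) P = \<tau> k y" if "k \<in> tng" for k
    using that G_sym[OF y] by (simp add: \<tau>_def Phi_tan)
  have tau': "G (F y) (\<Phi> A y) P = \<tau> A y" for A
    using G_sym[OF y] by (simp add: \<tau>_def)
  have "G (F y) (coord_curvature (christoffel G) (F y) (fd F y (e k y)) (fd F y (e l y)) (\<Phi> A y)) (\<Phi> C y) = Rb k l A C y"
    unfolding ambient_curvature[OF FV[OF y]] Rb_def using k l A C by (simp add: orth tau tau')
  moreover have "G (F y) (coord_curvature (christoffel G) (F y) (fd F y (e k y)) (fd F y (e l y)) (\<Phi> A y)) (\<Phi> C y)
     = G (F y) (DD (e k) (DD (e l) (\<Phi> A)) y) (\<Phi> C y) - G (F y) (DD (e l) (DD (e k) (\<Phi> A)) y) (\<Phi> C y)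
       - (\<Sum>j\<in>tng. (\<theta> k l j y - \<theta> l k j y) * \<theta> j A C y)"
    unfolding DD_curvature[OF y e_smooth'[OF k] e_smooth'[OF l] Phi_smooth[OF A], symmetric]
    by (simp add: bilinear_lsub[OF g] br)
  ultimately show ?thesis
    unfolding dt[OF k l] dt[OF l k] by (simp add: right_diff_distrib sum_subtractf algebra_simps)
qed

lemma d_tau:
  assumes y: "y \<in> S" and k: "k \<in> tng" and A: "A \<in> ind"
  shows "d k (\<tau> A) y = lam (F y) * ((if k = A then 1 else 0) - \<epsilon> * \<tau> k y * \<tau> A y)
     + (\<Sum>B\<in>ind. \<eta> B * \<theta> k A B y * \<tau> B y)"
proof -
  note g = G_bilinear[OF y]
  have "d k (\<tau> A) y = G (F y) (DD (e k) (\<lambda>_. P) y) (\<Phi> A y) + G (F y) P (DD (e k) (\<Phi> A) y)"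
    unfolding \<tau>_def[abs_def] by (rule DD_compat[OF y differentiable_const Phi_differentiable[OF A y]])
  also have "G (F y) P (DD (e k) (\<Phi> A) y) = (\<Sum>B\<in>ind. \<eta> B * \<theta> k A B y * \<tau> B y)"
    by (subst G_frame_expansion[OF y]) (simp add: \<theta>_def \<tau>_def mult_ac)
  also have "DD (e k) (\<lambda>_. P) y = lam (F y) *\<^sub>R (\<Phi> k y - (\<epsilon> * \<tau> k y) *\<^sub>R P)"
    using ambient_dt[OF FV[OF y]] k G_sym[OF y, of P] by (simp add: ambient_deriv_def Phi_tan \<tau>_def)
  finally show ?thesis
    using Phi_orth[OF y tan_ind[OF k] A] eta_tan[OF k]
    by (auto simp: bilinear_lmul[OF g] bilinear_lsub[OF g] \<tau>_def[symmetric])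
qed

lemma theta_parallel:
  assumes k: "k \<in> tng" and i: "i \<in> tng" and j: "j \<in> tng"
  shows "\<theta> k i j x = 0"
proof -
  have "cov_deriv gM (e k) (e i) x = cov_deriv gM (\<lambda>_. e k x) (e i) x" by (simp add: cov_deriv_def)
  then have "cov_deriv gM (e k) (e i) x = 0" using e_parallel'[OF i] by simp
  then have "0 = gM x (cov_deriv gM (e k) (e i) x) (e j x)"
    by (simp add: bilinear_lzero[OF metric_on_bilinear[OF gM_metric_on x]])
  also have "\<dots> = \<theta> k i j x"
    unfolding gM_cov_deriv[OF x smooth_on_differentiable[OF e_smooth'[OF i] x]] by (simp add: \<theta>_def Phi_tan i j)
  finally show ?thesis by simp
qed

end

section \<open>The second fundamental form and its derivatives in the frame\<close>

context adapted_chart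
begin

text \<open>
  The component \<open>\<langle>\<alpha>(u, v), \<nu>\<^sub>\<beta>\<rangle>\<close>. This formula contains derivatives of \<open>F\<close> only, so it is visibly
  tensorial, whereas \<open>second_ff\<close> differentiates its second argument.
\<close>

definition "II \<beta> y u v =
  G (F y) (fd (\<lambda>z. fd F z v) y u + christoffel G (F y) (fd F y u) (fd F y v)) (\<nu> \<beta> y)"

lemma second_ff_normal: "y \<in> S \<Longrightarrow> G (F y) (second_ff G F X Y y) (fd F y v) = 0"
  unfolding second_ff_def by (rule normal_part_orthogonal)

lemma normal_deriv_normal: "y \<in> S \<Longrightarrow> G (F y) (normal_deriv G F X N y) (fd F y v) = 0"
  unfolding normal_deriv_def by (rule normal_part_orthogonal)

lemma nabla_second_ff_normal:
  assumes y: "y \<in> S"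
  shows "G (F y) (nabla_second_ff G F Z X Y y) (fd F y v) = 0"
  by (simp add: nabla_second_ff_def bilinear_lsub[OF G_bilinear[OF y]] second_ff_normal[OF y] normal_deriv_normal[OF y])

lemma normal_expansion:
  assumes y: "y \<in> S" and w: "\<And>v. G (F y) w (fd F y v) = 0"
  shows "w = (\<Sum>\<beta>\<in>nor. (\<eta> \<beta> * G (F y) w (\<nu> \<beta> y)) *\<^sub>R \<nu> \<beta> y)"
proof -
  have "w = (\<Sum>A\<in>ind. (\<eta> A * G (F y) w (\<Phi> A y)) *\<^sub>R \<Phi> A y)" by (rule frame_expansion[OF y])
  also have "\<dots> = (\<Sum>\<beta>\<in>nor. (\<eta> \<beta> * G (F y) w (\<nu> \<beta> y)) *\<^sub>R \<nu> \<beta> y)"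
    unfolding sum_ind by (simp add: Phi_tan Phi_nor w)
  finally show ?thesis .
qed

lemma G_normal_expansion:
  assumes y: "y \<in> S" and w: "\<And>v. G (F y) w (fd F y v) = 0"
  shows "G (F y) w u = (\<Sum>\<beta>\<in>nor. \<eta> \<beta> * G (F y) w (\<nu> \<beta> y) * G (F y) u (\<nu> \<beta> y))"
proof -
  have "G (F y) w u = (\<Sum>A\<in>ind. \<eta> A * G (F y) w (\<Phi> A y) * G (F y) u (\<Phi> A y))"
    by (rule G_frame_expansion[OF y])
  also have "\<dots> = (\<Sum>\<beta>\<in>nor. \<eta> \<beta> * G (F y) w (\<nu> \<beta> y) * G (F y) u (\<nu> \<beta> y))"
    unfolding sum_ind by (simp add: Phi_tan Phi_nor w)
  finally show ?thesis .
qed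

lemma second_ff_II:
  assumes y: "y \<in> S" and Y: "Y differentiable (at y)" and b: "\<beta> \<in> nor"
  shows "G (F y) (second_ff G F X Y y) (\<nu> \<beta> y) = II \<beta> y (X y) (Y y)"
  unfolding second_ff_def G_normal_part[OF y nu_normal'[OF y b]] DD_tangent_field[OF y Y] II_def
  using trans[OF G_sym[OF y] nu_normal'[OF y b]] by (simp add: bilinear_ladd[OF G_bilinear[OF y]])

lemma II_bilinear:
  assumes y: "y \<in> S"
  shows "bilinear (II \<beta> y)"
proof -
  note g = G_bilinear[OF y] and l = fd_F_linear[OF y] and c = christoffel_bilinear[OF G V FV[OF y]]
  have l2: "linear (fd (\<lambda>z. fd F z v) y)" for v
    by (rule linear_frechet_derivative[OF smooth_on_differentiable[OF smooth_on_fd[OF F] y]])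
  have sym: "fd (\<lambda>z. fd F z v) y u = fd (\<lambda>z. fd F z u) y v" for u v
    by (rule fd_commute[OF F S y])
  have add: "fd (\<lambda>z. fd F z (v + v')) y u = fd (\<lambda>z. fd F z v) y u + fd (\<lambda>z. fd F z v') y u" for u v v'
    unfolding sym[of _ u] by (rule linear_add[OF l2])
  have scale: "fd (\<lambda>z. fd F z (r *\<^sub>R v)) y u = r *\<^sub>R fd (\<lambda>z. fd F z v) y u" for u v r
    unfolding sym[of _ u] by (rule linear_scale[OF l2])
  show ?thesis
    unfolding bilinear_def II_def
    by (intro conjI allI linearI)
       (simp_all add: add scale linear_add[OF l2] linear_scale[OF l2] linear_add[OF l] linear_scale[OF l]
          bilinear_ladd[OF c] bilinear_radd[OF c] bilinear_lmul[OF c] bilinear_rmul[OF c]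
          bilinear_ladd[OF g] bilinear_lmul[OF g] algebra_simps)
qed

lemma II_smooth:
  assumes b: "\<beta> \<in> nor" and X: "smooth_on X S" and Y: "smooth_on Y S"
  shows "smooth_on (\<lambda>y. II \<beta> y (X y) (Y y)) S"
proof -
  have s: "smooth_on (\<lambda>y. II \<beta> y u v) S" for u v
    unfolding II_def
    by (intro smooth_on_G smooth_on_add S smooth_on_fd F nu_smooth'[OF b] smooth_on_bilinear_family[OF S FS, where B = "christoffel G"]
        christoffel_bilinear[OF G V] christoffel_smooth)
  show ?thesis
    by (rule smooth_on_bilinear_family[OF S _ II_bilinear s smooth_on_id X Y]) auto
qed

lemma fd_II:
  assumes y: "y \<in> S" and b: "\<beta> \<in> nor" and X: "smooth_on X S" and Y: "smooth_on Y S"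
  shows "fd (\<lambda>y. II \<beta> y (X y) (Y y)) y h =
    fd (\<lambda>z. II \<beta> z (X y) (Y y)) y h + II \<beta> y (fd X y h) (Y y) + II \<beta> y (X y) (fd Y y h)"
proof -
  have "((\<lambda>y. II \<beta> y (X y) (Y y)) has_derivative (\<lambda>h. fd (\<lambda>z. II \<beta> z (X y) (Y y)) y h
      + II \<beta> y (fd X y h) (Y y) + II \<beta> y (X y) (fd Y y h))) (at y)"
    by (rule has_derivative_bilinear_family[OF S y S _ II_bilinear, where F = "\<lambda>y. y" and F' = "\<lambda>h. h"])
       (auto intro!: smooth_on_has_derivative[OF _ y] smooth_on_differentiable[OF II_smooth y] X Y smooth_on_const b)
  from fd_eqI[OF this] show ?thesis by simp
qed

lemma second_ff_expansion:
  assumes y: "y \<in> S" and Y: "Y differentiable (at y)"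
  shows "second_ff G F X Y y = (\<Sum>\<beta>\<in>nor. (\<eta> \<beta> * II \<beta> y (X y) (Y y)) *\<^sub>R \<nu> \<beta> y)"
proof -
  have "second_ff G F X Y y = (\<Sum>\<beta>\<in>nor. (\<eta> \<beta> * G (F y) (second_ff G F X Y y) (\<nu> \<beta> y)) *\<^sub>R \<nu> \<beta> y)"
    by (rule normal_expansion[OF y second_ff_normal[OF y]])
  then show ?thesis by (simp add: second_ff_II[OF y Y])
qed

lemma second_ff_smooth:
  assumes "smooth_on X S" "smooth_on Y S"
  shows "smooth_on (second_ff G F X Y) S"
proof (rule smooth_on_cong[OF S])
  show "smooth_on (\<lambda>y. \<Sum>\<beta>\<in>nor. (\<eta> \<beta> * II \<beta> y (X y) (Y y)) *\<^sub>R \<nu> \<beta> y) S"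
    by (intro smooth_on_sum smooth_on_scaleR smooth_on_mult smooth_on_const II_smooth nu_smooth' S assms)
qed (use second_ff_expansion smooth_on_differentiable[OF assms(2)] in auto)

lemma II_frame:
  assumes y: "y \<in> S" and i: "i \<in> tng" and j: "j \<in> tng" and b: "\<beta> \<in> nor"
  shows "II \<beta> y (e i y) (e j y) = \<theta> i j \<beta> y"
  unfolding second_ff_II[OF y smooth_on_differentiable[OF e_smooth'[OF j] y] b, of "e i", symmetric]
  unfolding second_ff_def G_normal_part[OF y nu_normal'[OF y b]] by (simp add: \<theta>_def Phi_tan Phi_nor b j)

lemma second_ff_frame:
  assumes y: "y \<in> S" and i: "i \<in> tng" and j: "j \<in> tng" and b: "\<beta> \<in> nor"
  shows "G (F y) (second_ff G F (e i) (e j) y) (\<nu> \<beta> y) = \<theta> i j \<beta> y"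
  using second_ff_II[OF y smooth_on_differentiable[OF e_smooth'[OF j] y] b] II_frame[OF assms] by simp

lemma normal_deriv_component:
  assumes y: "y \<in> S" and N: "N differentiable (at y)" and b: "\<beta> \<in> nor"
  shows "G (F y) (normal_deriv G F Z N y) (\<nu> \<beta> y) =
    fd (\<lambda>y. G (F y) (N y) (\<nu> \<beta> y)) y (Z y) - G (F y) (N y) (DD Z (\<nu> \<beta>) y)"
  unfolding normal_deriv_def G_normal_part[OF y nu_normal'[OF y b]]
  using DD_compat[OF y N smooth_on_differentiable[OF nu_smooth'[OF b] y], of Z] by simp

lemma normal_deriv_frame:
  assumes y: "y \<in> S" and N: "N differentiable (at y)" and b: "\<beta> \<in> nor" and k: "k \<in> tng"
    and normal: "\<And>v. G (F y) (N y) (fd F y v) = 0"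
  shows "G (F y) (normal_deriv G F (e k) N y) (\<nu> \<beta> y) =
    d k (\<lambda>y. G (F y) (N y) (\<nu> \<beta> y)) y - (\<Sum>\<gamma>\<in>nor. \<eta> \<gamma> * \<theta> k \<beta> \<gamma> y * G (F y) (N y) (\<nu> \<gamma> y))"
proof -
  have "G (F y) (N y) (DD (e k) (\<nu> \<beta>) y) = (\<Sum>\<gamma>\<in>nor. \<eta> \<gamma> * G (F y) (N y) (\<nu> \<gamma> y) * G (F y) (DD (e k) (\<nu> \<beta>) y) (\<nu> \<gamma> y))"
    by (rule G_normal_expansion[OF y normal])
  also have "\<dots> = (\<Sum>\<gamma>\<in>nor. \<eta> \<gamma> * \<theta> k \<beta> \<gamma> y * G (F y) (N y) (\<nu> \<gamma> y))"
    by (intro sum.cong refl) (simp add: \<theta>_def Phi_nor b)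
  finally show ?thesis unfolding normal_deriv_component[OF y N b] by simp
qed

lemma cov_deriv_frame:
  assumes y: "y \<in> S" and k: "k \<in> tng" and i: "i \<in> tng"
  shows "cov_deriv gM (e k) (e i) y = (\<Sum>p\<in>tng. \<theta> k i p y *\<^sub>R e p y)"
proof -
  have "gM y (cov_deriv gM (e k) (e i) y) (e p y) = \<theta> k i p y" if "p \<in> tng" for p
    unfolding gM_cov_deriv[OF y smooth_on_differentiable[OF e_smooth'[OF i] y]]
    by (simp add: \<theta>_def Phi_tan i that)
  then show ?thesis using tangent_expansion[OF y, of "cov_deriv gM (e k) (e i) y"] by simp
qed

lemma cov_deriv_frame_smooth:
  assumes k: "k \<in> tng" and i: "i \<in> tng"
  shows "smooth_on (cov_deriv gM (e k) (e i)) S"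
proof (rule smooth_on_cong[OF S])
  show "smooth_on (\<lambda>y. \<Sum>p\<in>tng. \<theta> k i p y *\<^sub>R e p y) S"
    by (intro smooth_on_sum smooth_on_scaleR S theta_smooth e_smooth' k tan_ind i)
qed (simp add: cov_deriv_frame k i)

text \<open>
  The components \<open>h\<^sup>\<beta>\<^sub>i\<^sub>j\<^sub>k\<close> as functions near the point: the derivative of \<open>h\<^sup>\<beta>\<^sub>i\<^sub>j\<close>, corrected once for each of
  the indices \<open>\<beta>\<close>, \<open>i\<close> and \<open>j\<close>.
\<close>

definition "H3 \<beta> i j k y = d k (\<theta> i j \<beta>) y - (\<Sum>\<gamma>\<in>nor. \<eta> \<gamma> * \<theta> k \<beta> \<gamma> y * \<theta> i j \<gamma> y)
   - (\<Sum>p\<in>tng. \<theta> k i p y * \<theta> p j \<beta> y) - (\<Sum>p\<in>tng. \<theta> k j p y * \<theta> i p \<beta> y)"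

lemma II_sum_left: "y \<in> S \<Longrightarrow> II \<beta> y (\<Sum>p\<in>J. c p *\<^sub>R u p) v = (\<Sum>p\<in>J. c p * II \<beta> y (u p) v)"
  and II_sum_right: "y \<in> S \<Longrightarrow> II \<beta> y v (\<Sum>p\<in>J. c p *\<^sub>R u p) = (\<Sum>p\<in>J. c p * II \<beta> y v (u p))"
proof -
  assume "y \<in> S"
  then have l: "linear (\<lambda>u. II \<beta> y u v)" "linear (II \<beta> y v)"
    using II_bilinear[of y \<beta>] by (simp_all add: bilinear_def)
  show "II \<beta> y (\<Sum>p\<in>J. c p *\<^sub>R u p) v = (\<Sum>p\<in>J. c p * II \<beta> y (u p) v)"
    "II \<beta> y v (\<Sum>p\<in>J. c p *\<^sub>R u p) = (\<Sum>p\<in>J. c p * II \<beta> y v (u p))"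
    by (simp_all add: linear_sum[OF l(1)] linear_scale[OF l(1)] linear_sum[OF l(2)] linear_scale[OF l(2)])
qed

lemma nabla_second_ff_frame:
  assumes y: "y \<in> S" and i: "i \<in> tng" and j: "j \<in> tng" and k: "k \<in> tng" and b: "\<beta> \<in> nor"
  shows "G (F y) (nabla_second_ff G F (e k) (e i) (e j) y) (\<nu> \<beta> y) = H3 \<beta> i j k y"
proof -
  have ff: "G (F y) (second_ff G F (e i) (e j) y) (\<nu> \<beta> y) = \<theta> i j \<beta> y" if "y \<in> S" "\<beta> \<in> nor" for y \<beta>
    by (rule second_ff_frame[OF that(1) i j that(2)])
  have dd: "fd (\<lambda>y. G (F y) (second_ff G F (e i) (e j) y) (\<nu> \<beta> y)) y = fd (\<theta> i j \<beta>) y"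
    by (rule fd_cong_open(2)[OF S y])
       (use ff b theta_smooth[OF i tan_ind[OF j] nor_ind[OF b]] smooth_on_differentiable y in auto)
  have 1: "G (F y) (normal_deriv G F (e k) (second_ff G F (e i) (e j)) y) (\<nu> \<beta> y)
     = d k (\<theta> i j \<beta>) y - (\<Sum>\<gamma>\<in>nor. \<eta> \<gamma> * \<theta> k \<beta> \<gamma> y * \<theta> i j \<gamma> y)"
    unfolding normal_deriv_frame[OF y smooth_on_differentiable[OF second_ff_smooth[OF e_smooth'[OF i] e_smooth'[OF j]] y]
      b k second_ff_normal[OF y]] dd by (simp add: ff y)
  have 2: "G (F y) (second_ff G F (cov_deriv gM (e k) (e i)) (e j) y) (\<nu> \<beta> y) = (\<Sum>p\<in>tng. \<theta> k i p y * \<theta> p j \<beta> y)"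
    unfolding second_ff_II[OF y smooth_on_differentiable[OF e_smooth'[OF j] y] b] cov_deriv_frame[OF y k i] II_sum_left[OF y]
    by (simp add: II_frame y j b)
  have 3: "G (F y) (second_ff G F (e i) (cov_deriv gM (e k) (e j)) y) (\<nu> \<beta> y) = (\<Sum>p\<in>tng. \<theta> k j p y * \<theta> i p \<beta> y)"
    unfolding second_ff_II[OF y smooth_on_differentiable[OF cov_deriv_frame_smooth[OF k j] y] b] cov_deriv_frame[OF y k j] II_sum_right[OF y]
    by (simp add: II_frame y i b)
  show ?thesis
    by (simp add: nabla_second_ff_def bilinear_lsub[OF G_bilinear[OF y]] 1 2 3 H3_def)
qed

lemma H3_smooth:
  assumes i: "i \<in> tng" and j: "j \<in> tng" and k: "k \<in> tng" and b: "\<beta> \<in> nor"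
  shows "smooth_on (H3 \<beta> i j k) S"
proof -
  have "smooth_on (\<lambda>y. d k (\<theta> i j \<beta>) y - (\<Sum>\<gamma>\<in>nor. \<eta> \<gamma> * \<theta> k \<beta> \<gamma> y * \<theta> i j \<gamma> y)
     - (\<Sum>p\<in>tng. \<theta> k i p y * \<theta> p j \<beta> y) - (\<Sum>p\<in>tng. \<theta> k j p y * \<theta> i p \<beta> y)) S"
    by (intro smooth_on_diff smooth_on_sum smooth_on_mult smooth_on_const d_smooth theta_smooth tan_ind nor_ind i j k b S)
  then show ?thesis unfolding H3_def[abs_def] .
qed

lemma nabla_second_ff_smooth:
  assumes i: "i \<in> tng" and j: "j \<in> tng" and k: "k \<in> tng"
  shows "smooth_on (nabla_second_ff G F (e k) (e i) (e j)) S"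
proof (rule smooth_on_cong[OF S])
  show "smooth_on (\<lambda>y. \<Sum>\<beta>\<in>nor. (\<eta> \<beta> * H3 \<beta> i j k y) *\<^sub>R \<nu> \<beta> y) S"
    by (intro smooth_on_sum smooth_on_scaleR smooth_on_mult smooth_on_const H3_smooth nu_smooth' S i j k)
  show "(\<Sum>\<beta>\<in>nor. (\<eta> \<beta> * H3 \<beta> i j k y) *\<^sub>R \<nu> \<beta> y) = nabla_second_ff G F (e k) (e i) (e j) y" if y: "y \<in> S" for y
    using normal_expansion[OF y nabla_second_ff_normal[OF y], of "e k" "e i" "e j"]
    by (simp add: nabla_second_ff_frame[OF y i j k])
qed

text \<open>
  Tensoriality of \<open>\<nabla>\<^sup>\<bottom>\<alpha>\<close>, for fields that vanish at a point. The correction terms in the second covariant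
  derivative involve the fields \<open>\<nabla>e\<^sub>i\<close>, which vanish at the base point but in general not near it.
\<close>

lemma nabla_second_ff_zero_direction:
  assumes y: "y \<in> S" and b: "\<beta> \<in> nor" and Z: "Z y = 0" and X: "smooth_on X S" and Y: "smooth_on Y S"
    and ZY: "cov_deriv gM Z Y differentiable (at y)"
  shows "G (F y) (nabla_second_ff G F Z X Y y) (\<nu> \<beta> y) = 0"
proof -
  note c = christoffel_bilinear[OF gM_metric_on S y] and c' = christoffel_bilinear[OF G V FV[OF y]]
  have l: "fd W y 0 = 0" if "smooth_on W S" for W :: "(real^'n) \<Rightarrow> 'c::real_normed_vector"
    using linear_0[OF linear_frechet_derivative[OF smooth_on_differentiable[OF that y]]] .
  have 0: "cov_deriv gM Z X y = 0" "cov_deriv gM Z Y y = 0"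
    by (simp_all add: cov_deriv_def Z l X Y bilinear_lzero[OF c])
  have "DD Z (second_ff G F X Y) y = 0"
    by (simp add: ambient_deriv_def Z l second_ff_smooth X Y F bilinear_lzero[OF c'])
  then have 1: "G (F y) (normal_deriv G F Z (second_ff G F X Y) y) (\<nu> \<beta> y) = 0"
    unfolding normal_deriv_def G_normal_part[OF y nu_normal'[OF y b]] by (simp add: bilinear_lzero[OF G_bilinear[OF y]])
  show ?thesis
    by (simp add: nabla_second_ff_def bilinear_lsub[OF G_bilinear[OF y]] 1 0 second_ff_II[OF y _ b]
        smooth_on_differentiable[OF Y y] ZY bilinear_lzero[OF II_bilinear[OF y]] bilinear_rzero[OF II_bilinear[OF y]])
qed

lemma fd_second_ff_component:
  assumes y: "y \<in> S" and b: "\<beta> \<in> nor" and X: "smooth_on X S" and Y: "smooth_on Y S"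
  shows "fd (\<lambda>y. G (F y) (second_ff G F X Y y) (\<nu> \<beta> y)) y h =
    fd (\<lambda>z. II \<beta> z (X y) (Y y)) y h + II \<beta> y (fd X y h) (Y y) + II \<beta> y (X y) (fd Y y h)"
proof -
  have "fd (\<lambda>y. G (F y) (second_ff G F X Y y) (\<nu> \<beta> y)) y = fd (\<lambda>y. II \<beta> y (X y) (Y y)) y"
    by (rule fd_cong_open(2)[OF S y])
       (use second_ff_II b smooth_on_differentiable[OF Y] smooth_on_differentiable[OF II_smooth[OF b X Y] y] in auto)
  then show ?thesis by (simp add: fd_II[OF y b X Y])
qed

lemma II_zero_fields:
  assumes y: "y \<in> S" and "u = 0 \<or> v = 0"
  shows "fd (\<lambda>z. II \<beta> z u v) y h = 0" "second_ff G F (\<lambda>_. u) (\<lambda>_. v) y = 0"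
proof -
  have z: "II \<beta> z u v = 0" if "z \<in> S" for z \<beta>
    using assms(2) bilinear_lzero[OF II_bilinear[OF that]] bilinear_rzero[OF II_bilinear[OF that]] by auto
  have "fd (\<lambda>z. II \<beta> z u v) y = fd (\<lambda>_. 0) y"
    by (rule fd_cong_open(2)[OF S y]) (use z in auto)
  then show "fd (\<lambda>z. II \<beta> z u v) y h = 0" by simp
  show "second_ff G F (\<lambda>_. u) (\<lambda>_. v) y = 0"
    by (subst second_ff_expansion[OF y]) (simp_all add: z y)
qed

lemma nabla_second_ff_zero_argument:
  assumes y: "y \<in> S" and b: "\<beta> \<in> nor" and XY: "X y = 0 \<or> Y y = 0" and X: "smooth_on X S" and Y: "smooth_on Y S"
    and ZY: "cov_deriv gM Z Y differentiable (at y)"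
  shows "G (F y) (nabla_second_ff G F Z X Y y) (\<nu> \<beta> y) = 0"
proof -
  note c = christoffel_bilinear[OF gM_metric_on S y] and g = G_bilinear[OF y]
  note B = II_bilinear[OF y]
  have "second_ff G F X Y y = second_ff G F (\<lambda>_. X y) (\<lambda>_. Y y) y"
    by (simp add: second_ff_expansion[OF y] smooth_on_differentiable[OF Y y])
  then have s0: "second_ff G F X Y y = 0" using II_zero_fields(2)[OF y XY] by simp
  have 1: "G (F y) (normal_deriv G F Z (second_ff G F X Y) y) (\<nu> \<beta> y)
      = II \<beta> y (fd X y (Z y)) (Y y) + II \<beta> y (X y) (fd Y y (Z y))"
    unfolding normal_deriv_component[OF y smooth_on_differentiable[OF second_ff_smooth[OF X Y] y] b] fd_second_ff_component[OF y b X Y]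
    by (simp add: s0 bilinear_lzero[OF g] II_zero_fields(1)[OF y XY])
  have 2: "II \<beta> y (christoffel gM y (Z y) (X y)) (Y y) = 0" "II \<beta> y (X y) (christoffel gM y (Z y) (Y y)) = 0"
    using XY by (auto simp: bilinear_rzero[OF c] bilinear_lzero[OF B] bilinear_rzero[OF B])
  show ?thesis
    by (simp add: nabla_second_ff_def bilinear_lsub[OF g] 1 second_ff_II[OF y _ b] smooth_on_differentiable[OF Y y] ZY
        cov_deriv_def bilinear_ladd[OF B] bilinear_radd[OF B] 2)
qed

lemma cov_deriv_smooth:
  assumes X: "smooth_on X S" and Y: "smooth_on Y S"
  shows "smooth_on (cov_deriv gM X Y) S"
proof (rule smooth_on_cong[OF S])
  show "smooth_on (\<lambda>y. \<Sum>i\<in>tng. G (F y) (DD X (\<lambda>y. fd F y (Y y)) y) (fd F y (e i y)) *\<^sub>R e i y) S"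
    by (intro smooth_on_sum smooth_on_scaleR S smooth_on_G smooth_on_DD smooth_on_tangent_field e_smooth' X Y)
  show "(\<Sum>i\<in>tng. G (F y) (DD X (\<lambda>y. fd F y (Y y)) y) (fd F y (e i y)) *\<^sub>R e i y) = cov_deriv gM X Y y" if y: "y \<in> S" for y
    using tangent_expansion[OF y, of "cov_deriv gM X Y y"] by (simp add: gM_cov_deriv[OF y smooth_on_differentiable[OF Y y]])
qed

text \<open>
  The components of the second covariant derivative at the base point. The correction terms for the
  tangential indices are missing because the tangent frame is parallel there.
\<close>

definition "H4 \<beta> i j k l = d l (H3 \<beta> i j k) x - (\<Sum>\<gamma>\<in>nor. \<eta> \<gamma> * \<theta> l \<beta> \<gamma> x * H3 \<gamma> i j k x)"

lemma nabla2_second_ff_frame: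
  assumes i: "i \<in> tng" and j: "j \<in> tng" and k: "k \<in> tng" and l: "l \<in> tng" and b: "\<beta> \<in> nor"
  shows "G (F x) (nabla2_second_ff G F (e l) (e k) (e i) (e j) x) (\<nu> \<beta> x) = H4 \<beta> i j k l"
proof -
  note g = G_bilinear[OF x]
  have 0: "cov_deriv gM (e l) (e i) x = 0" if "i \<in> tng" for i
    unfolding cov_deriv_frame[OF x l that] by (simp add: theta_parallel l that)
  have dd: "fd (\<lambda>y. G (F y) (nabla_second_ff G F (e k) (e i) (e j) y) (\<nu> \<beta> y)) x = fd (H3 \<beta> i j k) x"
    by (rule fd_cong_open(2)[OF S x])
       (use nabla_second_ff_frame i j k b smooth_on_differentiable[OF H3_smooth x] in auto)
  have 1: "G (F x) (normal_deriv G F (e l) (nabla_second_ff G F (e k) (e i) (e j)) x) (\<nu> \<beta> x) = H4 \<beta> i j k l"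
    unfolding normal_deriv_frame[OF x smooth_on_differentiable[OF nabla_second_ff_smooth[OF i j k] x] b l nabla_second_ff_normal[OF x]] dd
    by (simp add: H4_def nabla_second_ff_frame x i j k)
  have sm: "cov_deriv gM Z Y differentiable (at x)" if "smooth_on Z S" "smooth_on Y S" for Z Y
    by (rule smooth_on_differentiable[OF cov_deriv_smooth[OF that] x])
  note es = e_smooth'[OF i] e_smooth'[OF j] e_smooth'[OF k] cov_deriv_frame_smooth[OF l i] cov_deriv_frame_smooth[OF l j]
    cov_deriv_frame_smooth[OF l k]
  have 2: "G (F x) (nabla_second_ff G F (cov_deriv gM (e l) (e k)) (e i) (e j) x) (\<nu> \<beta> x) = 0"
    by (rule nabla_second_ff_zero_direction[OF x b]) (use 0[OF k] in \<open>auto intro!: es sm\<close>)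
  have 3: "G (F x) (nabla_second_ff G F (e k) (cov_deriv gM (e l) (e i)) (e j) x) (\<nu> \<beta> x) = 0"
    by (rule nabla_second_ff_zero_argument[OF x b]) (use 0[OF i] in \<open>auto intro!: es sm\<close>)
  have 4: "G (F x) (nabla_second_ff G F (e k) (e i) (cov_deriv gM (e l) (e j)) x) (\<nu> \<beta> x) = 0"
    by (rule nabla_second_ff_zero_argument[OF x b]) (use 0[OF j] in \<open>auto intro!: es sm\<close>)
  show ?thesis
    by (simp add: nabla2_second_ff_def bilinear_lsub[OF g] 1 2 3 4)
qed

end

section \<open>Commutation formulas at the base point\<close>

lemma sum_symmetric_skew_zero:
  fixes s g :: "'i \<Rightarrow> 'i \<Rightarrow> real"
  assumes "\<And>i p. i \<in> J \<Longrightarrow> p \<in> J \<Longrightarrow> s i p = s p i" "\<And>i p. i \<in> J \<Longrightarrow> p \<in> J \<Longrightarrow> g i p = - g p i"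
  shows "(\<Sum>i\<in>J. \<Sum>p\<in>J. s i p * g i p) = 0"
proof -
  have "(\<Sum>i\<in>J. \<Sum>p\<in>J. s i p * g i p) = (\<Sum>i\<in>J. \<Sum>p\<in>J. s p i * g p i)" by (rule sum.swap)
  also have "\<dots> = (\<Sum>i\<in>J. \<Sum>p\<in>J. - (s i p * g i p))"
  proof (intro sum.cong refl)
    fix i p assume "i \<in> J" "p \<in> J"
    then show "s p i * g p i = - (s i p * g i p)" using assms(1)[of i p] assms(2)[of i p] by simp
  qed
  also have "\<dots> = - (\<Sum>i\<in>J. \<Sum>p\<in>J. s i p * g i p)" by (simp add: sum_negf)
  finally show ?thesis by simp
qed

text \<open>The Kronecker symbol.\<close>

definition kd :: "nat \<Rightarrow> nat \<Rightarrow> real" where "kd i j = (if i = j then 1 else 0)"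

context adapted_chart
begin

lemma theta_sym_fd:
  assumes y: "y \<in> S" and i: "i \<in> tng" and j: "j \<in> tng" and b: "\<beta> \<in> nor"
  shows "fd (\<theta> i j \<beta>) y = fd (\<theta> j i \<beta>) y"
  by (rule fd_cong_open(2)[OF S y])
     (use theta_sym i j b smooth_on_differentiable[OF theta_smooth[OF j tan_ind[OF i] nor_ind[OF b]] y] in auto)

lemma theta_skew_fd:
  assumes y: "y \<in> S" and k: "k \<in> tng" and A: "A \<in> ind" and C: "C \<in> ind"
  shows "fd (\<theta> k A C) y h = - fd (\<theta> k C A) y h"
proof -
  have "((\<lambda>y. - \<theta> k C A y) has_derivative (\<lambda>h. - fd (\<theta> k C A) y h)) (at y)"
    by (rule has_derivative_minus[OF smooth_on_has_derivative[OF theta_smooth[OF k C A] y]])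
  then have "(\<theta> k A C has_derivative (\<lambda>h. - fd (\<theta> k C A) y h)) (at y)"
    by (rule has_derivative_transform_within_open[OF _ S y]) (use theta_skew[OF _ k A C] in auto)
  from fd_eqI[OF this] show ?thesis by simp
qed

lemma H3_sym:
  assumes y: "y \<in> S" and i: "i \<in> tng" and j: "j \<in> tng" and k: "k \<in> tng" and b: "\<beta> \<in> nor"
  shows "H3 \<beta> i j k y = H3 \<beta> j i k y"
proof -
  have "(\<Sum>\<gamma>\<in>nor. \<eta> \<gamma> * \<theta> k \<beta> \<gamma> y * \<theta> i j \<gamma> y) = (\<Sum>\<gamma>\<in>nor. \<eta> \<gamma> * \<theta> k \<beta> \<gamma> y * \<theta> j i \<gamma> y)"
    using theta_sym[OF y i j] by (intro sum.cong refl) simp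
  moreover have "(\<Sum>p\<in>tng. \<theta> k i p y * \<theta> p j \<beta> y) = (\<Sum>p\<in>tng. \<theta> k i p y * \<theta> j p \<beta> y)"
    using theta_sym[OF y _ j b] by (intro sum.cong refl) simp
  moreover have "(\<Sum>p\<in>tng. \<theta> k j p y * \<theta> i p \<beta> y) = (\<Sum>p\<in>tng. \<theta> k j p y * \<theta> p i \<beta> y)"
    using theta_sym[OF y i _ b] by (intro sum.cong refl) simp
  ultimately show ?thesis by (simp add: H3_def theta_sym_fd[OF y i j b])
qed

lemma H4_sym:
  assumes i: "i \<in> tng" and j: "j \<in> tng" and k: "k \<in> tng" and l: "l \<in> tng" and b: "\<beta> \<in> nor"
  shows "H4 \<beta> i j k l = H4 \<beta> j i k l"
proof -
  have "fd (H3 \<beta> i j k) x = fd (H3 \<beta> j i k) x"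
    by (rule fd_cong_open(2)[OF S x])
       (use H3_sym i j k b smooth_on_differentiable[OF H3_smooth[OF j i k b] x] in auto)
  then show ?thesis
    using H3_sym[OF x i j k] by (simp add: H4_def)
qed

text \<open>
  The normal component of the structure equation. The two derivatives of \<open>h\<close> in it, with the products of
  connection forms, are exactly the two components of \<open>\<nabla>\<^sup>\<bottom>\<alpha>\<close>.
\<close>

lemma codazzi:
  assumes y: "y \<in> S" and i: "i \<in> tng" and j: "j \<in> tng" and k: "k \<in> tng" and b: "\<beta> \<in> nor"
  shows "H3 \<beta> i j k y - H3 \<beta> k j i y = - rr (F y) * ((kd i j * \<tau> k y - kd k j * \<tau> i y) * \<tau> \<beta> y)"
proof -
  have ne: "i \<noteq> \<beta>" "k \<noteq> \<beta>" using i k b tan_nor by blast+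
  have "Rb k i j \<beta> y = - rr (F y) * ((kd i j * \<tau> k y - kd k j * \<tau> i y) * \<tau> \<beta> y)"
    using ne by (auto simp: Rb_def kd_def algebra_simps)
  moreover have "(\<Sum>\<gamma>\<in>nor. \<eta> \<gamma> * (\<theta> i j \<gamma> y * \<theta> k \<gamma> \<beta> y - \<theta> k j \<gamma> y * \<theta> i \<gamma> \<beta> y))
     = (\<Sum>\<gamma>\<in>nor. \<eta> \<gamma> * \<theta> i \<beta> \<gamma> y * \<theta> k j \<gamma> y) - (\<Sum>\<gamma>\<in>nor. \<eta> \<gamma> * \<theta> k \<beta> \<gamma> y * \<theta> i j \<gamma> y)"
    unfolding sum_subtractf[symmetric]
    by (intro sum.cong refl) (use theta_skew[OF y i _ nor_ind[OF b]] theta_skew[OF y k _ nor_ind[OF b]] nor_ind in \<open>simp add: algebra_simps\<close>)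
  moreover have "(\<Sum>p\<in>tng. \<eta> p * (\<theta> i j p y * \<theta> k p \<beta> y - \<theta> k j p y * \<theta> i p \<beta> y))
     = (\<Sum>p\<in>tng. \<theta> i j p y * \<theta> k p \<beta> y) - (\<Sum>p\<in>tng. \<theta> k j p y * \<theta> i p \<beta> y)"
    unfolding sum_subtractf[symmetric] by (intro sum.cong refl) (simp add: eta_tan)
  moreover have "(\<Sum>p\<in>tng. (\<theta> k i p y - \<theta> i k p y) * \<theta> p j \<beta> y)
     = (\<Sum>p\<in>tng. \<theta> k i p y * \<theta> p j \<beta> y) - (\<Sum>p\<in>tng. \<theta> i k p y * \<theta> p j \<beta> y)"
    unfolding sum_subtractf[symmetric] by (intro sum.cong refl) (simp add: algebra_simps)
  ultimately show ?thesis
    using structure_equation[OF y k i tan_ind[OF j] nor_ind[OF b]] unfolding sum_ind H3_def by simp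
qed

text \<open>
  The components of \<open>\<nabla>T\<close> and of \<open>\<nabla>\<^sup>\<bottom>\<xi>\<close> at the base point.
\<close>

definition "DT l k = d l (\<tau> k) x"
definition "DX \<beta> l = d l (\<tau> \<beta>) x - (\<Sum>\<gamma>\<in>nor. \<eta> \<gamma> * \<theta> l \<beta> \<gamma> x * \<tau> \<gamma> x)"

lemma DT_eq:
  assumes l: "l \<in> tng" and k: "k \<in> tng"
  shows "DT l k = lam (F x) * (kd l k - \<epsilon> * \<tau> l x * \<tau> k x) + (\<Sum>\<gamma>\<in>nor. \<eta> \<gamma> * \<theta> l k \<gamma> x * \<tau> \<gamma> x)"
  unfolding DT_def d_tau[OF x l tan_ind[OF k]] sum_ind kd_def using theta_parallel[OF l k] by simp

lemma DX_eq:
  assumes l: "l \<in> tng" and b: "\<beta> \<in> nor"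
  shows "DX \<beta> l = - lam (F x) * \<epsilon> * \<tau> l x * \<tau> \<beta> x - (\<Sum>p\<in>tng. \<theta> l p \<beta> x * \<tau> p x)"
proof -
  have "l \<noteq> \<beta>" using l b tan_nor by blast
  moreover have "(\<Sum>p\<in>tng. \<eta> p * \<theta> l \<beta> p x * \<tau> p x) = - (\<Sum>p\<in>tng. \<theta> l p \<beta> x * \<tau> p x)"
    unfolding sum_negf[symmetric]
    by (intro sum.cong refl) (use theta_skew[OF x l _ nor_ind[OF b]] tan_ind eta_tan in simp)
  ultimately show ?thesis unfolding DX_def d_tau[OF x l nor_ind[OF b]] sum_ind by simp
qed

text \<open>
  The covariant derivative in direction \<open>l\<close> of the right-hand side of the Codazzi equation.
\<close>

definition "cod \<beta> i j k l =
  - d l (\<lambda>y. rr (F y)) x * ((kd i j * \<tau> k x - kd k j * \<tau> i x) * \<tau> \<beta> x)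
  - rr (F x) * ((kd i j * DT l k - kd k j * DT l i) * \<tau> \<beta> x)
  - rr (F x) * ((kd i j * \<tau> k x - kd k j * \<tau> i x) * DX \<beta> l)"

lemma rrF_smooth: "smooth_on (\<lambda>y. rr (F y)) S"
  by (rule smooth_on_compose[OF S F rr_smooth FS])

lemma H4_codazzi:
  assumes i: "i \<in> tng" and j: "j \<in> tng" and k: "k \<in> tng" and l: "l \<in> tng" and b: "\<beta> \<in> nor"
  shows "H4 \<beta> i j k l - H4 \<beta> k j i l = cod \<beta> i j k l"
proof -
  let ?r = "\<lambda>y. rr (F y)"
  note ts = tau_smooth[OF tan_ind[OF i]] tau_smooth[OF tan_ind[OF k]] tau_smooth[OF nor_ind[OF b]]
  have D1: "((\<lambda>y. H3 \<beta> i j k y - H3 \<beta> k j i y) has_derivative (\<lambda>h. fd (H3 \<beta> i j k) x h - fd (H3 \<beta> k j i) x h)) (at x)"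
    by (intro has_derivative_diff smooth_on_has_derivative[OF H3_smooth x] i j k b)
  have D2: "((\<lambda>y. - (?r y * ((kd i j * \<tau> k y - kd k j * \<tau> i y) * \<tau> \<beta> y))) has_derivative
     (\<lambda>h. - (?r x * ((kd i j * \<tau> k x - kd k j * \<tau> i x) * fd (\<tau> \<beta>) x h + (kd i j * fd (\<tau> k) x h - kd k j * fd (\<tau> i) x h) * \<tau> \<beta> x)
       + fd ?r x h * ((kd i j * \<tau> k x - kd k j * \<tau> i x) * \<tau> \<beta> x)))) (at x)"
    by (intro has_derivative_minus has_derivative_mult has_derivative_diff has_derivative_mult_right
        smooth_on_has_derivative[OF _ x] rrF_smooth ts)
  have "((\<lambda>y. - (?r y * ((kd i j * \<tau> k y - kd k j * \<tau> i y) * \<tau> \<beta> y))) has_derivative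
     (\<lambda>h. fd (H3 \<beta> i j k) x h - fd (H3 \<beta> k j i) x h)) (at x)"
    by (rule has_derivative_transform_within_open[OF D1 S x]) (use codazzi i j k b in auto)
  from has_derivative_unique[OF this D2, THEN fun_cong, of "e l x"]
  have 1: "d l (H3 \<beta> i j k) x - d l (H3 \<beta> k j i) x =
     - (?r x * ((kd i j * \<tau> k x - kd k j * \<tau> i x) * d l (\<tau> \<beta>) x + (kd i j * DT l k - kd k j * DT l i) * \<tau> \<beta> x)
       + d l ?r x * ((kd i j * \<tau> k x - kd k j * \<tau> i x) * \<tau> \<beta> x))"
    by (simp add: DT_def)
  have 2: "(\<Sum>\<gamma>\<in>nor. \<eta> \<gamma> * \<theta> l \<beta> \<gamma> x * H3 \<gamma> i j k x) - (\<Sum>\<gamma>\<in>nor. \<eta> \<gamma> * \<theta> l \<beta> \<gamma> x * H3 \<gamma> k j i x)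
     = - rr (F x) * ((kd i j * \<tau> k x - kd k j * \<tau> i x) * (\<Sum>\<gamma>\<in>nor. \<eta> \<gamma> * \<theta> l \<beta> \<gamma> x * \<tau> \<gamma> x))"
    unfolding sum_subtractf[symmetric] sum_distrib_left right_diff_distrib[symmetric]
    by (intro sum.cong refl) (simp add: codazzi[OF x i j k])
  show ?thesis
    using 1 2 unfolding H4_def cod_def DX_def by (simp add: algebra_simps)
qed

text \<open>
  The curvature \<open>\<langle>R(e\<^sub>l, e\<^sub>k)e\<^sub>i, e\<^sub>p\<rangle>\<close> of the induced metric, given by the Gauss equation, and the resulting value of
  \<open>h\<^sup>\<beta>\<^sub>i\<^sub>j\<^sub>k\<^sub>l - h\<^sup>\<beta>\<^sub>i\<^sub>j\<^sub>l\<^sub>k\<close>.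
\<close>

definition "Rm l k i p = Rb l k i p x + (\<Sum>\<gamma>\<in>nor. \<eta> \<gamma> * (\<theta> k i \<gamma> x * \<theta> l p \<gamma> x - \<theta> l i \<gamma> x * \<theta> k p \<gamma> x))"

definition "ric \<beta> i j k l =
  - (\<Sum>\<gamma>\<in>nor. \<eta> \<gamma> * (\<Sum>p\<in>tng. \<theta> k p \<beta> x * \<theta> l p \<gamma> x - \<theta> l p \<beta> x * \<theta> k p \<gamma> x) * \<theta> i j \<gamma> x)
  - (\<Sum>p\<in>tng. Rm l k i p * \<theta> p j \<beta> x) - (\<Sum>p\<in>tng. Rm l k j p * \<theta> i p \<beta> x)"

lemma gauss:
  assumes i: "i \<in> tng" and p: "p \<in> tng" and k: "k \<in> tng" and l: "l \<in> tng"
  shows "d l (\<theta> k i p) x - d k (\<theta> l i p) x = Rm l k i p"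
proof -
  have "(\<Sum>\<gamma>\<in>nor. \<eta> \<gamma> * (\<theta> k i \<gamma> x * \<theta> l \<gamma> p x - \<theta> l i \<gamma> x * \<theta> k \<gamma> p x))
     = - (\<Sum>\<gamma>\<in>nor. \<eta> \<gamma> * (\<theta> k i \<gamma> x * \<theta> l p \<gamma> x - \<theta> l i \<gamma> x * \<theta> k p \<gamma> x))"
    unfolding sum_negf[symmetric]
    by (intro sum.cong refl)
       (use theta_skew[OF x l nor_ind tan_ind[OF p]] theta_skew[OF x k nor_ind tan_ind[OF p]] in \<open>simp add: algebra_simps\<close>)
  moreover have "(\<Sum>q\<in>tng. \<eta> q * (\<theta> k i q x * \<theta> l q p x - \<theta> l i q x * \<theta> k q p x)) = 0"
    by (simp add: theta_parallel i p k l)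
  moreover have "(\<Sum>j\<in>tng. (\<theta> l k j x - \<theta> k l j x) * \<theta> j i p x) = 0"
    by (simp add: theta_parallel k l)
  ultimately show ?thesis
    using structure_equation[OF x l k tan_ind[OF i] tan_ind[OF p]] unfolding sum_ind Rm_def by simp
qed

lemma normal_curvature:
  assumes b: "\<beta> \<in> nor" and c: "\<gamma> \<in> nor" and k: "k \<in> tng" and l: "l \<in> tng"
  shows "d l (\<theta> k \<beta> \<gamma>) x - d k (\<theta> l \<beta> \<gamma>) x =
    (\<Sum>p\<in>tng. \<theta> k p \<beta> x * \<theta> l p \<gamma> x - \<theta> l p \<beta> x * \<theta> k p \<gamma> x)
    - (\<Sum>\<delta>\<in>nor. \<eta> \<delta> * (\<theta> k \<beta> \<delta> x * \<theta> l \<delta> \<gamma> x - \<theta> l \<beta> \<delta> x * \<theta> k \<delta> \<gamma> x))"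
proof -
  have ne: "l \<noteq> \<beta>" "k \<noteq> \<beta>" "l \<noteq> \<gamma>" "k \<noteq> \<gamma>" using k l b c tan_nor by blast+
  have "Rb l k \<beta> \<gamma> x = 0" using ne by (simp add: Rb_def)
  moreover have "(\<Sum>p\<in>tng. \<eta> p * (\<theta> k \<beta> p x * \<theta> l p \<gamma> x - \<theta> l \<beta> p x * \<theta> k p \<gamma> x))
     = - (\<Sum>p\<in>tng. \<theta> k p \<beta> x * \<theta> l p \<gamma> x - \<theta> l p \<beta> x * \<theta> k p \<gamma> x)"
    unfolding sum_negf[symmetric]
    by (intro sum.cong refl)
       (use theta_skew[OF x l nor_ind[OF b] tan_ind] theta_skew[OF x k nor_ind[OF b] tan_ind] eta_tan in \<open>simp add: algebra_simps\<close>)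
  moreover have "(\<Sum>j\<in>tng. (\<theta> l k j x - \<theta> k l j x) * \<theta> j \<beta> \<gamma> x) = 0"
    by (simp add: theta_parallel k l)
  ultimately show ?thesis
    using structure_equation[OF x l k nor_ind[OF b] nor_ind[OF c]] unfolding sum_ind by simp
qed

lemma d_H3:
  assumes i: "i \<in> tng" and j: "j \<in> tng" and k: "k \<in> tng" and b: "\<beta> \<in> nor"
  shows "d l (H3 \<beta> i j k) x = d l (\<lambda>y. d k (\<theta> i j \<beta>) y) x
   - (\<Sum>\<gamma>\<in>nor. \<eta> \<gamma> * (\<theta> k \<beta> \<gamma> x * d l (\<theta> i j \<gamma>) x + d l (\<theta> k \<beta> \<gamma>) x * \<theta> i j \<gamma> x))
   - (\<Sum>p\<in>tng. d l (\<theta> k i p) x * \<theta> p j \<beta> x) - (\<Sum>p\<in>tng. d l (\<theta> k j p) x * \<theta> i p \<beta> x)"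
proof -
  have "((\<lambda>y. d k (\<theta> i j \<beta>) y - (\<Sum>\<gamma>\<in>nor. \<eta> \<gamma> * \<theta> k \<beta> \<gamma> y * \<theta> i j \<gamma> y)
     - (\<Sum>p\<in>tng. \<theta> k i p y * \<theta> p j \<beta> y) - (\<Sum>p\<in>tng. \<theta> k j p y * \<theta> i p \<beta> y)) has_derivative
     (\<lambda>h. fd (\<lambda>y. d k (\<theta> i j \<beta>) y) x h
        - (\<Sum>\<gamma>\<in>nor. \<eta> \<gamma> * \<theta> k \<beta> \<gamma> x * fd (\<theta> i j \<gamma>) x h + \<eta> \<gamma> * fd (\<theta> k \<beta> \<gamma>) x h * \<theta> i j \<gamma> x)
        - (\<Sum>p\<in>tng. \<theta> k i p x * fd (\<theta> p j \<beta>) x h + fd (\<theta> k i p) x h * \<theta> p j \<beta> x)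
        - (\<Sum>p\<in>tng. \<theta> k j p x * fd (\<theta> i p \<beta>) x h + fd (\<theta> k j p) x h * \<theta> i p \<beta> x))) (at x)"
    by (intro has_derivative_diff has_derivative_sum has_derivative_mult has_derivative_mult_right
        smooth_on_has_derivative[OF _ x])
       (use i j k b in \<open>auto intro!: theta_smooth d_smooth intro: tan_ind nor_ind\<close>)
  from fd_eqI[OF this] show ?thesis
    unfolding H3_def[abs_def] by (simp add: theta_parallel i j k algebra_simps)
qed

lemma H3_base:
  assumes i: "i \<in> tng" and j: "j \<in> tng" and k: "k \<in> tng"
  shows "H3 \<beta> i j k x = d k (\<theta> i j \<beta>) x - (\<Sum>\<gamma>\<in>nor. \<eta> \<gamma> * \<theta> k \<beta> \<gamma> x * \<theta> i j \<gamma> x)"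
  by (simp add: H3_def theta_parallel i j k)

text \<open>
  The second derivatives of \<open>h\<close> commute at the base point, since the brackets of the frame vanish there. The
  products of first derivatives with connection forms are symmetric in \<open>k\<close> and \<open>l\<close>, and the products of two
  normal connection forms cancel against those in the normal curvature.
\<close>

lemma H4_ricci:
  assumes i: "i \<in> tng" and j: "j \<in> tng" and k: "k \<in> tng" and l: "l \<in> tng" and b: "\<beta> \<in> nor"
  shows "H4 \<beta> i j k l - H4 \<beta> i j l k = ric \<beta> i j k l"
proof -
  let ?h = "\<lambda>\<gamma>. \<theta> i j \<gamma> x"
  let ?w = "\<lambda>k \<beta> \<gamma>. \<theta> k \<beta> \<gamma> x"
  let ?W = "\<lambda>k l. \<Sum>\<gamma>\<in>nor. \<eta> \<gamma> * ?w l \<beta> \<gamma> * (\<Sum>\<delta>\<in>nor. \<eta> \<delta> * ?w k \<gamma> \<delta> * ?h \<delta>)"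
  let ?M = "\<lambda>k l. \<Sum>\<gamma>\<in>nor. \<eta> \<gamma> * (?w k \<beta> \<gamma> * d l (\<theta> i j \<gamma>) x)"
  let ?D = "\<lambda>k l. \<Sum>\<gamma>\<in>nor. \<eta> \<gamma> * (d l (\<theta> k \<beta> \<gamma>) x * ?h \<gamma>)"
  let ?A = "\<lambda>k l. \<Sum>p\<in>tng. d l (\<theta> k i p) x * \<theta> p j \<beta> x"
  let ?B = "\<lambda>k l. \<Sum>p\<in>tng. d l (\<theta> k j p) x * \<theta> i p \<beta> x"
  have H4: "H4 \<beta> i j k l = d l (\<lambda>y. d k (\<theta> i j \<beta>) y) x - ?M k l - ?D k l - ?A k l - ?B k l - ?M l k + ?W k l"
    if k: "k \<in> tng" and l: "l \<in> tng" for k l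
    unfolding H4_def d_H3[OF i j k b] H3_base[OF i j k]
    by (simp add: right_diff_distrib sum_subtractf distrib_left sum.distrib mult.assoc)
  have com: "d l (\<lambda>y. d k (\<theta> i j \<beta>) y) x = d k (\<lambda>y. d l (\<theta> i j \<beta>) y) x"
    using d_commutator[OF x l k theta_smooth[OF i tan_ind[OF j] nor_ind[OF b]]] theta_parallel[OF l k] theta_parallel[OF k l]
    by simp
  have W: "?W k l = (\<Sum>\<delta>\<in>nor. \<Sum>\<gamma>\<in>nor. \<eta> \<delta> * \<eta> \<gamma> * ?w l \<beta> \<gamma> * ?w k \<gamma> \<delta> * ?h \<delta>)" for k l
    by (subst sum.swap) (simp add: sum_distrib_left mult_ac)
  have "?D k l - ?D l k = (\<Sum>\<delta>\<in>nor. \<eta> \<delta> * ((d l (\<theta> k \<beta> \<delta>) x - d k (\<theta> l \<beta> \<delta>) x) * ?h \<delta>))"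
    unfolding sum_subtractf[symmetric] by (intro sum.cong refl) (simp add: algebra_simps)
  also have "\<dots> = (\<Sum>\<delta>\<in>nor. \<eta> \<delta> * (((\<Sum>p\<in>tng. \<theta> k p \<beta> x * \<theta> l p \<delta> x - \<theta> l p \<beta> x * \<theta> k p \<delta> x)
       - (\<Sum>\<gamma>\<in>nor. \<eta> \<gamma> * (?w k \<beta> \<gamma> * ?w l \<gamma> \<delta> - ?w l \<beta> \<gamma> * ?w k \<gamma> \<delta>))) * ?h \<delta>))"
    by (intro sum.cong refl) (simp add: normal_curvature[OF b _ k l])
  also have "\<dots> = (\<Sum>\<delta>\<in>nor. \<eta> \<delta> * (\<Sum>p\<in>tng. \<theta> k p \<beta> x * \<theta> l p \<delta> x - \<theta> l p \<beta> x * \<theta> k p \<delta> x) * ?h \<delta>)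
       - (?W l k - ?W k l)"
    unfolding W sum_subtractf[symmetric]
    by (intro sum.cong refl) (simp add: left_diff_distrib right_diff_distrib sum_subtractf sum_distrib_left sum_distrib_right mult_ac)
  finally have D: "?D k l - ?D l k = \<dots>" .
  have A: "?A k l - ?A l k = (\<Sum>p\<in>tng. Rm l k i p * \<theta> p j \<beta> x)"
    unfolding sum_subtractf[symmetric] by (intro sum.cong refl) (simp add: gauss[OF i _ k l, symmetric] algebra_simps)
  have B: "?B k l - ?B l k = (\<Sum>p\<in>tng. Rm l k j p * \<theta> i p \<beta> x)"
    unfolding sum_subtractf[symmetric] by (intro sum.cong refl) (simp add: gauss[OF j _ k l, symmetric] algebra_simps)
  show ?thesis
    unfolding H4[OF k l] H4[OF l k] ric_def using com A B D by linarith
qed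

text \<open>
  Codazzi, Ricci, Codazzi: \<open>h\<^sub>i\<^sub>j\<^sub>k\<^sub>k \<rightarrow> h\<^sub>k\<^sub>j\<^sub>i\<^sub>k \<rightarrow> h\<^sub>k\<^sub>j\<^sub>k\<^sub>i = h\<^sub>j\<^sub>k\<^sub>k\<^sub>i \<rightarrow> h\<^sub>k\<^sub>k\<^sub>j\<^sub>i\<close>.
\<close>

lemma H4_commute:
  assumes i: "i \<in> tng" and j: "j \<in> tng" and k: "k \<in> tng" and b: "\<beta> \<in> nor"
  shows "H4 \<beta> i j k k = H4 \<beta> k k j i + cod \<beta> i j k k + cod \<beta> j k k i + ric \<beta> k j i k"
  using H4_codazzi[OF i j k k b] H4_ricci[OF k j i k b] H4_sym[OF k j k i b] H4_codazzi[OF j k k i b] by simp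

definition "sq_norm y = (\<Sum>\<beta>\<in>nor. \<Sum>i\<in>tng. \<Sum>j\<in>tng. (\<theta> i j \<beta> y)\<^sup>2)"

lemma sq_norm_smooth: "smooth_on sq_norm S"
  unfolding sq_norm_def[abs_def] power2_eq_square
  by (intro smooth_on_sum smooth_on_mult S) (auto intro!: theta_smooth intro: tan_ind nor_ind)

lemma dd_sq_norm:
  assumes k: "k \<in> tng"
  shows "d k (\<lambda>y. d k sq_norm y) x = 2 * (\<Sum>\<beta>\<in>nor. \<Sum>i\<in>tng. \<Sum>j\<in>tng. (d k (\<theta> i j \<beta>) x)\<^sup>2 + \<theta> i j \<beta> x * d k (\<lambda>y. d k (\<theta> i j \<beta>) y) x)"
proof -
  have 1: "d k sq_norm y = (\<Sum>\<beta>\<in>nor. \<Sum>i\<in>tng. \<Sum>j\<in>tng. 2 * (\<theta> i j \<beta> y * d k (\<theta> i j \<beta>) y))" if y: "y \<in> S" for y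
  proof -
    have "(sq_norm has_derivative (\<lambda>h. \<Sum>\<beta>\<in>nor. \<Sum>i\<in>tng. \<Sum>j\<in>tng. \<theta> i j \<beta> y * fd (\<theta> i j \<beta>) y h + fd (\<theta> i j \<beta>) y h * \<theta> i j \<beta> y)) (at y)"
      unfolding sq_norm_def[abs_def] power2_eq_square
      by (intro has_derivative_sum has_derivative_mult smooth_on_has_derivative[OF _ y])
         (auto intro!: theta_smooth intro: tan_ind nor_ind)
    from fd_eqI[OF this] show ?thesis by (simp add: mult.commute[of "fd _ _ _"])
  qed
  have "((\<lambda>y. \<Sum>\<beta>\<in>nor. \<Sum>i\<in>tng. \<Sum>j\<in>tng. 2 * (\<theta> i j \<beta> y * d k (\<theta> i j \<beta>) y)) has_derivative
     (\<lambda>h. \<Sum>\<beta>\<in>nor. \<Sum>i\<in>tng. \<Sum>j\<in>tng. 2 * (\<theta> i j \<beta> x * fd (\<lambda>y. d k (\<theta> i j \<beta>) y) x h + fd (\<theta> i j \<beta>) x h * d k (\<theta> i j \<beta>) x))) (at x)"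
    by (intro has_derivative_sum has_derivative_mult_right has_derivative_mult smooth_on_has_derivative[OF _ x])
       (use k in \<open>auto intro!: theta_smooth d_smooth intro: tan_ind nor_ind\<close>)
  then have "((\<lambda>y. d k sq_norm y) has_derivative
     (\<lambda>h. \<Sum>\<beta>\<in>nor. \<Sum>i\<in>tng. \<Sum>j\<in>tng. 2 * (\<theta> i j \<beta> x * fd (\<lambda>y. d k (\<theta> i j \<beta>) y) x h + fd (\<theta> i j \<beta>) x h * d k (\<theta> i j \<beta>) x))) (at x)"
    by (rule has_derivative_transform_within_open[OF _ S x]) (simp add: 1)
  from fd_eqI[OF this] show ?thesis by (simp add: sum_distrib_left power2_eq_square algebra_simps)
qed

text \<open>
  Write \<open>W\<close> for the matrix \<open>\<eta>\<^sub>\<gamma> \<theta> k \<beta> \<gamma>\<close> of the normal connection at the point. Since it does not mix signs, it is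
  skew. The derivative of \<open>h\<close> is \<open>\<nabla>h + W h\<close>, and the excess of \<open>|\<nabla>h + W h|\<^sup>2\<close> over \<open>|\<nabla>h|\<^sup>2\<close> is
  cancelled by the terms with \<open>W\<close> in \<open>\<langle>h, \<nabla>\<^sup>2h\<rangle>\<close>. The derivatives of connection forms in \<open>\<nabla>\<^sup>2h\<close>
  are skew and are contracted with a symmetric matrix.
\<close>

lemma laplacian_sq_norm:
  assumes w0: "\<And>\<beta> \<gamma> k. \<beta> \<in> nor \<Longrightarrow> \<gamma> \<in> nor \<Longrightarrow> sg \<beta> \<noteq> sg \<gamma> \<Longrightarrow> k \<in> tng \<Longrightarrow> \<theta> k \<beta> \<gamma> x = 0"
    and dw0: "\<And>\<beta> \<gamma>. \<beta> \<in> nor \<Longrightarrow> \<gamma> \<in> nor \<Longrightarrow> sg \<beta> \<noteq> sg \<gamma> \<Longrightarrow> (\<Sum>k\<in>tng. d k (\<theta> k \<beta> \<gamma>) x) = 0"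
  shows "1/2 * (\<Sum>k\<in>tng. d k (\<lambda>y. d k sq_norm y) x) =
     (\<Sum>\<beta>\<in>nor. \<Sum>i\<in>tng. \<Sum>j\<in>tng. \<Sum>k\<in>tng. \<theta> i j \<beta> x * H4 \<beta> i j k k)
     + (\<Sum>\<beta>\<in>nor. \<Sum>i\<in>tng. \<Sum>j\<in>tng. \<Sum>k\<in>tng. (H3 \<beta> i j k x)\<^sup>2)"
proof -
  let ?h = "\<lambda>\<beta> i j. \<theta> i j \<beta> x" and ?a = "\<lambda>\<beta> i j k. d k (\<theta> i j \<beta>) x"
  let ?H = "\<lambda>\<beta> i j k. H3 \<beta> i j k x"
  define W where "W k \<beta> \<gamma> = \<eta> \<gamma> * \<theta> k \<beta> \<gamma> x" for k \<beta> \<gamma>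
  define D where "D \<beta> \<gamma> = \<eta> \<gamma> * (\<Sum>k\<in>tng. d k (\<theta> k \<beta> \<gamma>) x)" for \<beta> \<gamma>
  have Wskew: "W k \<beta> \<gamma> = - W k \<gamma> \<beta>" if "k \<in> tng" "\<beta> \<in> nor" "\<gamma> \<in> nor" for k \<beta> \<gamma>
    using w0[of \<beta> \<gamma> k] w0[of \<gamma> \<beta> k] theta_skew[OF x that(1) nor_ind[OF that(2)] nor_ind[OF that(3)]] that
    by (cases "sg \<beta> = sg \<gamma>") (simp_all add: W_def eta_nor)
  have Dskew: "D \<beta> \<gamma> = - D \<gamma> \<beta>" if "\<beta> \<in> nor" "\<gamma> \<in> nor" for \<beta> \<gamma>
  proof (cases "sg \<beta> = sg \<gamma>")
    case True
    have "(\<Sum>k\<in>tng. d k (\<theta> k \<beta> \<gamma>) x) = - (\<Sum>k\<in>tng. d k (\<theta> k \<gamma> \<beta>) x)"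
      unfolding sum_negf[symmetric] by (intro sum.cong refl theta_skew_fd[OF x] nor_ind that)
    then show ?thesis using True that by (simp add: D_def eta_nor)
  next
    case False
    then show ?thesis using dw0[of \<beta> \<gamma>] dw0[of \<gamma> \<beta>] that by (simp add: D_def)
  qed
  have a: "?a \<beta> i j k = ?H \<beta> i j k + (\<Sum>\<gamma>\<in>nor. W k \<beta> \<gamma> * ?h \<gamma> i j)" if "i \<in> tng" "j \<in> tng" "k \<in> tng" for \<beta> i j k
    using H3_base[OF that, of \<beta>] by (simp add: W_def)
  have sq: "(\<Sum>\<beta>\<in>nor. (?a \<beta> i j k)\<^sup>2) = (\<Sum>\<beta>\<in>nor. (?H \<beta> i j k)\<^sup>2)
      - (\<Sum>\<beta>\<in>nor. ?h \<beta> i j * (\<Sum>\<gamma>\<in>nor. W k \<beta> \<gamma> * (?a \<gamma> i j k + ?H \<gamma> i j k)))"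
    if ijk: "i \<in> tng" "j \<in> tng" "k \<in> tng" for i j k
  proof -
    have "(\<Sum>\<beta>\<in>nor. (?a \<beta> i j k)\<^sup>2) - (\<Sum>\<beta>\<in>nor. (?H \<beta> i j k)\<^sup>2)
      = (\<Sum>\<beta>\<in>nor. \<Sum>\<gamma>\<in>nor. W k \<beta> \<gamma> * ?h \<gamma> i j * (?a \<beta> i j k + ?H \<beta> i j k))"
      unfolding sum_subtractf[symmetric] sum_distrib_right[symmetric]
      by (intro sum.cong refl) (simp add: a[OF ijk] power2_eq_square algebra_simps)
    also have "\<dots> = (\<Sum>\<gamma>\<in>nor. \<Sum>\<beta>\<in>nor. W k \<beta> \<gamma> * ?h \<gamma> i j * (?a \<beta> i j k + ?H \<beta> i j k))"
      by (rule sum.swap)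
    also have "\<dots> = (\<Sum>\<gamma>\<in>nor. \<Sum>\<beta>\<in>nor. - (?h \<gamma> i j * (W k \<gamma> \<beta> * (?a \<beta> i j k + ?H \<beta> i j k))))"
      by (intro sum.cong refl, subst Wskew[OF ijk(3)]) (simp_all add: algebra_simps)
    finally show ?thesis by (simp add: sum_negf sum_distrib_left)
  qed
  have skew_dg: "(\<Sum>i\<in>tng. \<Sum>j\<in>tng. ?h \<beta> i j * (\<Sum>p\<in>tng. d k (\<theta> k i p) x * ?h \<beta> p j)) = 0" (is "?L = 0")
    if "k \<in> tng" "\<beta> \<in> nor" for k \<beta>
  proof -
    have "?L = (\<Sum>i\<in>tng. \<Sum>p\<in>tng. (\<Sum>j\<in>tng. ?h \<beta> i j * ?h \<beta> p j) * d k (\<theta> k i p) x)"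
      unfolding sum_distrib_left sum_distrib_right
      by (rule sum.cong[OF refl], subst sum.swap) (simp add: mult_ac)
    also have "\<dots> = 0"
      by (rule sum_symmetric_skew_zero[OF _ theta_skew_fd[OF x that(1) tan_ind tan_ind]]) (simp_all add: mult.commute)
    finally show ?thesis .
  qed
  have skew_dg': "(\<Sum>i\<in>tng. \<Sum>j\<in>tng. ?h \<beta> i j * (\<Sum>p\<in>tng. d k (\<theta> k j p) x * ?h \<beta> i p)) = 0"
    if "k \<in> tng" "\<beta> \<in> nor" for k \<beta>
  proof -
    have "(\<Sum>i\<in>tng. \<Sum>j\<in>tng. ?h \<beta> i j * (\<Sum>p\<in>tng. d k (\<theta> k j p) x * ?h \<beta> i p))
       = (\<Sum>j\<in>tng. \<Sum>i\<in>tng. ?h \<beta> j i * (\<Sum>p\<in>tng. d k (\<theta> k j p) x * ?h \<beta> p i))"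
      by (subst sum.swap) (use theta_sym[OF x _ _ that(2)] in simp)
    then show ?thesis using skew_dg[OF that] by simp
  qed
  have skew_dw: "(\<Sum>\<beta>\<in>nor. ?h \<beta> i j * (\<Sum>\<gamma>\<in>nor. D \<beta> \<gamma> * ?h \<gamma> i j)) = 0" (is "?L = 0") for i j
  proof -
    have "?L = (\<Sum>\<beta>\<in>nor. \<Sum>\<gamma>\<in>nor. (?h \<beta> i j * ?h \<gamma> i j) * D \<beta> \<gamma>)" by (simp add: sum_distrib_left mult_ac)
    also have "\<dots> = 0" by (rule sum_symmetric_skew_zero[OF _ Dskew]) (simp_all add: mult.commute)
    finally show ?thesis .
  qed
  have H4: "H4 \<beta> i j k k = d k (\<lambda>y. d k (\<theta> i j \<beta>) y) x
      - (\<Sum>\<gamma>\<in>nor. W k \<beta> \<gamma> * (?a \<gamma> i j k + ?H \<gamma> i j k))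
      - (\<Sum>\<gamma>\<in>nor. \<eta> \<gamma> * d k (\<theta> k \<beta> \<gamma>) x * ?h \<gamma> i j)
      - (\<Sum>p\<in>tng. d k (\<theta> k i p) x * ?h \<beta> p j) - (\<Sum>p\<in>tng. d k (\<theta> k j p) x * ?h \<beta> i p)"
    if "i \<in> tng" "j \<in> tng" "k \<in> tng" "\<beta> \<in> nor" for \<beta> i j k
    unfolding H4_def d_H3[OF that] W_def by (simp add: sum.distrib algebra_simps)
  have "(\<Sum>\<beta>\<in>nor. \<Sum>i\<in>tng. \<Sum>j\<in>tng. \<Sum>k\<in>tng. ?h \<beta> i j * H4 \<beta> i j k k)
    = (\<Sum>\<beta>\<in>nor. \<Sum>i\<in>tng. \<Sum>j\<in>tng. \<Sum>k\<in>tng. ?h \<beta> i j * d k (\<lambda>y. d k (\<theta> i j \<beta>) y) x)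
    - (\<Sum>\<beta>\<in>nor. \<Sum>i\<in>tng. \<Sum>j\<in>tng. \<Sum>k\<in>tng. ?h \<beta> i j * (\<Sum>\<gamma>\<in>nor. W k \<beta> \<gamma> * (?a \<gamma> i j k + ?H \<gamma> i j k)))
    - (\<Sum>\<beta>\<in>nor. \<Sum>i\<in>tng. \<Sum>j\<in>tng. \<Sum>k\<in>tng. ?h \<beta> i j * (\<Sum>\<gamma>\<in>nor. \<eta> \<gamma> * d k (\<theta> k \<beta> \<gamma>) x * ?h \<gamma> i j))
    - (\<Sum>\<beta>\<in>nor. \<Sum>i\<in>tng. \<Sum>j\<in>tng. \<Sum>k\<in>tng. ?h \<beta> i j * (\<Sum>p\<in>tng. d k (\<theta> k i p) x * ?h \<beta> p j))
    - (\<Sum>\<beta>\<in>nor. \<Sum>i\<in>tng. \<Sum>j\<in>tng. \<Sum>k\<in>tng. ?h \<beta> i j * (\<Sum>p\<in>tng. d k (\<theta> k j p) x * ?h \<beta> i p))"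
    (is "_ = ?A - ?B - ?C - ?E - ?G")
    unfolding sum_subtractf[symmetric] right_diff_distrib[symmetric]
    by (intro sum.cong refl) (simp add: H4)
  moreover have "?C = 0"
  proof -
    have CD: "(\<Sum>k\<in>tng. \<Sum>\<gamma>\<in>nor. \<eta> \<gamma> * d k (\<theta> k \<beta> \<gamma>) x * ?h \<gamma> i j) = (\<Sum>\<gamma>\<in>nor. D \<beta> \<gamma> * ?h \<gamma> i j)"
      for \<beta> i j by (subst sum.swap) (simp add: D_def sum_distrib_left sum_distrib_right)
    have "?C = (\<Sum>\<beta>\<in>nor. \<Sum>i\<in>tng. \<Sum>j\<in>tng. ?h \<beta> i j * (\<Sum>\<gamma>\<in>nor. D \<beta> \<gamma> * ?h \<gamma> i j))"
      unfolding sum_distrib_left[symmetric] CD ..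
    also have "\<dots> = (\<Sum>i\<in>tng. \<Sum>j\<in>tng. \<Sum>\<beta>\<in>nor. ?h \<beta> i j * (\<Sum>\<gamma>\<in>nor. D \<beta> \<gamma> * ?h \<gamma> i j))"
      by (rule trans[OF sum.swap], rule sum.cong[OF refl], rule sum.swap)
    finally show ?thesis by (simp add: skew_dw)
  qed
  moreover have k_last: "(\<Sum>\<beta>\<in>nor. \<Sum>i\<in>tng. \<Sum>j\<in>tng. \<Sum>k\<in>tng. f \<beta> i j k) = (\<Sum>k\<in>tng. \<Sum>\<beta>\<in>nor. \<Sum>i\<in>tng. \<Sum>j\<in>tng. f \<beta> i j k)"
    for f :: "nat \<Rightarrow> nat \<Rightarrow> nat \<Rightarrow> nat \<Rightarrow> real"
  proof -
    have "(\<Sum>\<beta>\<in>nor. \<Sum>i\<in>tng. \<Sum>j\<in>tng. \<Sum>k\<in>tng. f \<beta> i j k) = (\<Sum>\<beta>\<in>nor. \<Sum>i\<in>tng. \<Sum>k\<in>tng. \<Sum>j\<in>tng. f \<beta> i j k)"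
      by (rule sum.cong[OF refl], rule sum.cong[OF refl], rule sum.swap)
    also have "\<dots> = (\<Sum>\<beta>\<in>nor. \<Sum>k\<in>tng. \<Sum>i\<in>tng. \<Sum>j\<in>tng. f \<beta> i j k)"
      by (rule sum.cong[OF refl], rule sum.swap)
    also have "\<dots> = (\<Sum>k\<in>tng. \<Sum>\<beta>\<in>nor. \<Sum>i\<in>tng. \<Sum>j\<in>tng. f \<beta> i j k)" by (rule sum.swap)
    finally show ?thesis .
  qed
  moreover have "?E = 0" "?G = 0"
    unfolding k_last by (simp_all add: skew_dg skew_dg')
  moreover have "(\<Sum>\<beta>\<in>nor. \<Sum>i\<in>tng. \<Sum>j\<in>tng. \<Sum>k\<in>tng. (?a \<beta> i j k)\<^sup>2)
    = (\<Sum>\<beta>\<in>nor. \<Sum>i\<in>tng. \<Sum>j\<in>tng. \<Sum>k\<in>tng. (?H \<beta> i j k)\<^sup>2) - ?B"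
  proof -
    have first: "(\<Sum>\<beta>\<in>nor. \<Sum>i\<in>tng. \<Sum>j\<in>tng. \<Sum>k\<in>tng. f \<beta> i j k) = (\<Sum>i\<in>tng. \<Sum>j\<in>tng. \<Sum>k\<in>tng. \<Sum>\<beta>\<in>nor. f \<beta> i j k)"
      for f :: "nat \<Rightarrow> nat \<Rightarrow> nat \<Rightarrow> nat \<Rightarrow> real"
      by (rule trans[OF sum.swap], rule sum.cong[OF refl], rule trans[OF sum.swap], rule sum.cong[OF refl], rule sum.swap)
    show ?thesis
      unfolding first sum_subtractf[symmetric]
      by (rule sum.cong[OF refl], rule sum.cong[OF refl], rule sum.cong[OF refl])
         (rule sq[unfolded sum_subtractf[symmetric]])
  qed
  moreover have "1/2 * (\<Sum>k\<in>tng. d k (\<lambda>y. d k sq_norm y) x)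
     = (\<Sum>\<beta>\<in>nor. \<Sum>i\<in>tng. \<Sum>j\<in>tng. \<Sum>k\<in>tng. (?a \<beta> i j k)\<^sup>2) + ?A"
    unfolding k_last sum.distrib[symmetric] sum_distrib_left
    by (intro sum.cong refl) (simp add: dd_sq_norm sum.distrib)
  ultimately show ?thesis by linarith
qed

end

section \<open>Traces of products of symmetric matrices\<close>

text \<open>Matrices are functions of two indices, of which only the values on the index set \<open>J\<close> matter.\<close>

definition mm :: "nat set \<Rightarrow> (nat \<Rightarrow> nat \<Rightarrow> real) \<Rightarrow> (nat \<Rightarrow> nat \<Rightarrow> real) \<Rightarrow> nat \<Rightarrow> nat \<Rightarrow> real" where
  "mm J A B i j = (\<Sum>k\<in>J. A i k * B k j)"

definition mtr :: "nat set \<Rightarrow> (nat \<Rightarrow> nat \<Rightarrow> real) \<Rightarrow> real" where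
  "mtr J A = (\<Sum>i\<in>J. A i i)"

lemma mm_assoc: "mm J (mm J A B) C = mm J A (mm J B C)"
proof (intro ext)
  fix i j
  have "mm J (mm J A B) C i j = (\<Sum>l\<in>J. \<Sum>k\<in>J. A i k * B k l * C l j)"
    by (simp add: mm_def sum_distrib_right)
  also have "\<dots> = (\<Sum>k\<in>J. \<Sum>l\<in>J. A i k * B k l * C l j)" by (rule sum.swap)
  finally show "mm J (mm J A B) C i j = mm J A (mm J B C) i j"
    by (simp add: mm_def sum_distrib_left mult.assoc)
qed

lemma mtr_mm_commute: "mtr J (mm J A B) = mtr J (mm J B A)"
  unfolding mtr_def mm_def by (subst sum.swap) (simp add: mult.commute)

lemma mtr_commutator_sq:
  "mtr J (mm J (\<lambda>i j. mm J A B i j - mm J B A i j) (\<lambda>i j. mm J A B i j - mm J B A i j)) =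
   2 * mtr J (mm J A (mm J B (mm J A B))) - 2 * mtr J (mm J A (mm J A (mm J B B)))"
proof -
  have d: "mm J (\<lambda>i j. P i j - Q i j) R = (\<lambda>i j. mm J P R i j - mm J Q R i j)"
    "mm J R (\<lambda>i j. P i j - Q i j) = (\<lambda>i j. mm J R P i j - mm J R Q i j)" for P Q R
    by (intro ext, simp add: mm_def left_diff_distrib sum_subtractf)
       (intro ext, simp add: mm_def right_diff_distrib sum_subtractf)
  have t: "mtr J (\<lambda>i j. P i j - Q i j) = mtr J P - mtr J Q" for P Q
    by (simp add: mtr_def sum_subtractf)
  have 1: "mtr J (mm J A (mm J B (mm J B A))) = mtr J (mm J A (mm J A (mm J B B)))"
    using mtr_mm_commute[of J "mm J A (mm J B B)" A] by (simp add: mm_assoc)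
  have 2: "mtr J (mm J B (mm J A (mm J A B))) = mtr J (mm J A (mm J A (mm J B B)))"
    using mtr_mm_commute[of J B "mm J A (mm J A B)"] by (simp add: mm_assoc)
  have 3: "mtr J (mm J B (mm J A (mm J B A))) = mtr J (mm J A (mm J B (mm J A B)))"
    using mtr_mm_commute[of J B "mm J A (mm J B A)"] by (simp add: mm_assoc)
  show ?thesis by (simp add: d t mm_assoc 1 2 3)
qed

lemma kd_sum:
  assumes "finite J" "i \<in> J"
  shows "(\<Sum>j\<in>J. kd i j * f j) = f i" "(\<Sum>j\<in>J. kd j i * f j) = f i"
proof -
  have "(\<Sum>j\<in>J. kd i j * f j) = (\<Sum>j\<in>J. if i = j then f j else 0)"
    "(\<Sum>j\<in>J. kd j i * f j) = (\<Sum>j\<in>J. if j = i then f j else 0)"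
    by (intro sum.cong refl; simp add: kd_def)+
  then show "(\<Sum>j\<in>J. kd i j * f j) = f i" "(\<Sum>j\<in>J. kd j i * f j) = f i"
    using assms by simp_all
qed

text \<open>
  The quadratic expression in \<open>h\<close> through which the curvature of the tangent bundle enters the contracted Ricci
  identity. It is linear in the curvature tensor \<open>X\<close>, so the three parts of the Gauss equation can be
  treated separately.
\<close>

definition curv_contraction :: "nat set \<Rightarrow> (nat \<Rightarrow> nat \<Rightarrow> real) \<Rightarrow> (nat \<Rightarrow> nat \<Rightarrow> nat \<Rightarrow> nat \<Rightarrow> real) \<Rightarrow> real" where
  "curv_contraction J h X = (\<Sum>i\<in>J. \<Sum>j\<in>J. \<Sum>k\<in>J. h i j * ((\<Sum>p\<in>J. X k i k p * h p j) + (\<Sum>p\<in>J. X k i j p * h k p)))"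

lemma curv_contraction_add:
  "curv_contraction J h (\<lambda>l k i p. X l k i p + Y l k i p) = curv_contraction J h X + curv_contraction J h Y"
  by (simp add: curv_contraction_def algebra_simps sum.distrib)

lemma curv_contraction_scale:
  "curv_contraction J h (\<lambda>l k i p. c * X l k i p) = c * curv_contraction J h X"
  by (simp add: curv_contraction_def sum_distrib_left algebra_simps)

lemma curv_contraction_sum:
  "curv_contraction J h (\<lambda>l k i p. \<Sum>\<gamma>\<in>K. X \<gamma> l k i p) = (\<Sum>\<gamma>\<in>K. curv_contraction J h (X \<gamma>))"
proof (induction K rule: infinite_finite_induct)
  case (insert \<gamma> K)
  then show ?case by (simp add: curv_contraction_add)
qed (simp_all add: curv_contraction_def)

lemma sum_rotate3: "(\<Sum>i\<in>(J::nat set). \<Sum>j\<in>J. \<Sum>k\<in>J. f i j k) = (\<Sum>k\<in>J. \<Sum>i\<in>J. \<Sum>j\<in>J. f i j k)" for f :: "nat \<Rightarrow> nat \<Rightarrow> nat \<Rightarrow> real"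
  by (rule trans[OF sum.cong[OF refl sum.swap]], rule sum.swap)

context
  fixes J :: "nat set" and h :: "nat \<Rightarrow> nat \<Rightarrow> real" and u :: "nat \<Rightarrow> real"
  assumes J: "finite J" and hs: "\<And>i j. i \<in> J \<Longrightarrow> j \<in> J \<Longrightarrow> h i j = h j i"
begin

lemma curv_contraction_constant:
  "curv_contraction J h (\<lambda>l k i p. kd k i * kd l p - kd l i * kd k p) =
    (mtr J h)\<^sup>2 - real (card J) * mtr J (mm J h h)"
proof -
  note kd = kd_sum[OF J]
  have 1: "(\<Sum>k\<in>J. \<Sum>p\<in>J. (kd i k * kd k p - kd k k * kd i p) * h p j) = (1 - real (card J)) * h i j"
    if "i \<in> J" "j \<in> J" for i j
    by (simp add: left_diff_distrib sum_subtractf mult.assoc sum_distrib_left[symmetric] kd that)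
       (simp add: kd_def)
  have 2: "(\<Sum>k\<in>J. \<Sum>p\<in>J. (kd i j * kd k p - kd k j * kd i p) * h k p) = kd i j * mtr J h - h i j"
    if "i \<in> J" "j \<in> J" for i j
    by (simp add: left_diff_distrib sum_subtractf mult.assoc sum_distrib_left[symmetric] kd that mtr_def hs[of j i])
  have "curv_contraction J h (\<lambda>l k i p. kd k i * kd l p - kd l i * kd k p) =
    (\<Sum>i\<in>J. \<Sum>j\<in>J. h i j * ((1 - real (card J)) * h i j + (kd i j * mtr J h - h i j)))"
    unfolding curv_contraction_def sum_distrib_left[symmetric] sum.distrib
    by (intro sum.cong refl) (simp add: 1 2)
  also have "\<dots> = (\<Sum>i\<in>J. (\<Sum>j\<in>J. kd i j * h i j)) * mtr J h - real (card J) * (\<Sum>i\<in>J. \<Sum>j\<in>J. h i j * h i j)"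
    by (simp add: algebra_simps sum.distrib sum_subtractf sum_distrib_left sum_distrib_right)
  also have "\<dots> = (mtr J h)\<^sup>2 - real (card J) * mtr J (mm J h h)"
    by (simp add: kd power2_eq_square) (simp add: mtr_def mm_def hs cong: sum.cong)
  finally show ?thesis .
qed

lemma curv_contraction_warping:
  "curv_contraction J h (\<lambda>l k i p. kd k i * u l * u p - kd l i * u k * u p + u k * u i * kd l p - u l * u i * kd k p) =
    2 * mtr J h * (\<Sum>i\<in>J. u i * (\<Sum>j\<in>J. h i j * u j)) - real (card J) * (\<Sum>i\<in>J. (\<Sum>j\<in>J. h i j * u j)\<^sup>2)
    - (\<Sum>i\<in>J. (u i)\<^sup>2) * mtr J (mm J h h)"
proof -
  note kd = kd_sum[OF J]
  define v where "v i = (\<Sum>j\<in>J. h i j * u j)" for i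
  have v: "(\<Sum>p\<in>J. h p j * u p) = v j" if "j \<in> J" for j
    unfolding v_def by (intro sum.cong refl) (simp add: hs that)
  define q0 where "q0 = (\<Sum>i\<in>J. u i * v i)"
  define u2 where "u2 = (\<Sum>i\<in>J. (u i)\<^sup>2)"
  have kk: "kd k k = 1" for k by (simp add: kd_def)
  have 1: "(\<Sum>k\<in>J. \<Sum>p\<in>J. (kd i k * u k * u p - kd k k * u i * u p + u i * u k * kd k p - u k * u k * kd i p) * h p j)
     = (2 - real (card J)) * u i * v j - u2 * h i j" if "i \<in> J" "j \<in> J" for i j
  proof -
    have a: "(\<Sum>k\<in>J. \<Sum>p\<in>J. kd i k * u k * u p * h p j) = u i * v j"
      using that by (simp add: mult.assoc sum_distrib_left[symmetric] kd) (simp add: v mult.commute[of "u _" "h _ _"])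
    have b: "(\<Sum>k\<in>J. \<Sum>p\<in>J. kd k k * u i * u p * h p j) = real (card J) * (u i * v j)"
      using that by (simp add: kk mult.assoc sum_distrib_left[symmetric]) (simp add: v mult.commute[of "u _" "h _ _"])
    have c: "(\<Sum>k\<in>J. \<Sum>p\<in>J. u i * u k * kd k p * h p j) = u i * v j"
      using that by (simp add: mult.assoc sum_distrib_left[symmetric] kd) (simp add: v mult.commute[of "u _" "h _ _"])
    have d: "(\<Sum>k\<in>J. \<Sum>p\<in>J. u k * u k * kd i p * h p j) = u2 * h i j"
      using that by (simp add: mult.assoc sum_distrib_left[symmetric] kd) (simp add: u2_def sum_distrib_right power2_eq_square mult.assoc)
    show ?thesis by (simp add: left_diff_distrib distrib_right sum_subtractf sum.distrib a b c d)
  qed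
  have 2: "(\<Sum>k\<in>J. \<Sum>p\<in>J. (kd i j * u k * u p - kd k j * u i * u p + u i * u j * kd k p - u k * u j * kd i p) * h k p)
     = kd i j * q0 - u i * v j + u i * u j * mtr J h - u j * v i" if "i \<in> J" "j \<in> J" for i j
  proof -
    have a: "(\<Sum>k\<in>J. \<Sum>p\<in>J. kd i j * u k * u p * h k p) = kd i j * q0"
      by (simp add: q0_def v_def sum_distrib_left mult_ac)
    have b: "(\<Sum>k\<in>J. \<Sum>p\<in>J. kd k j * u i * u p * h k p) = u i * v j"
      using that by (simp add: mult.assoc sum_distrib_left[symmetric] kd v_def) (simp add: mult.commute)
    have c: "(\<Sum>k\<in>J. \<Sum>p\<in>J. u i * u j * kd k p * h k p) = u i * u j * mtr J h"
      using that by (simp add: mult.assoc sum_distrib_left[symmetric] kd mtr_def)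
    have d: "(\<Sum>k\<in>J. \<Sum>p\<in>J. u k * u j * kd i p * h k p) = u j * v i"
      using that v[of i] by (simp add: mult.assoc sum_distrib_left[symmetric] kd)
        (simp add: sum_distrib_left mult_ac flip: v)
    show ?thesis by (simp add: left_diff_distrib distrib_right sum_subtractf sum.distrib a b c d)
  qed
  have q: "(\<Sum>i\<in>J. \<Sum>j\<in>J. h i j * (u i * v j)) = (\<Sum>i\<in>J. (v i)\<^sup>2)"
  proof -
    have "(\<Sum>i\<in>J. \<Sum>j\<in>J. h i j * (u i * v j)) = (\<Sum>j\<in>J. \<Sum>i\<in>J. h i j * (u i * v j))" by (rule sum.swap)
    also have "\<dots> = (\<Sum>j\<in>J. (\<Sum>i\<in>J. h i j * u i) * v j)" by (simp add: sum_distrib_right mult.assoc)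
    finally show ?thesis by (simp add: v power2_eq_square)
  qed
  have q': "(\<Sum>i\<in>J. \<Sum>j\<in>J. h i j * (u j * v i)) = (\<Sum>i\<in>J. (v i)\<^sup>2)"
    by (simp add: v_def sum_distrib_left sum_distrib_right power2_eq_square mult_ac)
  have t: "(\<Sum>i\<in>J. \<Sum>j\<in>J. h i j * (u i * u j)) = q0"
    by (simp add: q0_def v_def sum_distrib_left mult_ac)
  have "curv_contraction J h (\<lambda>l k i p. kd k i * u l * u p - kd l i * u k * u p + u k * u i * kd l p - u l * u i * kd k p)
   = (\<Sum>i\<in>J. \<Sum>j\<in>J. h i j * (((2 - real (card J)) * u i * v j - u2 * h i j)
        + (kd i j * q0 - u i * v j + u i * u j * mtr J h - u j * v i)))"
    unfolding curv_contraction_def sum_distrib_left[symmetric] sum.distrib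
    by (intro sum.cong refl) (simp only: 1 2)
  also have "\<dots> = (1 - real (card J)) * (\<Sum>i\<in>J. \<Sum>j\<in>J. h i j * (u i * v j)) - u2 * (\<Sum>i\<in>J. \<Sum>j\<in>J. h i j * h i j)
     + (\<Sum>i\<in>J. \<Sum>j\<in>J. kd i j * h i j) * q0 + (\<Sum>i\<in>J. \<Sum>j\<in>J. h i j * (u i * u j)) * mtr J h
     - (\<Sum>i\<in>J. \<Sum>j\<in>J. h i j * (u j * v i))"
    unfolding sum_distrib_left sum_distrib_right sum.distrib[symmetric] sum_subtractf[symmetric]
    by (intro sum.cong refl) (simp add: algebra_simps)
  also have "\<dots> = (1 - real (card J)) * (\<Sum>i\<in>J. (v i)\<^sup>2) - u2 * mtr J (mm J h h) + mtr J h * q0 + q0 * mtr J h - (\<Sum>i\<in>J. (v i)\<^sup>2)"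
    unfolding q q' t by (simp add: kd) (simp add: mtr_def mm_def hs cong: sum.cong)
  finally show ?thesis unfolding u2_def q0_def v_def by (simp add: algebra_simps)
qed

end

context
  fixes J :: "nat set" and h g :: "nat \<Rightarrow> nat \<Rightarrow> real"
  assumes hs: "\<And>i j. i \<in> J \<Longrightarrow> j \<in> J \<Longrightarrow> h i j = h j i"
    and gs: "\<And>i j. i \<in> J \<Longrightarrow> j \<in> J \<Longrightarrow> g i j = g j i"
begin

lemma mtr_mm_sym: "mtr J (mm J h g) = (\<Sum>i\<in>J. \<Sum>j\<in>J. h i j * g i j)"
  unfolding mtr_def mm_def using gs by simp

lemma quartic_Q3:
  "(\<Sum>i\<in>J. \<Sum>j\<in>J. \<Sum>k\<in>J. \<Sum>p\<in>J. h i j * h i p * g k p * g k j) = mtr J (mm J g (mm J g (mm J h h)))"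
proof -
  have "mtr J (mm J g (mm J g (mm J h h))) = mtr J (mm J h (mm J g (mm J g h)))"
    using mtr_mm_commute[of J "mm J g (mm J g h)" h] by (simp add: mm_assoc)
  also have "\<dots> = (\<Sum>i\<in>J. \<Sum>j\<in>J. \<Sum>k\<in>J. \<Sum>p\<in>J. h i j * h i p * g k p * g k j)"
    unfolding mtr_def mm_def sum_distrib_left
    by (intro sum.cong refl) (simp add: hs gs mult_ac)
  finally show ?thesis by simp
qed

lemma quartic_Q2:
  "(\<Sum>i\<in>J. \<Sum>j\<in>J. \<Sum>k\<in>J. \<Sum>p\<in>J. h i j * h k p * g i p * g k j) = mtr J (mm J g (mm J h (mm J g h)))"
proof -
  have "mtr J (mm J g (mm J h (mm J g h))) = mtr J (mm J h (mm J g (mm J h g)))"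
    using mtr_mm_commute[of J g "mm J h (mm J g h)"] by (simp add: mm_assoc)
  also have "\<dots> = (\<Sum>i\<in>J. \<Sum>j\<in>J. \<Sum>k\<in>J. \<Sum>p\<in>J. h i j * h k p * g i p * g k j)"
    unfolding mtr_def mm_def sum_distrib_left
    by (intro sum.cong refl) (simp add: hs gs mult_ac)
  finally show ?thesis by simp
qed

lemma curv_contraction_gauss:
  "curv_contraction J h (\<lambda>l k i p. g k i * g l p - g l i * g k p) =
    mtr J (mm J g (mm J g (mm J h h))) - mtr J (mm J g (mm J h (mm J g h)))
    + (mtr J (mm J h g))\<^sup>2 - mtr J g * mtr J (mm J g (mm J h h))"
proof -
  have "curv_contraction J h (\<lambda>l k i p. g k i * g l p - g l i * g k p) =
     (\<Sum>i\<in>J. \<Sum>j\<in>J. \<Sum>k\<in>J. \<Sum>p\<in>J. h i j * (g i k * g k p * h p j)) - (\<Sum>i\<in>J. \<Sum>j\<in>J. \<Sum>k\<in>J. \<Sum>p\<in>J. h i j * (g k k * g i p * h p j))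
     + (\<Sum>i\<in>J. \<Sum>j\<in>J. \<Sum>k\<in>J. \<Sum>p\<in>J. h i j * (g i j * g k p * h k p)) - (\<Sum>i\<in>J. \<Sum>j\<in>J. \<Sum>k\<in>J. \<Sum>p\<in>J. h i j * (g k j * g i p * h k p))"
    unfolding curv_contraction_def sum_subtractf[symmetric] sum.distrib[symmetric] sum_distrib_left
    by (intro sum.cong refl) (simp add: algebra_simps)
  also have "(\<Sum>i\<in>J. \<Sum>j\<in>J. \<Sum>k\<in>J. \<Sum>p\<in>J. h i j * (g i k * g k p * h p j)) = mtr J (mm J g (mm J g (mm J h h)))"
  proof -
    have "mtr J (mm J g (mm J g (mm J h h))) = mtr J (mm J h (mm J g (mm J g h)))"
      using mtr_mm_commute[of J "mm J g (mm J g h)" h] by (simp add: mm_assoc)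
    also have "\<dots> = (\<Sum>j\<in>J. \<Sum>i\<in>J. \<Sum>k\<in>J. \<Sum>p\<in>J. h i j * (g i k * g k p * h p j))"
      unfolding mtr_def mm_def sum_distrib_left
      by (intro sum.cong refl) (simp add: hs gs mult_ac)
    finally show ?thesis using sum.swap[of _ J J] by simp
  qed
  also have "(\<Sum>i\<in>J. \<Sum>j\<in>J. \<Sum>k\<in>J. \<Sum>p\<in>J. h i j * (g k j * g i p * h k p)) = mtr J (mm J g (mm J h (mm J g h)))"
    unfolding quartic_Q2[symmetric] by (simp add: mult_ac)
  also have "(\<Sum>i\<in>J. \<Sum>j\<in>J. \<Sum>k\<in>J. \<Sum>p\<in>J. h i j * (g i j * g k p * h k p)) = (mtr J (mm J h g))\<^sup>2"
    unfolding mtr_mm_sym power2_eq_square sum_distrib_right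
    by (intro sum.cong refl) (simp add: sum_distrib_left mult_ac)
  also have "(\<Sum>i\<in>J. \<Sum>j\<in>J. \<Sum>k\<in>J. \<Sum>p\<in>J. h i j * (g k k * g i p * h p j)) = mtr J g * mtr J (mm J g (mm J h h))"
  proof -
    have "(\<Sum>i\<in>J. \<Sum>j\<in>J. \<Sum>k\<in>J. \<Sum>p\<in>J. h i j * (g k k * g i p * h p j))
       = (\<Sum>k\<in>J. g k k) * (\<Sum>i\<in>J. \<Sum>j\<in>J. \<Sum>p\<in>J. h i j * (g i p * h p j))"
      unfolding sum_distrib_right by (rule trans[OF sum_rotate3]) (simp add: sum_distrib_left mult_ac)
    also have "(\<Sum>i\<in>J. \<Sum>j\<in>J. \<Sum>p\<in>J. h i j * (g i p * h p j)) = (\<Sum>i\<in>J. \<Sum>p\<in>J. \<Sum>j\<in>J. g i p * (h p j * h j i))"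
      by (rule sum.cong[OF refl], rule trans[OF sum.swap], intro sum.cong refl) (simp add: hs mult_ac)
    finally show ?thesis by (simp add: mtr_def mm_def sum_distrib_left)
  qed
  finally show ?thesis by simp
qed

end

section \<open>Contraction with the second fundamental form\<close>

context adapted_chart
begin

text \<open>The second fundamental form at the base point, and the components of \<open>A\<^sub>\<beta>T\<close>.\<close>

definition "h \<beta> i j = \<theta> i j \<beta> x"
definition "hT \<beta> i = (\<Sum>j\<in>tng. h \<beta> i j * \<tau> j x)"
abbreviation "tr2 \<beta> \<gamma> \<equiv> mtr tng (mm tng (h \<beta>) (h \<gamma>))"
definition "comm \<beta> \<gamma> i j = mm tng (h \<gamma>) (h \<beta>) i j - mm tng (h \<beta>) (h \<gamma>) i j"

lemma h_sym: "\<beta> \<in> nor \<Longrightarrow> i \<in> tng \<Longrightarrow> j \<in> tng \<Longrightarrow> h \<beta> i j = h \<beta> j i"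
  unfolding h_def by (rule theta_sym[OF x])

lemma card_tng: "card tng = n"
  by (simp add: tng_def)

lemma Rm_decomposition:
  "Rm l k i p = - bb (F x) * (kd k i * kd l p - kd l i * kd k p)
     + - rr (F x) * (kd k i * \<tau> l x * \<tau> p x - kd l i * \<tau> k x * \<tau> p x + \<tau> k x * \<tau> i x * kd l p - \<tau> l x * \<tau> i x * kd k p)
     + (\<Sum>\<gamma>\<in>nor. \<eta> \<gamma> * (h \<gamma> k i * h \<gamma> l p - h \<gamma> l i * h \<gamma> k p))"
  unfolding Rm_def Rb_def h_def kd_def by simp

text \<open>
  The normal curvature and the two curvature terms of the tangent bundle each contribute quartic traces; together
  they are \<open>2 tr(A\<^sub>\<gamma>A\<^sub>\<beta>A\<^sub>\<gamma>A\<^sub>\<beta>) - 2 tr(A\<^sub>\<gamma>\<^sup>2A\<^sub>\<beta>\<^sup>2)\<close>, the trace of the squared commutator, and the terms with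
  traces of fewer factors.
\<close>

lemma ricci_contraction:
  assumes b: "\<beta> \<in> nor"
  shows "(\<Sum>i\<in>tng. \<Sum>j\<in>tng. \<Sum>k\<in>tng. h \<beta> i j * ric \<beta> k j i k) =
    bb (F x) * ((mtr tng (h \<beta>))\<^sup>2 - real n * tr2 \<beta> \<beta>)
    + rr (F x) * (2 * mtr tng (h \<beta>) * (\<Sum>i\<in>tng. \<tau> i x * hT \<beta> i) - real n * (\<Sum>i\<in>tng. (hT \<beta> i)\<^sup>2)
        - (\<Sum>i\<in>tng. (\<tau> i x)\<^sup>2) * tr2 \<beta> \<beta>)
    + (\<Sum>\<gamma>\<in>nor. \<eta> \<gamma> * (mtr tng (h \<gamma>) * mtr tng (mm tng (h \<gamma>) (mm tng (h \<beta>) (h \<beta>)))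
        + mtr tng (mm tng (comm \<beta> \<gamma>) (comm \<beta> \<gamma>)) - (tr2 \<beta> \<gamma>)\<^sup>2))"
proof -
  note fin = finite_index_sets(1)
  let ?Q3 = "\<lambda>\<gamma>. mtr tng (mm tng (h \<gamma>) (mm tng (h \<gamma>) (mm tng (h \<beta>) (h \<beta>))))"
  let ?Q2 = "\<lambda>\<gamma>. mtr tng (mm tng (h \<gamma>) (mm tng (h \<beta>) (mm tng (h \<gamma>) (h \<beta>))))"
  let ?N = "\<lambda>\<gamma> i j k. (\<Sum>p\<in>tng. h \<beta> i p * h \<gamma> k p - h \<beta> k p * h \<gamma> i p) * h \<gamma> k j"
  have N: "(\<Sum>i\<in>tng. \<Sum>j\<in>tng. \<Sum>k\<in>tng. h \<beta> i j * ?N \<gamma> i j k) = ?Q3 \<gamma> - ?Q2 \<gamma>" if c: "\<gamma> \<in> nor" for \<gamma>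
  proof -
    have "(\<Sum>i\<in>tng. \<Sum>j\<in>tng. \<Sum>k\<in>tng. h \<beta> i j * ?N \<gamma> i j k) =
       (\<Sum>i\<in>tng. \<Sum>j\<in>tng. \<Sum>k\<in>tng. \<Sum>p\<in>tng. h \<beta> i j * h \<beta> i p * h \<gamma> k p * h \<gamma> k j)
       - (\<Sum>i\<in>tng. \<Sum>j\<in>tng. \<Sum>k\<in>tng. \<Sum>p\<in>tng. h \<beta> i j * h \<beta> k p * h \<gamma> i p * h \<gamma> k j)"
      unfolding sum_subtractf[symmetric]
      by (intro sum.cong refl) (simp add: sum_distrib_left sum_distrib_right algebra_simps)
    also have "(\<Sum>i\<in>tng. \<Sum>j\<in>tng. \<Sum>k\<in>tng. \<Sum>p\<in>tng. h \<beta> i j * h \<beta> i p * h \<gamma> k p * h \<gamma> k j) = ?Q3 \<gamma>"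
      by (rule quartic_Q3[OF h_sym[OF b] h_sym[OF c]])
    also have "(\<Sum>i\<in>tng. \<Sum>j\<in>tng. \<Sum>k\<in>tng. \<Sum>p\<in>tng. h \<beta> i j * h \<beta> k p * h \<gamma> i p * h \<gamma> k j) = ?Q2 \<gamma>"
      by (rule quartic_Q2[OF h_sym[OF b] h_sym[OF c]])
    finally show ?thesis .
  qed
  have push: "(\<Sum>i\<in>tng. \<Sum>j\<in>tng. \<Sum>k\<in>tng. h \<beta> i j * (\<Sum>\<gamma>\<in>nor. \<eta> \<gamma> * ?N \<gamma> i j k)) = (\<Sum>\<gamma>\<in>nor. \<eta> \<gamma> * (?Q3 \<gamma> - ?Q2 \<gamma>))"
  proof -
    have "(\<Sum>i\<in>tng. \<Sum>j\<in>tng. \<Sum>k\<in>tng. h \<beta> i j * (\<Sum>\<gamma>\<in>nor. \<eta> \<gamma> * ?N \<gamma> i j k))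
       = (\<Sum>i\<in>tng. \<Sum>j\<in>tng. \<Sum>k\<in>tng. \<Sum>\<gamma>\<in>nor. \<eta> \<gamma> * (h \<beta> i j * ?N \<gamma> i j k))"
      by (simp add: sum_distrib_left mult.left_commute)
    also have "\<dots> = (\<Sum>\<gamma>\<in>nor. \<Sum>i\<in>tng. \<Sum>j\<in>tng. \<Sum>k\<in>tng. \<eta> \<gamma> * (h \<beta> i j * ?N \<gamma> i j k))"
      by (rule trans[OF sum.cong[OF refl trans[OF sum.cong[OF refl sum.swap] sum.swap]] sum.swap])
    also have "\<dots> = (\<Sum>\<gamma>\<in>nor. \<eta> \<gamma> * (?Q3 \<gamma> - ?Q2 \<gamma>))"
      unfolding sum_distrib_left[symmetric] by (intro sum.cong refl) (simp only: N[unfolded sum_distrib_left[symmetric]])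
    finally show ?thesis .
  qed
  have "(\<Sum>i\<in>tng. \<Sum>j\<in>tng. \<Sum>k\<in>tng. h \<beta> i j * ric \<beta> k j i k) =
     - (\<Sum>i\<in>tng. \<Sum>j\<in>tng. \<Sum>k\<in>tng. h \<beta> i j * (\<Sum>\<gamma>\<in>nor. \<eta> \<gamma> * ?N \<gamma> i j k)) - curv_contraction tng (h \<beta>) Rm"
    unfolding curv_contraction_def sum_negf[symmetric] sum_subtractf[symmetric]
    by (intro sum.cong refl) (simp add: ric_def h_def algebra_simps)
  moreover have "curv_contraction tng (h \<beta>) Rm =
     - bb (F x) * ((mtr tng (h \<beta>))\<^sup>2 - real n * tr2 \<beta> \<beta>)
     + - rr (F x) * (2 * mtr tng (h \<beta>) * (\<Sum>i\<in>tng. \<tau> i x * hT \<beta> i) - real n * (\<Sum>i\<in>tng. (hT \<beta> i)\<^sup>2)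
        - (\<Sum>i\<in>tng. (\<tau> i x)\<^sup>2) * tr2 \<beta> \<beta>)
     + (\<Sum>\<gamma>\<in>nor. \<eta> \<gamma> * (?Q3 \<gamma> - ?Q2 \<gamma> + (tr2 \<beta> \<gamma>)\<^sup>2 - mtr tng (h \<gamma>) * mtr tng (mm tng (h \<gamma>) (mm tng (h \<beta>) (h \<beta>)))))"
  proof -
    have G: "(\<Sum>\<gamma>\<in>nor. \<eta> \<gamma> * curv_contraction tng (h \<beta>) (\<lambda>l k i p. h \<gamma> k i * h \<gamma> l p - h \<gamma> l i * h \<gamma> k p))
      = (\<Sum>\<gamma>\<in>nor. \<eta> \<gamma> * (?Q3 \<gamma> - ?Q2 \<gamma> + (tr2 \<beta> \<gamma>)\<^sup>2 - mtr tng (h \<gamma>) * mtr tng (mm tng (h \<gamma>) (mm tng (h \<beta>) (h \<beta>)))))"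
      by (rule sum.cong[OF refl], subst curv_contraction_gauss) (simp_all add: h_sym[OF b] h_sym)
    have A: "curv_contraction tng (h \<beta>) (\<lambda>l k i p. kd k i * kd l p - kd l i * kd k p)
      = (mtr tng (h \<beta>))\<^sup>2 - real (card tng) * tr2 \<beta> \<beta>"
      by (rule curv_contraction_constant[OF fin h_sym[OF b]])
    have B: "curv_contraction tng (h \<beta>)
       (\<lambda>l k i p. kd k i * \<tau> l x * \<tau> p x - kd l i * \<tau> k x * \<tau> p x + \<tau> k x * \<tau> i x * kd l p - \<tau> l x * \<tau> i x * kd k p)
      = 2 * mtr tng (h \<beta>) * (\<Sum>i\<in>tng. \<tau> i x * (\<Sum>j\<in>tng. h \<beta> i j * \<tau> j x))
        - real (card tng) * (\<Sum>i\<in>tng. (\<Sum>j\<in>tng. h \<beta> i j * \<tau> j x)\<^sup>2)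
        - (\<Sum>i\<in>tng. (\<tau> i x)\<^sup>2) * tr2 \<beta> \<beta>"
      by (rule curv_contraction_warping[OF fin h_sym[OF b]])
    show ?thesis
      unfolding Rm_decomposition[abs_def] curv_contraction_add curv_contraction_scale curv_contraction_sum G A B
        card_tng hT_def ..
  qed
  moreover have "(\<Sum>\<gamma>\<in>nor. \<eta> \<gamma> * (mtr tng (h \<gamma>) * mtr tng (mm tng (h \<gamma>) (mm tng (h \<beta>) (h \<beta>)))
        + mtr tng (mm tng (comm \<beta> \<gamma>) (comm \<beta> \<gamma>)) - (tr2 \<beta> \<gamma>)\<^sup>2))
     = - (\<Sum>\<gamma>\<in>nor. \<eta> \<gamma> * (?Q3 \<gamma> - ?Q2 \<gamma>))
       - (\<Sum>\<gamma>\<in>nor. \<eta> \<gamma> * (?Q3 \<gamma> - ?Q2 \<gamma> + (tr2 \<beta> \<gamma>)\<^sup>2 - mtr tng (h \<gamma>) * mtr tng (mm tng (h \<gamma>) (mm tng (h \<beta>) (h \<beta>)))))"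
  proof -
    have CM: "mtr tng (mm tng (comm \<beta> \<gamma>) (comm \<beta> \<gamma>)) = 2 * ?Q2 \<gamma> - 2 * ?Q3 \<gamma>" for \<gamma>
      using mtr_commutator_sq[of tng "h \<gamma>" "h \<beta>"] by (simp add: comm_def[abs_def])
    show ?thesis
      unfolding CM sum_negf[symmetric] sum_subtractf[symmetric] by (intro sum.cong refl) (simp add: algebra_simps)
  qed
  ultimately show ?thesis
    unfolding push by (simp add: algebra_simps)
qed

definition "drr i = d i (\<lambda>y. rr (F y)) x"

text \<open>
  Contracting the Kronecker symbols leaves \<open>n\<close> times a contraction with \<open>h\<close> minus \<open>tr h\<close> times a trace, for
  each of \<open>\<nabla>r\<close>, \<open>\<nabla>T\<close> and \<open>\<nabla>\<^sup>\<bottom>\<xi>\<close>. Both \<open>\<nabla>T\<close> and \<open>\<nabla>\<^sup>\<bottom>\<xi>\<close> contain \<open>a'/a\<close> with the factor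
  \<open>-\<epsilon>\<close>, which explains the 2 in the second line.
\<close>

lemma codazzi_contraction:
  assumes b: "\<beta> \<in> nor"
  shows "(\<Sum>i\<in>tng. \<Sum>j\<in>tng. \<Sum>k\<in>tng. h \<beta> i j * (cod \<beta> i j k k + cod \<beta> j k k i)) =
    (real n * (\<Sum>i\<in>tng. drr i * hT \<beta> i) - mtr tng (h \<beta>) * (\<Sum>i\<in>tng. drr i * \<tau> i x)) * \<tau> \<beta> x
    - 2 * \<epsilon> * lam (F x) * rr (F x) * (real n * (\<Sum>i\<in>tng. \<tau> i x * hT \<beta> i) - mtr tng (h \<beta>) * (\<Sum>i\<in>tng. (\<tau> i x)\<^sup>2)) * \<tau> \<beta> x
    + rr (F x) * (real n * (\<Sum>\<gamma>\<in>nor. \<eta> \<gamma> * \<tau> \<gamma> x * tr2 \<gamma> \<beta>) - (\<Sum>\<gamma>\<in>nor. \<eta> \<gamma> * \<tau> \<gamma> x * mtr tng (h \<gamma>)) * mtr tng (h \<beta>)) * \<tau> \<beta> x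
    + rr (F x) * (mtr tng (h \<beta>) * (\<Sum>i\<in>tng. \<tau> i x * hT \<beta> i) - real n * (\<Sum>i\<in>tng. (hT \<beta> i)\<^sup>2))"
proof -
  note kd = kd_sum[OF finite_index_sets(1)]
  let ?u = "\<lambda>i. \<tau> i x" and ?ub = "\<tau> \<beta> x" and ?\<rho> = "rr (F x)" and ?L = "lam (F x)" and ?h = "h \<beta>"
  have kk: "kd k k = 1" for k by (simp add: kd_def)
  have A: "(\<Sum>k\<in>tng. cod \<beta> i j k k) =
     - (kd i j * (\<Sum>k\<in>tng. drr k * ?u k) - drr j * ?u i) * ?ub
     - ?\<rho> * (kd i j * (\<Sum>k\<in>tng. DT k k) - DT j i) * ?ub
     - ?\<rho> * (kd i j * (\<Sum>k\<in>tng. ?u k * DX \<beta> k) - ?u i * DX \<beta> j)" if "i \<in> tng" "j \<in> tng" for i j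
  proof -
    have "(\<Sum>k\<in>tng. cod \<beta> i j k k) = (\<Sum>k\<in>tng.
      - (kd i j * (drr k * ?u k) * ?ub) + kd k j * (drr k * ?u i * ?ub)
      - ?\<rho> * (kd i j * DT k k * ?ub) + kd k j * (?\<rho> * (DT k i * ?ub))
      - ?\<rho> * (kd i j * (?u k * DX \<beta> k)) + kd k j * (?\<rho> * (?u i * DX \<beta> k)))"
      by (intro sum.cong refl) (simp add: cod_def drr_def algebra_simps)
    also have "\<dots> = - (kd i j * (\<Sum>k\<in>tng. drr k * ?u k) * ?ub) + drr j * ?u i * ?ub
      - ?\<rho> * (kd i j * (\<Sum>k\<in>tng. DT k k) * ?ub) + ?\<rho> * (DT j i * ?ub)
      - ?\<rho> * (kd i j * (\<Sum>k\<in>tng. ?u k * DX \<beta> k)) + ?\<rho> * (?u i * DX \<beta> j)"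
      unfolding sum.distrib sum_subtractf kd[OF that(2)]
      by (simp add: sum_negf sum_distrib_left sum_distrib_right)
    finally show ?thesis by (simp add: algebra_simps)
  qed
  have B: "(\<Sum>k\<in>tng. cod \<beta> j k k i) =
     (real n - 1) * (drr i * ?u j * ?ub + ?\<rho> * DT i j * ?ub + ?\<rho> * ?u j * DX \<beta> i)" if "i \<in> tng" "j \<in> tng" for i j
  proof -
    have "(\<Sum>k\<in>tng. cod \<beta> j k k i) = (\<Sum>k\<in>tng.
       (drr i * ?u j * ?ub + ?\<rho> * DT i j * ?ub + ?\<rho> * ?u j * DX \<beta> i)
       - kd j k * (drr i * ?u k * ?ub + ?\<rho> * DT i k * ?ub + ?\<rho> * ?u k * DX \<beta> i))"
      by (intro sum.cong refl) (simp add: cod_def drr_def kk algebra_simps)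
    also have "\<dots> = real n * (drr i * ?u j * ?ub + ?\<rho> * DT i j * ?ub + ?\<rho> * ?u j * DX \<beta> i)
       - (drr i * ?u j * ?ub + ?\<rho> * DT i j * ?ub + ?\<rho> * ?u j * DX \<beta> i)"
      unfolding sum_subtractf kd[OF that(2)] by (simp add: card_tng)
    finally show ?thesis by (simp add: algebra_simps)
  qed
  have flip: "(\<Sum>i\<in>tng. \<Sum>j\<in>tng. ?h i j * f j i) = (\<Sum>i\<in>tng. \<Sum>j\<in>tng. ?h i j * f i j)" for f :: "nat \<Rightarrow> nat \<Rightarrow> real"
    by (rule trans[OF sum.swap]) (use h_sym[OF b] in simp)
  \<comment> \<open>traces of \<open>\<nabla>r \<otimes> T\<close>, \<open>\<nabla>T\<close>, \<open>T \<otimes> \<nabla>\<^sup>\<bottom>\<xi>\<close>, and their contractions with \<open>h\<close>\<close>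
  define R where "R = (\<Sum>k\<in>tng. drr k * ?u k)"
  define D where "D = (\<Sum>k\<in>tng. DT k k)"
  define X where "X = (\<Sum>k\<in>tng. ?u k * DX \<beta> k)"
  define RH where "RH = (\<Sum>i\<in>tng. \<Sum>j\<in>tng. ?h i j * (drr i * ?u j))"
  define DH where "DH = (\<Sum>i\<in>tng. \<Sum>j\<in>tng. ?h i j * DT i j)"
  define XH where "XH = (\<Sum>i\<in>tng. \<Sum>j\<in>tng. ?h i j * (?u j * DX \<beta> i))"
  have tr: "(\<Sum>i\<in>tng. \<Sum>j\<in>tng. ?h i j * kd i j) = mtr tng ?h"
    by (simp add: mult.commute[of "h _ _ _"] kd mtr_def)
  have "(\<Sum>i\<in>tng. \<Sum>j\<in>tng. \<Sum>k\<in>tng. ?h i j * (cod \<beta> i j k k + cod \<beta> j k k i))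
     = (\<Sum>i\<in>tng. \<Sum>j\<in>tng. ?h i j * ((- (kd i j * R - drr j * ?u i) * ?ub - ?\<rho> * (kd i j * D - DT j i) * ?ub
          - ?\<rho> * (kd i j * X - ?u i * DX \<beta> j))
        + (real n - 1) * (drr i * ?u j * ?ub + ?\<rho> * DT i j * ?ub + ?\<rho> * ?u j * DX \<beta> i)))"
    unfolding sum_distrib_left[symmetric] sum.distrib R_def D_def X_def
    by (intro sum.cong refl) (simp only: A B)
  also have "\<dots> = (\<Sum>i\<in>tng. \<Sum>j\<in>tng. ?h i j * (drr j * ?u i)) * ?ub + ?\<rho> * (\<Sum>i\<in>tng. \<Sum>j\<in>tng. ?h i j * DT j i) * ?ub
      + ?\<rho> * (\<Sum>i\<in>tng. \<Sum>j\<in>tng. ?h i j * (?u i * DX \<beta> j)) + (real n - 1) * (RH * ?ub + ?\<rho> * DH * ?ub + ?\<rho> * XH)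
      - (\<Sum>i\<in>tng. \<Sum>j\<in>tng. ?h i j * kd i j) * (R * ?ub + ?\<rho> * D * ?ub + ?\<rho> * X)"
    unfolding RH_def DH_def XH_def sum_distrib_left sum_distrib_right sum.distrib[symmetric] sum_subtractf[symmetric]
    by (intro sum.cong refl) (simp add: algebra_simps)
  also have "(\<Sum>i\<in>tng. \<Sum>j\<in>tng. ?h i j * (drr j * ?u i)) = RH"
    unfolding RH_def by (rule flip[of "\<lambda>i j. drr i * ?u j"])
  also have "(\<Sum>i\<in>tng. \<Sum>j\<in>tng. ?h i j * DT j i) = DH"
    unfolding DH_def by (rule flip[of DT])
  also have "(\<Sum>i\<in>tng. \<Sum>j\<in>tng. ?h i j * (?u i * DX \<beta> j)) = XH"
    unfolding XH_def by (rule flip[of "\<lambda>i j. ?u j * DX \<beta> i"])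
  finally have main: "(\<Sum>i\<in>tng. \<Sum>j\<in>tng. \<Sum>k\<in>tng. ?h i j * (cod \<beta> i j k k + cod \<beta> j k k i))
     = (real n * RH - mtr tng ?h * R) * ?ub + ?\<rho> * (real n * DH - mtr tng ?h * D) * ?ub + ?\<rho> * (real n * XH - mtr tng ?h * X)"
    unfolding tr by (simp add: algebra_simps)
  have RH: "RH = (\<Sum>i\<in>tng. drr i * hT \<beta> i)"
    by (simp add: RH_def hT_def sum_distrib_left mult_ac)
  define q where "q = (\<Sum>i\<in>tng. ?u i * hT \<beta> i)"
  define u2 where "u2 = (\<Sum>i\<in>tng. (?u i)\<^sup>2)"
  define v2 where "v2 = (\<Sum>i\<in>tng. (hT \<beta> i)\<^sup>2)"
  have huu: "(\<Sum>i\<in>tng. \<Sum>j\<in>tng. ?h i j * (?u i * ?u j)) = q"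
    by (simp add: q_def hT_def sum_distrib_left mult_ac)
  have tr2: "(\<Sum>i\<in>tng. \<Sum>j\<in>tng. ?h i j * h \<gamma> i j) = tr2 \<gamma> \<beta>" if "\<gamma> \<in> nor" for \<gamma>
    using mtr_mm_sym[OF h_sym[OF b] h_sym[OF that]] mtr_mm_commute[of tng "h \<gamma>" ?h] by simp
  have D: "D = ?L * (real n - \<epsilon> * u2) + (\<Sum>\<gamma>\<in>nor. \<eta> \<gamma> * ?u \<gamma> * mtr tng (h \<gamma>))"
  proof -
    have "D = (\<Sum>k\<in>tng. ?L * (1 - \<epsilon> * (?u k)\<^sup>2)) + (\<Sum>k\<in>tng. \<Sum>\<gamma>\<in>nor. \<eta> \<gamma> * ?u \<gamma> * h \<gamma> k k)"
      unfolding D_def sum.distrib[symmetric]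
      by (intro sum.cong refl) (simp add: DT_eq kk h_def power2_eq_square mult_ac)
    also have "(\<Sum>k\<in>tng. \<Sum>\<gamma>\<in>nor. \<eta> \<gamma> * ?u \<gamma> * h \<gamma> k k) = (\<Sum>\<gamma>\<in>nor. \<eta> \<gamma> * ?u \<gamma> * mtr tng (h \<gamma>))"
      by (subst sum.swap) (simp add: mtr_def sum_distrib_left)
    finally show ?thesis
      by (simp add: sum_distrib_left[symmetric] sum_subtractf card_tng u2_def)
  qed
  have DH: "DH = ?L * (mtr tng ?h - \<epsilon> * q) + (\<Sum>\<gamma>\<in>nor. \<eta> \<gamma> * ?u \<gamma> * tr2 \<gamma> \<beta>)"
  proof -
    have "DH = ?L * ((\<Sum>i\<in>tng. \<Sum>j\<in>tng. ?h i j * kd i j) - \<epsilon> * (\<Sum>i\<in>tng. \<Sum>j\<in>tng. ?h i j * (?u i * ?u j)))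
       + (\<Sum>i\<in>tng. \<Sum>j\<in>tng. \<Sum>\<gamma>\<in>nor. \<eta> \<gamma> * ?u \<gamma> * (?h i j * h \<gamma> i j))"
      unfolding DH_def sum_distrib_left sum.distrib[symmetric] sum_subtractf[symmetric]
      by (intro sum.cong refl) (simp add: DT_eq h_def sum_distrib_left algebra_simps)
    also have "(\<Sum>i\<in>tng. \<Sum>j\<in>tng. \<Sum>\<gamma>\<in>nor. \<eta> \<gamma> * ?u \<gamma> * (?h i j * h \<gamma> i j))
       = (\<Sum>\<gamma>\<in>nor. \<Sum>i\<in>tng. \<Sum>j\<in>tng. \<eta> \<gamma> * ?u \<gamma> * (?h i j * h \<gamma> i j))"
      by (rule trans[OF sum.cong[OF refl sum.swap] sum.swap])
    also have "\<dots> = (\<Sum>\<gamma>\<in>nor. \<eta> \<gamma> * ?u \<gamma> * tr2 \<gamma> \<beta>)"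
      unfolding sum_distrib_left[symmetric] by (intro sum.cong refl) (simp only: tr2)
    finally show ?thesis unfolding tr huu .
  qed
  have X: "X = - ?L * \<epsilon> * u2 * ?ub - q"
  proof -
    have "X = (\<Sum>k\<in>tng. - ?L * \<epsilon> * ?ub * (?u k)\<^sup>2 - ?u k * hT \<beta> k)"
      unfolding X_def
      by (intro sum.cong refl) (simp add: DX_eq[OF _ b] hT_def h_def power2_eq_square algebra_simps)
    then show ?thesis by (simp add: sum_subtractf sum_distrib_left[symmetric] sum_negf u2_def q_def)
  qed
  have sum_hT: "(\<Sum>p\<in>tng. \<tau> p x * \<theta> i p \<beta> x) = hT \<beta> i" for i
    by (simp add: hT_def h_def mult.commute)
  have XH: "XH = - ?L * \<epsilon> * q * ?ub - v2"
  proof -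
    have "XH = (\<Sum>i\<in>tng. hT \<beta> i * DX \<beta> i)"
      by (simp add: XH_def hT_def sum_distrib_right mult.assoc)
    also have "\<dots> = (\<Sum>i\<in>tng. - ?L * \<epsilon> * ?ub * (?u i * hT \<beta> i) - (hT \<beta> i)\<^sup>2)"
      by (intro sum.cong refl) (simp add: DX_eq[OF _ b] sum_hT power2_eq_square algebra_simps)
    finally show ?thesis by (simp add: sum_subtractf sum_distrib_left[symmetric] sum_negf v2_def q_def)
  qed
  show ?thesis
    unfolding main RH D DH X XH R_def q_def[symmetric] u2_def[symmetric] v2_def[symmetric]
    by (simp add: algebra_simps)
qed

lemma contracted_H4:
  assumes b: "\<beta> \<in> nor"
  shows "(\<Sum>i\<in>tng. \<Sum>j\<in>tng. \<Sum>k\<in>tng. h \<beta> i j * H4 \<beta> i j k k) =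
    (\<Sum>i\<in>tng. \<Sum>j\<in>tng. \<Sum>k\<in>tng. h \<beta> i j * H4 \<beta> k k j i)
    + (\<Sum>i\<in>tng. \<Sum>j\<in>tng. \<Sum>k\<in>tng. h \<beta> i j * (cod \<beta> i j k k + cod \<beta> j k k i))
    + (\<Sum>i\<in>tng. \<Sum>j\<in>tng. \<Sum>k\<in>tng. h \<beta> i j * ric \<beta> k j i k)"
  unfolding sum.distrib[symmetric]
  by (intro sum.cong refl) (simp add: H4_commute b algebra_simps)

end

section \<open>Invariant form of the identity\<close>

text \<open>The trace does not depend on the basis: expand the standard basis in the frame and exchange the sums.\<close>

lemma op_trace_orthonormal:
  fixes L :: "real^'n \<Rightarrow> real^'n"
  assumes L: "linear L" and B: "bilinear B" and exp: "\<And>v. v = (\<Sum>i\<in>J. B v (f i) *\<^sub>R f i)"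
  shows "op_trace L = (\<Sum>i\<in>J. B (L (f i)) (f i))"
proof -
  have lB: "linear (\<lambda>u. B u w)" for w using B by (simp add: bilinear_def)
  have "op_trace L = (\<Sum>j\<in>UNIV. L (axis j 1) $ j)"
    by (simp add: op_trace_def trace_def matrix_def)
  also have "\<dots> = (\<Sum>j\<in>UNIV. \<Sum>i\<in>J. B (axis j 1) (f i) * L (f i) $ j)"
  proof (rule sum.cong[OF refl])
    fix j :: 'n
    have "L (axis j 1) = L (\<Sum>i\<in>J. B (axis j 1) (f i) *\<^sub>R f i)" using exp[of "axis j 1"] by (rule arg_cong)
    also have "\<dots> = (\<Sum>i\<in>J. B (axis j 1) (f i) *\<^sub>R L (f i))" by (simp add: linear_sum[OF L] linear_scale[OF L])
    finally show "L (axis j 1) $ j = (\<Sum>i\<in>J. B (axis j 1) (f i) * L (f i) $ j)" by simp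
  qed
  also have "\<dots> = (\<Sum>i\<in>J. \<Sum>j\<in>UNIV. B (axis j 1) (f i) * L (f i) $ j)" by (rule sum.swap)
  also have "\<dots> = (\<Sum>i\<in>J. B (L (f i)) (f i))"
  proof (rule sum.cong[OF refl])
    fix i
    have "L (f i) = (\<Sum>j\<in>UNIV. L (f i) $ j *\<^sub>R axis j 1)"
      using basis_expansion[of "L (f i)"] by (simp add: scalar_mult_eq_scaleR)
    then have "B (L (f i)) (f i) = B (\<Sum>j\<in>UNIV. L (f i) $ j *\<^sub>R axis j 1) (f i)" by simp
    then show "(\<Sum>j\<in>UNIV. B (axis j 1) (f i) * L (f i) $ j) = B (L (f i)) (f i)"
      by (simp add: linear_sum[OF lB] linear_scale[OF lB] mult.commute)
  qed
  finally show ?thesis .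
qed

context adapted_chart
begin

abbreviation "gx \<equiv> gM x"
text \<open>
  The entry \<open>A i j\<close> is the \<open>j\<close>-th component of the image of \<open>e\<^sub>i\<close>, so composition reverses the order of the factors.
\<close>

definition "represents L A \<longleftrightarrow> linear L \<and> (\<forall>i\<in>tng. \<forall>j\<in>tng. gx (L (e i x)) (e j x) = A i j)"

lemma gx_bilinear: "bilinear gx"
  by (rule metric_on_bilinear[OF gM_metric_on x])

lemma gx_parseval: "gx u v = (\<Sum>i\<in>tng. gx u (e i x) * gx v (e i x))"
proof -
  have l: "linear (gx u)" using gx_bilinear by (simp add: bilinear_def)
  show ?thesis
    by (subst tangent_expansion[OF x, of v]) (simp add: linear_sum[OF l] linear_scale[OF l] mult.commute)
qed

lemma op_trace_frame: "linear L \<Longrightarrow> op_trace L = (\<Sum>i\<in>tng. gx (L (e i x)) (e i x))"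
  by (rule op_trace_orthonormal[OF _ gx_bilinear tangent_expansion[OF x]])

lemma represents_op_trace: "represents L A \<Longrightarrow> op_trace L = mtr tng A"
  by (simp add: represents_def op_trace_frame mtr_def)

lemma represents_compose:
  assumes L: "represents L A" and K: "represents K C"
  shows "represents (L \<circ> K) (mm tng C A)"
  unfolding represents_def
proof (intro conjI ballI)
  have lL: "linear L" and lK: "linear K" using assms by (auto simp: represents_def)
  then show "linear (L \<circ> K)" using linear_compose by blast
  fix i j assume i: "i \<in> tng" and j: "j \<in> tng"
  have l: "linear (\<lambda>u. gx u (e j x))" using gx_bilinear by (simp add: bilinear_def)
  have "K (e i x) = (\<Sum>k\<in>tng. C i k *\<^sub>R e k x)"
    using tangent_expansion[OF x, of "K (e i x)"] K i by (simp add: represents_def)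
  then have "gx ((L \<circ> K) (e i x)) (e j x) = (\<Sum>k\<in>tng. C i k * gx (L (e k x)) (e j x))"
    by (simp add: linear_sum[OF lL] linear_scale[OF lL] linear_sum[OF l] linear_scale[OF l])
  then show "gx ((L \<circ> K) (e i x)) (e j x) = mm tng C A i j"
    using L j by (simp add: mm_def represents_def)
qed

lemma represents_commutator:
  assumes L: "represents L A" and K: "represents K C"
  shows "represents (op_commutator L K) (\<lambda>i j. mm tng C A i j - mm tng A C i j)"
proof -
  have 1: "represents (L \<circ> K) (mm tng C A)" and 2: "represents (K \<circ> L) (mm tng A C)"
    using represents_compose assms by blast+
  have "linear (\<lambda>u. L (K u) - K (L u))"
    using linear_compose_sub[of "L \<circ> K" "K \<circ> L"] 1 2 by (simp add: represents_def o_def)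
  then show ?thesis
    using 1 2 by (simp add: represents_def op_commutator_def bilinear_lsub[OF gx_bilinear])
qed

lemma gx_shape_op:
  assumes \<zeta>: "\<And>v. G (F x) \<zeta> (fd F x v) = 0"
  shows "gx (shape_op G F x \<zeta> u) v = (\<Sum>\<gamma>\<in>nor. \<eta> \<gamma> * G (F x) \<zeta> (\<nu> \<gamma> x) * II \<gamma> x u v)"
proof -
  have eq: "G (F x) (second_ff G F (\<lambda>_. u) (\<lambda>_. v) x) \<zeta> = (\<Sum>\<gamma>\<in>nor. \<eta> \<gamma> * G (F x) \<zeta> (\<nu> \<gamma> x) * II \<gamma> x u v)" for v
  proof -
    have "G (F x) (second_ff G F (\<lambda>_. u) (\<lambda>_. v) x) \<zeta> = G (F x) \<zeta> (second_ff G F (\<lambda>_. u) (\<lambda>_. v) x)"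
      by (rule G_sym[OF x])
    also have "\<dots> = (\<Sum>\<gamma>\<in>nor. \<eta> \<gamma> * G (F x) \<zeta> (\<nu> \<gamma> x) * G (F x) (second_ff G F (\<lambda>_. u) (\<lambda>_. v) x) (\<nu> \<gamma> x))"
      by (rule G_normal_expansion[OF x \<zeta>])
    finally show ?thesis by (simp add: second_ff_II[OF x])
  qed
  have l: "linear (II \<gamma> x u)" for \<gamma> using II_bilinear[OF x] by (simp add: bilinear_def)
  have "linear (\<lambda>v. \<Sum>\<gamma>\<in>nor. \<eta> \<gamma> * G (F x) \<zeta> (\<nu> \<gamma> x) * II \<gamma> x u v)"
    by (rule linearI) (simp_all add: linear_add[OF l] linear_scale[OF l] distrib_left sum.distrib sum_distrib_left mult_ac)
  from metric_on_riesz[OF gM_metric_on x this] show ?thesis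
    unfolding shape_op_def eq .
qed

lemma shape_op_linear:
  assumes \<zeta>: "\<And>v. G (F x) \<zeta> (fd F x v) = 0"
  shows "linear (shape_op G F x \<zeta>)"
proof -
  note B = II_bilinear[OF x]
  show ?thesis
  proof (rule linearI)
    fix u v and c :: real
    show "shape_op G F x \<zeta> (u + v) = shape_op G F x \<zeta> u + shape_op G F x \<zeta> v"
      by (rule metric_on_eqI[OF gM_metric_on x])
         (simp add: gx_shape_op[OF \<zeta>] bilinear_ladd[OF gx_bilinear] bilinear_ladd[OF B] distrib_left sum.distrib)
    show "shape_op G F x \<zeta> (c *\<^sub>R u) = c *\<^sub>R shape_op G F x \<zeta> u"
      by (rule metric_on_eqI[OF gM_metric_on x])
         (simp add: gx_shape_op[OF \<zeta>] bilinear_lmul[OF gx_bilinear] bilinear_lmul[OF B] sum_distrib_left mult_ac)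
  qed
qed

abbreviation "Sh \<beta> \<equiv> shape_op G F x (\<nu> \<beta> x)"
abbreviation "T \<equiv> tangent_part G F x P"
abbreviation "\<xi> \<equiv> normal_part G F x P"

text \<open>
  Both \<open>\<langle>\<nu>\<^sub>\<beta>, \<nu>\<^sub>\<beta>\<rangle>\<close> and the expansion in the normal frame carry the sign of \<open>\<nu>\<^sub>\<beta>\<close>, so no sign remains.
\<close>

lemma gx_Sh:
  assumes b: "\<beta> \<in> nor"
  shows "gx (Sh \<beta> u) v = II \<beta> x u v"
proof -
  have "gx (Sh \<beta> u) v = (\<Sum>\<gamma>\<in>nor. \<eta> \<gamma> * G (F x) (\<nu> \<beta> x) (\<nu> \<gamma> x) * II \<gamma> x u v)"
    by (rule gx_shape_op[OF nu_normal'[OF x b]])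
  also have "\<dots> = (\<Sum>\<gamma>\<in>nor. if \<beta> = \<gamma> then II \<gamma> x u v else 0)"
    by (intro sum.cong refl)
       (use nu_orth'[OF x b] eta_nor eta_sq[OF nor_ind[OF b]] in auto)
  finally show ?thesis using b by (simp add: finite_index_sets)
qed

lemma represents_Sh: "\<beta> \<in> nor \<Longrightarrow> represents (Sh \<beta>) (h \<beta>)"
  unfolding represents_def
  by (simp add: shape_op_linear[OF nu_normal'[OF x]] gx_Sh II_frame x h_def)

lemma \<xi>_normal: "G (F x) \<xi> (fd F x v) = 0"
  by (rule normal_part_orthogonal[OF x])

lemma G_\<xi>: "\<beta> \<in> nor \<Longrightarrow> G (F x) \<xi> (\<nu> \<beta> x) = \<tau> \<beta> x"
  using G_normal_part[OF x nu_normal'[OF x]] by (simp add: \<tau>_def Phi_nor)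

lemma represents_Sh\<xi>: "represents (shape_op G F x \<xi>) (\<lambda>i j. \<Sum>\<gamma>\<in>nor. \<eta> \<gamma> * \<tau> \<gamma> x * h \<gamma> i j)"
  unfolding represents_def
  by (simp add: shape_op_linear[OF \<xi>_normal] gx_shape_op[OF \<xi>_normal] G_\<xi> II_frame x h_def)

lemma gx_T: "i \<in> tng \<Longrightarrow> gx T (e i x) = \<tau> i x"
  by (simp add: gM_tangent_part[OF x] \<tau>_def Phi_tan)

lemma gx_Sh_T:
  assumes b: "\<beta> \<in> nor" and i: "i \<in> tng"
  shows "gx (Sh \<beta> T) (e i x) = hT \<beta> i"
proof -
  have T: "T = (\<Sum>j\<in>tng. \<tau> j x *\<^sub>R e j x)"
    using tangent_expansion[OF x, of T] by (simp add: gx_T)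
  have "gx (Sh \<beta> T) (e i x) = (\<Sum>j\<in>tng. \<tau> j x * h \<beta> j i)"
    unfolding gx_Sh[OF b] by (subst T) (simp add: II_sum_left[OF x] II_frame[OF x _ i b] h_def)
  also have "\<dots> = hT \<beta> i"
    unfolding hT_def by (intro sum.cong refl) (simp add: h_sym[OF b _ i] mult.commute)
  finally show ?thesis .
qed

lemma gx_gradient:
  assumes p: "\<phi> differentiable (at x)"
  shows "gx (gradient gM \<phi> x) v = fd \<phi> x v"
  unfolding gradient_def by (rule metric_on_riesz[OF gM_metric_on x linear_frechet_derivative[OF p]])

lemma gradient_frame:
  assumes y: "y \<in> S" and p: "smooth_on \<phi> S"
  shows "gradient gM \<phi> y = (\<Sum>k\<in>tng. d k \<phi> y *\<^sub>R e k y)"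
proof -
  have "gM y (gradient gM \<phi> y) v = fd \<phi> y v" for v
    unfolding gradient_def
    by (rule metric_on_riesz[OF gM_metric_on y linear_frechet_derivative[OF smooth_on_differentiable[OF p y]]])
  then show ?thesis using tangent_expansion[OF y, of "gradient gM \<phi> y"] by simp
qed

lemma gradient_smooth:
  assumes p: "smooth_on \<phi> S"
  shows "smooth_on (gradient gM \<phi>) S"
proof (rule smooth_on_cong[OF S])
  show "smooth_on (\<lambda>y. \<Sum>k\<in>tng. d k \<phi> y *\<^sub>R e k y) S"
    by (intro smooth_on_sum smooth_on_scaleR S d_smooth p e_smooth')
qed (simp add: gradient_frame p)

text \<open>The Hessian is the second derivative at the base point because the frame is parallel there.\<close>

lemma laplacian_frame:
  assumes p: "smooth_on \<phi> S"
  shows "laplacian gM \<phi> x = (\<Sum>k\<in>tng. d k (\<lambda>y. d k \<phi> y) x)"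
proof -
  let ?X = "gradient gM \<phi>"
  have dX: "?X differentiable (at x)" by (rule smooth_on_differentiable[OF gradient_smooth[OF p] x])
  note lX = linear_frechet_derivative[OF dX] and c = christoffel_bilinear[OF gM_metric_on S x]
  have lin: "linear (\<lambda>v. cov_deriv gM (\<lambda>_. v) ?X x)"
    unfolding cov_deriv_def
    by (rule linearI) (simp_all add: linear_add[OF lX] linear_scale[OF lX] bilinear_ladd[OF c] bilinear_lmul[OF c] algebra_simps)
  have "gx (cov_deriv gM (\<lambda>_. e k x) ?X x) (e k x) = d k (\<lambda>y. d k \<phi> y) x" if k: "k \<in> tng" for k
  proof -
    have dF: "(\<lambda>y. fd F y (Y y)) differentiable (at x)" if "smooth_on Y S" for Y
      by (rule smooth_on_differentiable[OF smooth_on_tangent_field[OF that] x])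
    have gr: "G (F y) (fd F y (?X y)) (fd F y (e k y)) = d k \<phi> y" if y: "y \<in> S" for y
    proof -
      have l: "linear (\<lambda>u. gM y u (e k y))" using metric_on_bilinear[OF gM_metric_on y] by (simp add: bilinear_def)
      have "gM y (?X y) (e k y) = (\<Sum>j\<in>tng. kd j k * d j \<phi> y)"
        unfolding gradient_frame[OF y p] linear_sum[OF l] linear_scale[OF l]
        by (intro sum.cong refl) (simp add: e_orth'[OF y _ k] kd_def)
      then show ?thesis by (simp add: kd_sum[OF finite_index_sets(1) k] induced_metric_def)
    qed
    have "fd (\<lambda>y. G (F y) (fd F y (?X y)) (fd F y (e k y))) x = fd (\<lambda>y. d k \<phi> y) x"
      by (rule fd_cong_open(2)[OF S x]) (use gr smooth_on_differentiable[OF d_smooth[OF k p] x] in auto)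
    then have "d k (\<lambda>y. d k \<phi> y) x = G (F x) (DD (\<lambda>_. e k x) (\<lambda>y. fd F y (?X y)) x) (fd F x (e k x))
       + G (F x) (fd F x (?X x)) (DD (\<lambda>_. e k x) (\<lambda>y. fd F y (e k y)) x)"
      using DD_compat[OF x dF[OF gradient_smooth[OF p]] dF[OF e_smooth'[OF k]], of "\<lambda>_. e k x"] by simp
    also have "\<dots> = gx (cov_deriv gM (\<lambda>_. e k x) ?X x) (e k x) + gx (cov_deriv gM (\<lambda>_. e k x) (e k) x) (?X x)"
      unfolding gM_cov_deriv[OF x dX] gM_cov_deriv[OF x smooth_on_differentiable[OF e_smooth'[OF k] x]]
      using G_sym[OF x] by simp
    finally show ?thesis by (simp add: e_parallel'[OF k] bilinear_lzero[OF gx_bilinear])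
  qed
  then show ?thesis
    unfolding laplacian_def op_trace_frame[OF lin] by simp
qed

text \<open>
  The second covariant derivative of \<open>\<nu>\<^sub>\<beta>\<close> differs from the derivative of \<open>\<theta>\<close> by products \<open>\<theta> k \<gamma> \<delta> * \<theta> k \<beta> \<delta>\<close>. If
  \<open>\<beta>\<close> and \<open>\<gamma>\<close> have different signs, \<open>\<delta>\<close> differs in sign from one of them, and the product vanishes.
\<close>

lemma splitting_frame:
  assumes split1: "\<And>\<beta> \<gamma> v. \<beta> \<in> nor \<Longrightarrow> \<gamma> \<in> nor \<Longrightarrow> sg \<beta> \<noteq> sg \<gamma> \<Longrightarrow> G (F x) (normal_deriv G F (\<lambda>_. v) (\<nu> \<beta>) x) (\<nu> \<gamma> x) = 0"
    and split2: "\<And>\<beta> \<gamma>. \<beta> \<in> nor \<Longrightarrow> \<gamma> \<in> nor \<Longrightarrow> sg \<beta> \<noteq> sg \<gamma> \<Longrightarrow>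
      (\<Sum>i\<in>tng. G (F x) (normal_deriv G F (e i) (normal_deriv G F (e i) (\<nu> \<beta>)) x) (\<nu> \<gamma> x)) = 0"
    and b: "\<beta> \<in> nor" and c: "\<gamma> \<in> nor" and ne: "sg \<beta> \<noteq> sg \<gamma>"
  shows "\<And>k. k \<in> tng \<Longrightarrow> \<theta> k \<beta> \<gamma> x = 0" and "(\<Sum>k\<in>tng. d k (\<theta> k \<beta> \<gamma>) x) = 0"
proof -
  have nd: "G (F y) (normal_deriv G F (e k) (\<nu> \<beta>) y) (\<nu> \<gamma> y) = \<theta> k \<beta> \<gamma> y"
    if "y \<in> S" "\<beta> \<in> nor" "\<gamma> \<in> nor" for y k \<beta> \<gamma>
    unfolding normal_deriv_def G_normal_part[OF that(1) nu_normal'[OF that(1,3)]] using that by (simp add: \<theta>_def Phi_nor)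
  have w0: "\<theta> k \<beta> \<gamma> x = 0" if "\<beta> \<in> nor" "\<gamma> \<in> nor" "sg \<beta> \<noteq> sg \<gamma>" for k \<beta> \<gamma>
  proof -
    have "normal_deriv G F (e k) (\<nu> \<beta>) x = normal_deriv G F (\<lambda>_. e k x) (\<nu> \<beta>) x"
      by (simp add: normal_deriv_def ambient_deriv_def)
    then show ?thesis using nd[OF x that(1,2), of k] split1[OF that, of "e k x"] by simp
  qed
  then show "\<And>k. k \<in> tng \<Longrightarrow> \<theta> k \<beta> \<gamma> x = 0" using b c ne by blast
  have "G (F x) (normal_deriv G F (e k) (normal_deriv G F (e k) (\<nu> \<beta>)) x) (\<nu> \<gamma> x) = d k (\<theta> k \<beta> \<gamma>) x" if k: "k \<in> tng" for k
  proof -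
    let ?N = "normal_deriv G F (e k) (\<nu> \<beta>)"
    have "smooth_on ?N S"
    proof (rule smooth_on_cong[OF S])
      show "smooth_on (\<lambda>y. \<Sum>\<gamma>\<in>nor. (\<eta> \<gamma> * \<theta> k \<beta> \<gamma> y) *\<^sub>R \<nu> \<gamma> y) S"
        by (intro smooth_on_sum smooth_on_scaleR smooth_on_mult smooth_on_const S nu_smooth' theta_smooth nor_ind k b)
      show "(\<Sum>\<gamma>\<in>nor. (\<eta> \<gamma> * \<theta> k \<beta> \<gamma> y) *\<^sub>R \<nu> \<gamma> y) = ?N y" if y: "y \<in> S" for y
        using normal_expansion[OF y normal_deriv_normal[OF y], of "e k" "\<nu> \<beta>"] by (simp add: nd y b)
    qed
    then have dN: "?N differentiable (at x)" by (rule smooth_on_differentiable[OF _ x])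
    have "fd (\<lambda>y. G (F y) (?N y) (\<nu> \<gamma> y)) x = fd (\<theta> k \<beta> \<gamma>) x"
      by (rule fd_cong_open(2)[OF S x])
         (use nd b c smooth_on_differentiable[OF theta_smooth[OF k nor_ind[OF b] nor_ind[OF c]] x] in auto)
    moreover have "(\<Sum>\<delta>\<in>nor. \<eta> \<delta> * \<theta> k \<gamma> \<delta> x * G (F x) (?N x) (\<nu> \<delta> x)) = 0"
    proof (rule sum.neutral, rule ballI)
      fix \<delta> assume dl: "\<delta> \<in> nor"
      have "sg \<gamma> \<noteq> sg \<delta> \<or> sg \<beta> \<noteq> sg \<delta>" using ne by auto
      then have "\<theta> k \<gamma> \<delta> x = 0 \<or> \<theta> k \<beta> \<delta> x = 0" using w0 b c dl by blast
      then show "\<eta> \<delta> * \<theta> k \<gamma> \<delta> x * G (F x) (?N x) (\<nu> \<delta> x) = 0" by (auto simp: nd x b dl)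
    qed
    ultimately show ?thesis
      unfolding normal_deriv_frame[OF x dN c k normal_deriv_normal[OF x]] by simp
  qed
  then show "(\<Sum>k\<in>tng. d k (\<theta> k \<beta> \<gamma>) x) = 0" using split2[OF b c ne] by simp
qed

lemma simons_identity:
  assumes w0: "\<And>\<beta> \<gamma> k. \<beta> \<in> nor \<Longrightarrow> \<gamma> \<in> nor \<Longrightarrow> sg \<beta> \<noteq> sg \<gamma> \<Longrightarrow> k \<in> tng \<Longrightarrow> \<theta> k \<beta> \<gamma> x = 0"
    and dw0: "\<And>\<beta> \<gamma>. \<beta> \<in> nor \<Longrightarrow> \<gamma> \<in> nor \<Longrightarrow> sg \<beta> \<noteq> sg \<gamma> \<Longrightarrow> (\<Sum>k\<in>tng. d k (\<theta> k \<beta> \<gamma>) x) = 0"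
  defines "L \<equiv> \<lambda>\<beta> u. real n *\<^sub>R Sh \<beta> u - op_trace (Sh \<beta>) *\<^sub>R u"
    and "\<xi>c \<equiv> \<lambda>\<beta>. G (F x) \<xi> (\<nu> \<beta> x)" and "Sh\<xi> \<equiv> shape_op G F x \<xi>"
  shows "1/2 * (\<Sum>k\<in>tng. d k (\<lambda>y. d k sq_norm y) x) =
          (\<Sum>\<beta>\<in>nor. \<Sum>i\<in>tng. \<Sum>j\<in>tng. \<Sum>k\<in>tng. \<theta> i j \<beta> x * H4 \<beta> k k j i)
        + (\<Sum>\<beta>\<in>nor. \<Sum>i\<in>tng. \<Sum>j\<in>tng. \<Sum>k\<in>tng. (H3 \<beta> i j k x)\<^sup>2)
        + (\<Sum>\<beta>\<in>nor. gx (gradient gM (\<lambda>y. rr (F y)) x) (L \<beta> T) * \<xi>c \<beta>)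
        - (\<Sum>\<beta>\<in>nor. 2 * \<epsilon> * lam (F x) * rr (F x) * gx (L \<beta> T) T * \<xi>c \<beta>)
        + (\<Sum>\<beta>\<in>nor. rr (F x) * (real n * op_trace (Sh\<xi> \<circ> Sh \<beta>) - op_trace Sh\<xi> * op_trace (Sh \<beta>)) * \<xi>c \<beta>)
        + (\<Sum>\<beta>\<in>nor. rr (F x) * (3 * gx (Sh \<beta> T) T * op_trace (Sh \<beta>)
              - 2 * real n * gx (Sh \<beta> T) (Sh \<beta> T)
              - gx T T * op_trace (Sh \<beta> \<circ> Sh \<beta>)))
        + (\<Sum>\<beta>\<in>nor. bb (F x) * ((op_trace (Sh \<beta>))\<^sup>2 - real n * op_trace (Sh \<beta> \<circ> Sh \<beta>)))
        + (\<Sum>\<beta>\<in>nor. \<Sum>\<gamma>\<in>nor. sg \<gamma> *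
              (op_trace (Sh \<gamma>) * op_trace (Sh \<beta> \<circ> Sh \<beta> \<circ> Sh \<gamma>)
               + op_trace (op_commutator (Sh \<gamma>) (Sh \<beta>) \<circ> op_commutator (Sh \<gamma>) (Sh \<beta>))
               - (op_trace (Sh \<beta> \<circ> Sh \<gamma>))\<^sup>2))"
    (is "_ = _ + _ + (\<Sum>\<beta>\<in>nor. ?grad \<beta>) - (\<Sum>\<beta>\<in>nor. ?db \<beta>) + (\<Sum>\<beta>\<in>nor. ?r\<xi> \<beta>)
       + (\<Sum>\<beta>\<in>nor. ?rT \<beta>) + (\<Sum>\<beta>\<in>nor. ?b \<beta>) + (\<Sum>\<beta>\<in>nor. ?quart \<beta>)")
proof -
  have drr: "(\<lambda>y. rr (F y)) differentiable (at x)" by (rule smooth_on_differentiable[OF rrF_smooth x])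
  have tr: "op_trace (Sh \<beta>) = mtr tng (h \<beta>)" if "\<beta> \<in> nor" for \<beta>
    by (rule represents_op_trace[OF represents_Sh[OF that]])
  have tr2: "op_trace (Sh \<beta> \<circ> Sh \<gamma>) = tr2 \<beta> \<gamma>" if "\<beta> \<in> nor" "\<gamma> \<in> nor" for \<beta> \<gamma>
    using represents_op_trace[OF represents_compose[OF represents_Sh[OF that(1)] represents_Sh[OF that(2)]]]
      mtr_mm_commute[of tng "h \<gamma>" "h \<beta>"] by simp
  have tr3: "op_trace (Sh \<beta> \<circ> Sh \<beta> \<circ> Sh \<gamma>) = mtr tng (mm tng (h \<gamma>) (mm tng (h \<beta>) (h \<beta>)))" if "\<beta> \<in> nor" "\<gamma> \<in> nor" for \<beta> \<gamma>
    by (rule represents_op_trace[OF represents_compose[OF represents_compose[OF represents_Sh[OF that(1)] represents_Sh[OF that(1)]] represents_Sh[OF that(2)]]])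
  have com: "op_trace (op_commutator (Sh \<gamma>) (Sh \<beta>) \<circ> op_commutator (Sh \<gamma>) (Sh \<beta>)) = mtr tng (mm tng (comm \<gamma> \<beta>) (comm \<gamma> \<beta>))"
    if "\<beta> \<in> nor" "\<gamma> \<in> nor" for \<beta> \<gamma>
    using represents_op_trace[OF represents_compose[OF represents_commutator[OF represents_Sh[OF that(2)] represents_Sh[OF that(1)]]
        represents_commutator[OF represents_Sh[OF that(2)] represents_Sh[OF that(1)]]]]
    by (simp add: comm_def[abs_def])
  have com': "mtr tng (mm tng (comm \<gamma> \<beta>) (comm \<gamma> \<beta>)) = mtr tng (mm tng (comm \<beta> \<gamma>) (comm \<beta> \<gamma>))" for \<beta> \<gamma>
  proof -
    have "comm \<gamma> \<beta> i j = - comm \<beta> \<gamma> i j" for i j by (simp add: comm_def)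
    then show ?thesis by (simp add: mtr_def mm_def)
  qed
  have tr\<xi>: "op_trace Sh\<xi> = (\<Sum>\<gamma>\<in>nor. \<eta> \<gamma> * \<tau> \<gamma> x * mtr tng (h \<gamma>))"
    unfolding Sh\<xi>_def represents_op_trace[OF represents_Sh\<xi>] mtr_def
    by (subst sum.swap) (simp add: sum_distrib_left)
  have tr2\<xi>: "op_trace (Sh\<xi> \<circ> Sh \<beta>) = (\<Sum>\<gamma>\<in>nor. \<eta> \<gamma> * \<tau> \<gamma> x * tr2 \<gamma> \<beta>)" if b: "\<beta> \<in> nor" for \<beta>
  proof -
    have "op_trace (Sh\<xi> \<circ> Sh \<beta>) = (\<Sum>i\<in>tng. \<Sum>k\<in>tng. \<Sum>\<gamma>\<in>nor. \<eta> \<gamma> * \<tau> \<gamma> x * (h \<beta> i k * h \<gamma> k i))"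
      unfolding Sh\<xi>_def represents_op_trace[OF represents_compose[OF represents_Sh\<xi> represents_Sh[OF b]]] mtr_def mm_def
      by (simp add: sum_distrib_left mult_ac)
    also have "\<dots> = (\<Sum>\<gamma>\<in>nor. \<Sum>i\<in>tng. \<Sum>k\<in>tng. \<eta> \<gamma> * \<tau> \<gamma> x * (h \<beta> i k * h \<gamma> k i))"
      by (rule trans[OF sum.cong[OF refl sum.swap] sum.swap])
    also have "\<dots> = (\<Sum>\<gamma>\<in>nor. \<eta> \<gamma> * \<tau> \<gamma> x * tr2 \<beta> \<gamma>)"
      by (simp add: mtr_def mm_def sum_distrib_left)
    finally show ?thesis by (simp add: mtr_mm_commute[of tng "h \<beta>"])
  qed
  have gT: "gx (Sh \<beta> T) T = (\<Sum>i\<in>tng. \<tau> i x * hT \<beta> i)" if "\<beta> \<in> nor" for \<beta>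
    by (subst gx_parseval) (simp add: gx_T gx_Sh_T that mult.commute)
  have gTT: "gx T T = (\<Sum>i\<in>tng. (\<tau> i x)\<^sup>2)"
    by (subst gx_parseval) (simp add: gx_T power2_eq_square)
  have gSS: "gx (Sh \<beta> T) (Sh \<beta> T) = (\<Sum>i\<in>tng. (hT \<beta> i)\<^sup>2)" if "\<beta> \<in> nor" for \<beta>
    by (subst gx_parseval) (simp add: gx_Sh_T that power2_eq_square)
  note gb = bilinear_lsub[OF gx_bilinear] bilinear_lmul[OF gx_bilinear] bilinear_rsub[OF gx_bilinear] bilinear_rmul[OF gx_bilinear]
  have gL: "gx (L \<beta> T) T = real n * (\<Sum>i\<in>tng. \<tau> i x * hT \<beta> i) - mtr tng (h \<beta>) * (\<Sum>i\<in>tng. (\<tau> i x)\<^sup>2)" if "\<beta> \<in> nor" for \<beta>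
    unfolding L_def by (simp add: gb gT gTT tr that)
  have ggrad: "gx (gradient gM (\<lambda>y. rr (F y)) x) v = (\<Sum>i\<in>tng. drr i * gx v (e i x))" for v
    by (subst gx_parseval) (simp add: gx_gradient[OF drr] drr_def)
  have gG: "gx (gradient gM (\<lambda>y. rr (F y)) x) (L \<beta> T)
     = real n * (\<Sum>i\<in>tng. drr i * hT \<beta> i) - mtr tng (h \<beta>) * (\<Sum>i\<in>tng. drr i * \<tau> i x)" if "\<beta> \<in> nor" for \<beta>
    unfolding L_def by (simp add: gb) (simp add: ggrad gx_Sh_T gx_T tr that)
  have \<xi>c: "\<xi>c \<beta> = \<tau> \<beta> x" if "\<beta> \<in> nor" for \<beta>
    unfolding \<xi>c_def by (rule G_\<xi>[OF that])
  have quart: "?quart \<beta> =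
     (\<Sum>\<gamma>\<in>nor. \<eta> \<gamma> * (mtr tng (h \<gamma>) * mtr tng (mm tng (h \<gamma>) (mm tng (h \<beta>) (h \<beta>)))
        + mtr tng (mm tng (comm \<beta> \<gamma>) (comm \<beta> \<gamma>)) - (tr2 \<beta> \<gamma>)\<^sup>2))" if "\<beta> \<in> nor" for \<beta>
    by (intro sum.cong refl) (simp add: eta_nor tr tr2 tr3 com com' that)
  have "(\<Sum>\<beta>\<in>nor. \<Sum>i\<in>tng. \<Sum>j\<in>tng. \<Sum>k\<in>tng. \<theta> i j \<beta> x * H4 \<beta> i j k k) =
    (\<Sum>\<beta>\<in>nor. (\<Sum>i\<in>tng. \<Sum>j\<in>tng. \<Sum>k\<in>tng. \<theta> i j \<beta> x * H4 \<beta> k k j i)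
      + ?grad \<beta> - ?db \<beta> + ?r\<xi> \<beta> + ?rT \<beta> + ?b \<beta> + ?quart \<beta>)"
  proof (rule sum.cong[OF refl])
    fix \<beta> assume b: "\<beta> \<in> nor"
    define q where "q = (\<Sum>i\<in>tng. \<tau> i x * hT \<beta> i)"
    define u2 where "u2 = (\<Sum>i\<in>tng. (\<tau> i x)\<^sup>2)"
    define v2 where "v2 = (\<Sum>i\<in>tng. (hT \<beta> i)\<^sup>2)"
    define X where "X = (\<Sum>\<gamma>\<in>nor. \<eta> \<gamma> * (mtr tng (h \<gamma>) * mtr tng (mm tng (h \<gamma>) (mm tng (h \<beta>) (h \<beta>)))
        + mtr tng (mm tng (comm \<beta> \<gamma>) (comm \<beta> \<gamma>)) - (tr2 \<beta> \<gamma>)\<^sup>2))"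
    define Y where "Y = (\<Sum>\<gamma>\<in>nor. \<eta> \<gamma> * \<tau> \<gamma> x * mtr tng (h \<gamma>))"
    define Z where "Z = (\<Sum>\<gamma>\<in>nor. \<eta> \<gamma> * \<tau> \<gamma> x * tr2 \<gamma> \<beta>)"
    define R where "R = (\<Sum>i\<in>tng. drr i * \<tau> i x)"
    define RH where "RH = (\<Sum>i\<in>tng. drr i * hT \<beta> i)"
    note folds = q_def[symmetric] u2_def[symmetric] v2_def[symmetric] X_def[symmetric] Y_def[symmetric] Z_def[symmetric]
      R_def[symmetric] RH_def[symmetric]
    show "(\<Sum>i\<in>tng. \<Sum>j\<in>tng. \<Sum>k\<in>tng. \<theta> i j \<beta> x * H4 \<beta> i j k k) =
      (\<Sum>i\<in>tng. \<Sum>j\<in>tng. \<Sum>k\<in>tng. \<theta> i j \<beta> x * H4 \<beta> k k j i)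
      + ?grad \<beta> - ?db \<beta> + ?r\<xi> \<beta> + ?rT \<beta> + ?b \<beta> + ?quart \<beta>"
      unfolding quart[OF b] gG[OF b] gL[OF b] gT[OF b] gSS[OF b] gTT tr[OF b] tr2[OF b b] tr\<xi> tr2\<xi>[OF b] \<xi>c[OF b]
        h_def[symmetric] contracted_H4[OF b] codazzi_contraction[OF b] ricci_contraction[OF b] folds
      by (simp add: algebra_simps)
  qed
  moreover have "1/2 * (\<Sum>k\<in>tng. d k (\<lambda>y. d k sq_norm y) x) =
     (\<Sum>\<beta>\<in>nor. \<Sum>i\<in>tng. \<Sum>j\<in>tng. \<Sum>k\<in>tng. \<theta> i j \<beta> x * H4 \<beta> i j k k)
     + (\<Sum>\<beta>\<in>nor. \<Sum>i\<in>tng. \<Sum>j\<in>tng. \<Sum>k\<in>tng. (H3 \<beta> i j k x)\<^sup>2)"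
    by (rule laplacian_sq_norm[OF w0 dw0])
  ultimately show ?thesis
    unfolding sum.distrib sum_subtractf by linarith
qed

end

section \<open>The identity for space forms\<close>

text \<open>
  The relation \<open>b' = 2 \<epsilon> (a'/a) r\<close> turns the multiple of \<open>a'/a\<close> that the Codazzi terms produce into the term with
  \<open>b'\<close>.
\<close>

lemma warping_functions:
  fixes a :: "real \<Rightarrow> real" and c :: real
  assumes a: "smooth_on a I" and I: "open I" and pos: "\<And>t. t \<in> I \<Longrightarrow> 0 < a t" and eps: "\<epsilon> \<in> {-1, 1}"
  defines "b \<equiv> \<lambda>t. (\<epsilon> * (deriv a t)\<^sup>2 - c) / (a t)\<^sup>2"
  defines "r \<equiv> \<lambda>t. deriv (deriv a) t / a t - \<epsilon> * b t"
  shows "smooth_on r I" and "t \<in> I \<Longrightarrow> deriv b t = 2 * \<epsilon> * (deriv a t / a t) * r t"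
proof -
  have nz: "a t \<noteq> 0" if "t \<in> I" for t using pos[OF that] by simp
  note a1 = smooth_on_real_deriv(1)[OF a I]
  note a2 = smooth_on_real_deriv(1)[OF a1 I]
  show "smooth_on r I"
    unfolding r_def b_def power2_eq_square
    by (intro smooth_on_diff smooth_on_divide smooth_on_mult smooth_on_const I a a1 a2) (auto dest: nz)
  assume t: "t \<in> I"
  have "(b has_real_derivative ((\<epsilon> * (2 * deriv a t * deriv (deriv a) t)) * (a t)\<^sup>2
      - (\<epsilon> * (deriv a t)\<^sup>2 - c) * (2 * a t * deriv a t)) / ((a t)\<^sup>2 * (a t)\<^sup>2)) (at t)"
    unfolding b_def using nz[OF t]
    by (auto intro!: derivative_eq_intros smooth_on_real_deriv(2)[OF a I t] smooth_on_real_deriv(2)[OF a1 I t]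
        simp: power2_eq_square)
  then have "deriv b t = ((\<epsilon> * (2 * deriv a t * deriv (deriv a) t)) * (a t)\<^sup>2
      - (\<epsilon> * (deriv a t)\<^sup>2 - c) * (2 * a t * deriv a t)) / ((a t)\<^sup>2 * (a t)\<^sup>2)"
    by (rule DERIV_imp_deriv)
  also have "\<dots> = 2 * \<epsilon> * (deriv a t / a t) * r t"
  proof -
    have "\<epsilon> * (deriv a t)\<^sup>2 - c = b t * (a t)\<^sup>2" using nz[OF t] by (simp add: b_def)
    then have "(\<epsilon> * (2 * deriv a t * deriv (deriv a) t)) * (a t)\<^sup>2 - (\<epsilon> * (deriv a t)\<^sup>2 - c) * (2 * a t * deriv a t)
      = 2 * (deriv a t / a t) * (\<epsilon> * (deriv (deriv a) t / a t) - b t) * ((a t)\<^sup>2 * (a t)\<^sup>2)"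
      using nz[OF t] by (simp add: power2_eq_square field_simps)
    moreover have "\<epsilon> * (deriv (deriv a) t / a t) - b t = \<epsilon> * r t"
      using eps by (auto simp: r_def)
    ultimately show ?thesis using nz[OF t] by simp
  qed
  finally show "deriv b t = 2 * \<epsilon> * (deriv a t / a t) * r t" .
qed

lemma smooth_atlas_chart:
  assumes "smooth_atlas \<A>" "A \<in> \<A>"
  shows "open (fst A)" "open (snd A ` fst A)" "inj_on (snd A) (fst A)"
    "U \<subseteq> fst A \<Longrightarrow> open U \<Longrightarrow> open (snd A ` U)"
proof -
  obtain V \<phi> where A: "A = (V, \<phi>)" by (cases A)
  have op: "open V" "open (\<phi> ` V)" and hom: "homeomorphism V (\<phi> ` V) \<phi> (inv_into V \<phi>)"
    using assms unfolding A smooth_atlas_def by auto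
  show "open (fst A)" "open (snd A ` fst A)" using op by (simp_all add: A)
  show "inj_on (snd A) (fst A)"
    using hom unfolding A homeomorphism_def by (auto intro: inj_on_inverseI)
  assume U: "U \<subseteq> fst A" "open U"
  have "openin (top_of_set (\<phi> ` V)) (\<phi> ` U)"
    by (rule homeomorphism_imp_open_map[OF hom]) (use U op in \<open>simp add: A open_openin_trans open_subset\<close>)
  then show "open (snd A ` U)" using op by (simp add: A openin_open_trans)
qed

theorem theorem1:
  fixes \<A> :: "('m::{t2_space,second_countable_topology}, real^'n) chart set"
    and \<B> :: "('q::{t2_space,second_countable_topology}, real^'k) chart set"
    and g :: "('q, real^'k) chart \<Rightarrow> real^'k \<Rightarrow> real^'k \<Rightarrow> real^'k \<Rightarrow> real"
    and f :: "'m \<Rightarrow> real \<times> 'q"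
    and I :: "real set" and a :: "real \<Rightarrow> real" and \<epsilon> c :: real and s m :: nat
    and A :: "('m, real^'n) chart" and B :: "('q, real^'k) chart"
    and p :: 'm and N :: "'m set"
    and e :: "nat \<Rightarrow> real^'n \<Rightarrow> real^'n" and \<nu> :: "nat \<Rightarrow> real^'n \<Rightarrow> real \<times> (real^'k)"
    and sg :: "nat \<Rightarrow> real"
  assumes dims: "CARD('k) = CARD('n) + m"
    and M: "smooth_atlas \<A>"
    and Q: "constant_curvature_manifold \<B> g s c"
    and I: "open I" "is_interval I"
    and a: "smooth_on a I" "\<And>t. t \<in> I \<Longrightarrow> 0 < a t"
    and eps: "\<epsilon> \<in> {-1, 1}"
    and f: "spacelike_immersion \<A> \<B> g I \<epsilon> a f"
    and charts: "A \<in> \<A>" "B \<in> \<B>"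
    and N: "open N" "p \<in> N" "N \<subseteq> coord_domain f A B"
    and frame: "adapted_frame (warped_metric \<epsilon> a (g B)) (coord_rep f A B) (snd A ` N) (snd A p)
                  m e \<nu> sg"
    and splitting: "sign_splitting_parallel_at (warped_metric \<epsilon> a (g B)) (coord_rep f A B) (snd A p)
                  m e \<nu> sg"
  shows
    "let n = CARD('n);
         Nor = {n+1..n+m+1};
         G = warped_metric \<epsilon> a (g B);
         F = coord_rep f A B;
         gM = induced_metric G F;
         x = snd A p;
         h = (\<lambda>\<beta> i j y. G (F y) (second_ff G F (e i) (e j) y) (\<nu> \<beta> y));
         h3 = (\<lambda>\<beta> i j k. G (F x) (nabla_second_ff G F (e k) (e i) (e j) x) (\<nu> \<beta> x));
         h4 = (\<lambda>\<beta> i j k l. G (F x) (nabla2_second_ff G F (e l) (e k) (e i) (e j) x) (\<nu> \<beta> x));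
         norm2_\<alpha> = (\<lambda>y. \<Sum>\<beta>\<in>Nor. \<Sum>i=1..n. \<Sum>j=1..n. (h \<beta> i j y)\<^sup>2);
         norm2_D\<alpha> = (\<Sum>\<beta>\<in>Nor. \<Sum>i=1..n. \<Sum>j=1..n. \<Sum>k=1..n. (h3 \<beta> i j k)\<^sup>2);
         b = (\<lambda>t. (\<epsilon> * (deriv a t)\<^sup>2 - c) / (a t)\<^sup>2);
         r = (\<lambda>t. deriv (deriv a) t / a t - \<epsilon> * b t);
         t = fst (F x);
         T = tangent_part G F x (1, 0);
         \<xi> = normal_part G F x (1, 0);
         \<xi>c = (\<lambda>\<beta>. G (F x) \<xi> (\<nu> \<beta> x));
         Sh = (\<lambda>\<beta>. shape_op G F x (\<nu> \<beta> x));
         Sh\<xi> = shape_op G F x \<xi>;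
         L = (\<lambda>\<beta> u. real n *\<^sub>R Sh \<beta> u - op_trace (Sh \<beta>) *\<^sub>R u)
     in 1/2 * laplacian gM norm2_\<alpha> x =
          (\<Sum>\<beta>\<in>Nor. \<Sum>i=1..n. \<Sum>j=1..n. \<Sum>k=1..n. h \<beta> i j x * h4 \<beta> k k j i)
        + norm2_D\<alpha>
        + (\<Sum>\<beta>\<in>Nor. gM x (gradient gM (\<lambda>y. r (fst (F y))) x) (L \<beta> T) * \<xi>c \<beta>)
        - (\<Sum>\<beta>\<in>Nor. deriv b t * gM x (L \<beta> T) T * \<xi>c \<beta>)
        + (\<Sum>\<beta>\<in>Nor. r t * (real n * op_trace (Sh\<xi> \<circ> Sh \<beta>) - op_trace Sh\<xi> * op_trace (Sh \<beta>))
              * \<xi>c \<beta>)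
        + (\<Sum>\<beta>\<in>Nor. r t * (3 * gM x (Sh \<beta> T) T * op_trace (Sh \<beta>)
              - 2 * real n * gM x (Sh \<beta> T) (Sh \<beta> T)
              - gM x T T * op_trace (Sh \<beta> \<circ> Sh \<beta>)))
        + (\<Sum>\<beta>\<in>Nor. b t * ((op_trace (Sh \<beta>))\<^sup>2 - real n * op_trace (Sh \<beta> \<circ> Sh \<beta>)))
        + (\<Sum>\<beta>\<in>Nor. \<Sum>\<gamma>\<in>Nor. sg \<gamma> *
              (op_trace (Sh \<gamma>) * op_trace (Sh \<beta> \<circ> Sh \<beta> \<circ> Sh \<gamma>)
               + op_trace (op_commutator (Sh \<gamma>) (Sh \<beta>) \<circ> op_commutator (Sh \<gamma>) (Sh \<beta>))
               - (op_trace (Sh \<beta> \<circ> Sh \<gamma>))\<^sup>2))"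
proof -
  let ?W = "warped_metric \<epsilon> a (g B)" and ?F = "coord_rep f A B" and ?S = "snd A ` N"
    and ?V = "snd B ` fst B" and ?x = "snd A p"
  define b where "b t = (\<epsilon> * (deriv a t)\<^sup>2 - c) / (a t)\<^sup>2" for t
  define r where "r t = deriv (deriv a) t / a t - \<epsilon> * b t" for t
  define lam where "lam t = deriv a t / a t" for t
  have r: "smooth_on r I" and db: "deriv b t = 2 * \<epsilon> * lam t * r t" if "t \<in> I" for t
    using warping_functions[OF a(1) I(1) a(2) eps, where c = c] that
    unfolding r_def[abs_def] b_def[abs_def] lam_def by auto
  have atlB: "smooth_atlas \<B>" and semiB: "semi_riemannian_metric \<B> g"
    and constB: "\<forall>(U, \<phi>)\<in>\<B>. (\<forall>x\<in>\<phi> ` U. form_index (g (U, \<phi>) x) = s) \<and> constant_curvature_on (g (U, \<phi>)) c (\<phi> ` U)"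
    using Q unfolding constant_curvature_manifold_def by blast+
  have metB: "metric_on (g B) ?V"
    using bspec[OF conjunct1[OF semiB[unfolded semi_riemannian_metric_def]] charts(2)] by (simp add: case_prod_beta)
  have curvB: "constant_curvature_on (g B) c ?V"
    using bspec[OF constB charts(2)] by (simp add: case_prod_beta)
  have V: "open ?V" by (rule smooth_atlas_chart[OF atlB charts(2)])
  have NA: "N \<subseteq> fst A" using N(3) by (auto simp: coord_domain_def)
  have S: "open ?S" by (rule smooth_atlas_chart(4)[OF M charts(1) NA N(1)])
  note injA = smooth_atlas_chart(3)[OF M charts(1)]
  have sub: "?S \<subseteq> snd A ` coord_domain f A B" using N(3) by blast
  have FS: "?F ` ?S \<subseteq> I \<times> ?V"
  proof (rule subsetI)
    fix z assume "z \<in> ?F ` ?S"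
    then obtain q where q: "q \<in> N" and z: "z = ?F (snd A q)" by blast
    then have "inv_into (fst A) (snd A) (snd A q) = q" using injA NA by auto
    then have "?F (snd A q) = (fst (f q), snd B (snd (f q)))"
      by (simp add: coord_rep_def map_prod_def split_beta)
    moreover have "f q \<in> I \<times> UNIV"
      using conjunct1[OF f[unfolded spacelike_immersion_def]] by blast
    then have "fst (f q) \<in> I" by (rule mem_Times_iff[THEN iffD1, THEN conjunct1])
    moreover have "snd (f q) \<in> fst B" using N(3) q by (auto simp: coord_domain_def)
    ultimately show "z \<in> I \<times> ?V" unfolding z by auto
  qed
  interpret W: warped_product "g B" ?V a I \<epsilon>
    using metB V smooth_on_christoffel[OF metB V] a I(1) eps by unfold_locales auto
  have curvature: "coord_curvature (christoffel (g B)) (snd z) u v w = c *\<^sub>R (g B (snd z) v w *\<^sub>R u - g B (snd z) u w *\<^sub>R v)"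
    if "z \<in> I \<times> ?V" for z u v w
    by (rule constant_curvature_tensor[OF metB V _ smooth_on_christoffel[OF metB V] curvB]) (use that in auto)
  note fr = frame[unfolded adapted_frame_def]
  interpret C: adapted_chart ?W "I \<times> ?V" ?F ?S "CARD('n)" m e \<nu> sg ?x "(1, 0)"
      "\<lambda>z. b (fst z)" "\<lambda>z. r (fst z)" "\<lambda>z. lam (fst z)" \<epsilon>
  proof
    show "smooth_on ?F ?S"
      using f charts smooth_on_subset[OF _ sub] unfolding spacelike_immersion_def by blast
    show "0 < induced_metric ?W ?F y u u" if "y \<in> ?S" "u \<noteq> 0" for y u
      using f charts sub that unfolding spacelike_immersion_def by blast
    show "?x \<in> ?S" using N(2) by blast
    show "DIM(real \<times> (real^'k)) = CARD('n) + m + 1" using dims by simp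
    show "?W z (coord_curvature (christoffel ?W) z u v w) y =
     - b (fst z) * (?W z v w * ?W z u y - ?W z u w * ?W z v y)
     - r (fst z) * (?W z v w * ?W z u (1, 0) * ?W z y (1, 0) - ?W z u w * ?W z v (1, 0) * ?W z y (1, 0)
          + ?W z v (1, 0) * ?W z w (1, 0) * ?W z u y - ?W z u (1, 0) * ?W z w (1, 0) * ?W z v y)"
      if "z \<in> I \<times> ?V" for z u v w y
      by (rule W.warped_constant_curvature[OF that curvature[OF that]]) (simp_all add: b_def r_def)
    show "christoffel ?W z u (1, 0) = lam (fst z) *\<^sub>R (u - (\<epsilon> * ?W z u (1, 0)) *\<^sub>R (1, 0))" if "z \<in> I \<times> ?V" for z u
      unfolding lam_def by (rule W.warped_christoffel_dt[OF that])
    show "smooth_on (\<lambda>z. r (fst z)) (I \<times> ?V)"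
    proof -
      have "?F ?x \<in> I \<times> ?V" using FS N(2) by blast
      then have "smooth_on r I" using r by (cases "?F ?x") auto
      then show ?thesis by (rule W.smooth_on_warp)
    qed
  qed (use W.warped_metric_on W.open_domain W.smooth_on_warped_christoffel S FS fr in \<open>blast+\<close>)
  have t: "fst (?F ?x) \<in> I" using FS N(2) by fastforce
  note tng = C.tng_def and nor = C.nor_def
  have w0: "C.\<theta> k \<beta> \<gamma> ?x = 0" and dw0: "(\<Sum>k\<in>C.tng. fd (C.\<theta> k \<beta> \<gamma>) ?x (e k ?x)) = 0"
    if "\<beta> \<in> C.nor" "\<gamma> \<in> C.nor" "sg \<beta> \<noteq> sg \<gamma>" "k \<in> C.tng" for \<beta> \<gamma> k
    using C.splitting_frame[OF _ _ that(1,2,3)] splitting that(4) unfolding sign_splitting_parallel_at_def tng nor by blast+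
  have dw0: "(\<Sum>k\<in>C.tng. fd (C.\<theta> k \<beta> \<gamma>) ?x (e k ?x)) = 0"
    if "\<beta> \<in> C.nor" "\<gamma> \<in> C.nor" "sg \<beta> \<noteq> sg \<gamma>" for \<beta> \<gamma>
    using dw0[OF that, of 1] by (simp add: tng)
  have sq: "(\<Sum>\<beta>\<in>C.nor. \<Sum>i\<in>C.tng. \<Sum>j\<in>C.tng. (?W (?F y) (second_ff ?W ?F (e i) (e j) y) (\<nu> \<beta> y))\<^sup>2) = C.sq_norm y"
    if "y \<in> ?S" for y
    unfolding C.sq_norm_def by (intro sum.cong refl) (simp add: C.second_ff_frame that)
  \<comment> \<open>the two functions agree only on \<open>?S\<close>, but the Laplacian is local\<close>
  have lap: "laplacian C.gM (\<lambda>y. \<Sum>\<beta>\<in>C.nor. \<Sum>i\<in>C.tng. \<Sum>j\<in>C.tng. (?W (?F y) (second_ff ?W ?F (e i) (e j) y) (\<nu> \<beta> y))\<^sup>2) ?x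
     = (\<Sum>k\<in>C.tng. fd (\<lambda>y. fd C.sq_norm y (e k y)) ?x (e k ?x))"
  proof -
    let ?s = "\<lambda>y. \<Sum>\<beta>\<in>C.nor. \<Sum>i\<in>C.tng. \<Sum>j\<in>C.tng. (?W (?F y) (second_ff ?W ?F (e i) (e j) y) (\<nu> \<beta> y))\<^sup>2"
    have sm: "smooth_on ?s ?S" by (rule smooth_on_cong[OF S C.sq_norm_smooth]) (simp add: sq)
    have d1: "fd ?s y = fd C.sq_norm y" if "y \<in> ?S" for y
      by (rule fd_cong_open(2)[OF S that]) (use sq smooth_on_differentiable[OF C.sq_norm_smooth that] in auto)
    have "fd (\<lambda>y. fd ?s y (e k y)) ?x = fd (\<lambda>y. fd C.sq_norm y (e k y)) ?x" if "k \<in> C.tng" for k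
      by (rule fd_cong_open(2)[OF S C.x]) (use d1 smooth_on_differentiable[OF C.d_smooth[OF that C.sq_norm_smooth] C.x] in auto)
    then show ?thesis unfolding C.laplacian_frame[OF sm] by simp
  qed
  have h4: "(\<Sum>\<beta>\<in>C.nor. \<Sum>i\<in>C.tng. \<Sum>j\<in>C.tng. \<Sum>k\<in>C.tng. ?W (?F ?x) (second_ff ?W ?F (e i) (e j) ?x) (\<nu> \<beta> ?x)
       * ?W (?F ?x) (nabla2_second_ff ?W ?F (e i) (e j) (e k) (e k) ?x) (\<nu> \<beta> ?x))
     = (\<Sum>\<beta>\<in>C.nor. \<Sum>i\<in>C.tng. \<Sum>j\<in>C.tng. \<Sum>k\<in>C.tng. C.\<theta> i j \<beta> ?x * C.H4 \<beta> k k j i)"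
    by (intro sum.cong refl) (simp add: C.second_ff_frame[OF C.x] C.nabla2_second_ff_frame)
  have h3: "(\<Sum>\<beta>\<in>C.nor. \<Sum>i\<in>C.tng. \<Sum>j\<in>C.tng. \<Sum>k\<in>C.tng. (?W (?F ?x) (nabla_second_ff ?W ?F (e k) (e i) (e j) ?x) (\<nu> \<beta> ?x))\<^sup>2)
     = (\<Sum>\<beta>\<in>C.nor. \<Sum>i\<in>C.tng. \<Sum>j\<in>C.tng. \<Sum>k\<in>C.tng. (C.H3 \<beta> i j k ?x)\<^sup>2)"
    by (intro sum.cong refl) (simp add: C.nabla_second_ff_frame[OF C.x])
  show ?thesis
    unfolding Let_def tng[symmetric] nor[symmetric] lap h4 h3 b_def[abs_def, symmetric] b_def[symmetric] r_def[symmetric] db[OF t]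
    by (rule C.simons_identity[OF w0 dw0])
qed

end
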